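(* Let $b,p,q,f,g$ satisfy the hypotheses (h1)-(h4) and the accompanying conditions listed in the context. Then there exists $\varepsilon_0>0$ such that for $|\varepsilon|<\varepsilon_0$ the solution $(u,v)$ (the one obtained by local linking as described in the context) of $$u_{tt}-u_{xx}+bu+\varepsilon v+f(t,x,u)=0,\qquad v_{tt}-v_{xx}+bv+\varepsilon u+g(t,x,v)=0,$$ with $u,v$ vanishing at $x=0,\pi$ and $2\pi$-periodic in $t$, lies in $L^\infty(\Omega)\times L^\infty(\Omega)$, where $L^\infty(\Omega)$ is the Lebesgue space with the norm $\|w\|_{L^\infty}=\inf\{C\ge0:|w(t,x)|\le C\text{ for almost every }(t,x)\in\Omega\}<\infty$.
   Context: $\Omega=[0,2\pi]\times[0,\pi]$, $L=\partial_t^2-\partial_x^2$ with Dirichlet conditions in $x$ at $0,\pi$ and $2\pi$-periodicity in $t$, $\sigma(L)=\{j^2-k^2:j\in\mathbb{Z}_+,k\in\mathbb{Z}\}$, $\mathbb{Z}_+=\{1,2,\dots\}$. Hypotheses: $b>0$, $-b\notin\sigma(L)$, $f,g\in C(\Omega\times\mathbb{R},\mathbb{R})$ are $2\pi$-periodic in $t$, $F(t,x,\xi)=\int_0^\xi f(t,x,s)ds$, $G(t,x,\xi)=\int_0^\xi g(t,x,s)ds$, and: (h1) there are $p>1$, $q>1$, $c_0>0$ with $|f(t,x,\xi)|\le c_0(1+|\xi|^p)$ and $|g(t,x,\xi)|\le c_0(1+|\xi|^q)$ for all $t,x,\xi$; (h2) $f(t,x,\xi)=o(|\xi|)$, $g(t,x,\xi)=o(|\xi|)$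 as $\xi\to0$ uniformly in $(t,x)$; (h3) $(p+1)F\le f\xi$ and $(q+1)G\le g\xi$ for all $t,x,\xi$; (h4) $f,g$ are nondecreasing in $\xi$. Spaces: $u\in L^2(\Omega)$ is expanded as $u=\sum u_{jk}\sin(jx)e^{ikt}$, $\overline{u_{jk}}=u_{j,-k}$. $H=\{u\in L^2(\Omega):\|u\|_H^2=\pi^2\sum_{j\ne|k|}|j^2-k^2+b||u_{jk}|^2+\pi^2\sum_{j=|k|}|u_{jk}|^2<\infty\}$; $E=H\times H$ with $\|(u,v)\|_E=(\|u\|_H^2+\|v\|_H^2)^{1/2}$. $H_b^+,H_b^-,H^0$ are the closed subspaces of $H$ spanned by the $\sin(jx)e^{ikt}$ with, respectively, $j^2-k^2>-b$ and $j\ne|k|$; $j^2-k^2<-b$; $j=|k|$. $E^1=H_b^-\times H_b^-$, $E^2=(H_b^+\times H_b^+)\oplus(H^0\times H^0)$; $E_m^j=\mathrm{span}\{e_1^j,\dots,e_m^j\}$ where $(e_n^j)_{n\ge1}$ is a basis of $E^j$, $j=1,2$. Functional: $\Phi(u,v)=-\frac12\langle Lu,u\rangle-\frac b2\int u^2-\frac12\langle Lv,v\rangle-\frac b2\int v^2-\varepsilon\int uv-\int F(t,x,u)-\int G(t,x,v)$ on $E$, with $\int=\iint_\Omega\cdot\,dt\,dx$ and $\langle Lu,\varphi\rangle=\pi^2\sum(j^2-k^2)u_{jk}\overline{\varphi_{jk}}$. Its critical points in $E$ are the weak solutions of the system, i.e. $\iint_\Omega[u(\varphi_{tt}-\varphi_{xx})+bu\varphi+\varepsilon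 v\varphi+f(t,x,u)\varphi]\,dt\,dx=0$ and $\iint_\Omega[v(\psi_{tt}-\psi_{xx})+bv\psi+\varepsilon u\psi+g(t,x,v)\psi]\,dt\,dx=0$ for all $\varphi,\psi\in H$ satisfying the Dirichlet and periodicity conditions. Solutions obtained by local linking: under the hypotheses above, the existence result for the system asserts that for all sufficiently small $|\varepsilon|$ the system has at least one nontrivial weak solution with time period $2\pi$. It is obtained as the nontrivial critical point in $E$ of $\Phi$ furnished by the local linking theorem: if a $C^1$ functional on $E=E^1\oplus E^2$ satisfies the (PS)$^*$ condition, has a local linking at $0$ (for some $r>0$ it is $\ge0$ on $\{w\in E^1:\|w\|\le r\}$ and $\le0$ on $\{w\in E^2:\|w\|\le r\}$), maps bounded sets into bounded sets, and for every $m$ tends to $-\infty$ as $\|w\|\to\infty$ with $w\in E^1_m\oplus E^2$, then it has a nontrivial critical point. Here (PS)$^*$ means: with $E_\theta=E^1_{\theta^1}\oplus E^2_{\theta^2}$ and $\Phi_\theta=\Phi|_{E_\theta}$ for $\theta=(\theta^1,\theta^2)\in\mathbb{N}^2$, every sequence $w_n\in E_{\theta_n}$ such that both components of $\theta_n$ tend to infinity, $\sup_n\Phi(w_n)<\infty$ and $\Phi'_{\theta_n}(w_n)\to0$ has a subsequence converging to a critical point of $\Phi$. *)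

theory Defs
  imports "HOL-Analysis.Analysis"
begin

definition Omega :: "(real \<times> real) set"
  where "Omega = {0..2 * pi} \<times> {0..pi}"

abbreviation M\<^sub>\<Omega> :: "(real \<times> real) measure"
  where "M\<^sub>\<Omega> \<equiv> lebesgue_on Omega"

text \<open>Elements of function spaces on the domain are represented by functions of the pair
  \<open>(t, x)\<close>; values outside \<open>Omega\<close> and on null sets are irrelevant.\<close>

definition L2 :: "(real \<times> real \<Rightarrow> real) set"
  where "L2 = {u. u \<in> borel_measurable M\<^sub>\<Omega> \<and> integrable M\<^sub>\<Omega> (\<lambda>z. (u z)\<^sup>2)}"

definition Linf_norm :: "(real \<times> real \<Rightarrow> real) \<Rightarrow> ennreal"
  where "Linf_norm w = (INF C \<in> {C::real. 0 \<le> C \<and> (AE z in M\<^sub>\<Omega>. \<bar>w z\<bar> \<le> C)}. ennreal C)"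

definition Linf :: "(real \<times> real \<Rightarrow> real) set"
  where "Linf = {w. w \<in> borel_measurable M\<^sub>\<Omega> \<and> Linf_norm w < \<infinity>}"

definition modes :: "(nat \<times> int) set"
  where "modes = {1..} \<times> UNIV"

text \<open>The eigenvalue of \<open>L\<close> on the mode \<open>sin (j x) exp (i k t)\<close>.\<close>

definition eigval :: "nat \<Rightarrow> int \<Rightarrow> real"
  where "eigval j k = (real j)\<^sup>2 - (real_of_int k)\<^sup>2"

definition spectrum_L :: "real set"
  where "spectrum_L = (\<lambda>(j, k). eigval j k) ` modes"

text \<open>The coefficient of \<open>sin (j x) exp (i k t)\<close> in the expansion of \<open>u\<close>; this function has
  squared norm \<open>pi\<^sup>2\<close> in \<open>L2\<close>.\<close>

definition fourier_coeff :: "(real \<times> real \<Rightarrow> real) \<Rightarrow> nat \<Rightarrow> int \<Rightarrow> complex"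
  where "fourier_coeff u j k =
    (1 / complex_of_real (pi\<^sup>2)) *
    (\<integral>(t, x). complex_of_real (u (t, x) * sin (real j * x)) * cis (- (real_of_int k * t)) \<partial>M\<^sub>\<Omega>)"

definition H_weight :: "real \<Rightarrow> nat \<Rightarrow> int \<Rightarrow> real"
  where "H_weight b j k = (if int j = \<bar>k\<bar> then 1 else \<bar>eigval j k + b\<bar>)"

definition H_space :: "real \<Rightarrow> (real \<times> real \<Rightarrow> real) set"
  where "H_space b = {u \<in> L2.
    (\<lambda>(j, k). pi\<^sup>2 * H_weight b j k * (cmod (fourier_coeff u j k))\<^sup>2) summable_on modes}"

text \<open>The pairing \<open>\<langle>L u, \<phi>\<rangle>\<close>. For real functions the coefficients of opposite \<open>k\<close> are conjugate,
  so the sum is real and taking the real part only changes its type. It is the meaning of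
  the integral of \<open>u (\<phi>\<^sub>t\<^sub>t - \<phi>\<^sub>x\<^sub>x)\<close> over the domain when \<open>\<phi>\<close> is merely in \<open>H\<close>; the Dirichlet
  and periodicity conditions are carried by the expansion in the modes.\<close>

definition L_pairing :: "(real \<times> real \<Rightarrow> real) \<Rightarrow> (real \<times> real \<Rightarrow> real) \<Rightarrow> real"
  where "L_pairing u \<phi> = pi\<^sup>2 *
    Re (\<Sum>\<^sub>\<infinity>(j, k)\<in>modes.
          complex_of_real (eigval j k) * fourier_coeff u j k * cnj (fourier_coeff \<phi> j k))"

definition primitive :: "(real \<Rightarrow> real \<Rightarrow> real \<Rightarrow> real) \<Rightarrow> real \<Rightarrow> real \<Rightarrow> real \<Rightarrow> real"
  where "primitive f t x \<xi> = (LBINT s=ereal 0..ereal \<xi>. f t x s)"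

text \<open>The nonlinearity is given on one period, so \<open>2 pi\<close>-periodicity in \<open>t\<close> only concerns the
  end points. The \<open>uniform_limit\<close> says \<open>f(t, x, \<xi>) = o(\<bar>\<xi>\<bar>)\<close> as \<open>\<xi>\<close> tends to \<open>0\<close>, uniformly in
  \<open>(t, x)\<close>.\<close>

definition admissible_nonlinearity ::
    "real \<Rightarrow> real \<Rightarrow> (real \<Rightarrow> real \<Rightarrow> real \<Rightarrow> real) \<Rightarrow> bool"
  where "admissible_nonlinearity c\<^sub>0 p f \<longleftrightarrow>
    continuous_on (Omega \<times> UNIV) (\<lambda>((t, x), \<xi>). f t x \<xi>) \<and>
    (\<forall>x\<in>{0..pi}. \<forall>\<xi>. f (2 * pi) x \<xi> = f 0 x \<xi>) \<and>
    (\<forall>(t, x)\<in>Omega. \<forall>\<xi>. \<bar>f t x \<xi>\<bar> \<le> c\<^sub>0 * (1 + \<bar>\<xi>\<bar> powr p)) \<and>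
    uniform_limit Omega (\<lambda>\<xi> (t, x). f t x \<xi> / \<bar>\<xi>\<bar>) (\<lambda>_. 0) (at 0) \<and>
    (\<forall>(t, x)\<in>Omega. \<forall>\<xi>. (p + 1) * primitive f t x \<xi> \<le> f t x \<xi> * \<xi>) \<and>
    (\<forall>(t, x)\<in>Omega. mono (f t x))"

text \<open>Weak solutions in \<open>E = H \<times> H\<close>, that is, critical points in \<open>E\<close> of the functional
  \<open>\<Phi>(u, v) = - \<langle>L u, u\<rangle>/2 - b/2 \<integral>u\<^sup>2 - \<langle>L v, v\<rangle>/2 - b/2 \<integral>v\<^sup>2 - \<epsilon> \<integral>u v - \<integral>F(t, x, u) - \<integral>G(t, x, v)\<close>,
  where \<open>F\<close> and \<open>G\<close> are the primitives of \<open>f\<close> and \<open>g\<close>: the two equations are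
  \<open>\<Phi>'(u, v)(\<phi>, 0) = 0\<close> and \<open>\<Phi>'(u, v)(0, \<psi>) = 0\<close> with the sign reversed. Integrability of
  the nonlinear terms has to be demanded: the Bochner integral of a non-integrable function
  is \<open>0\<close>, and for \<open>u\<close> in \<open>H\<close> polynomial growth of \<open>f\<close> alone does not ensure it, since on the
  kernel of \<open>L\<close> the norm of \<open>H\<close> is only the \<open>L2\<close> norm.\<close>

definition weak_solution ::
    "real \<Rightarrow> real \<Rightarrow> (real \<Rightarrow> real \<Rightarrow> real \<Rightarrow> real) \<Rightarrow> (real \<Rightarrow> real \<Rightarrow> real \<Rightarrow> real) \<Rightarrow>
     (real \<times> real \<Rightarrow> real) \<Rightarrow> (real \<times> real \<Rightarrow> real) \<Rightarrow> bool"
  where "weak_solution b \<epsilon> f g u v \<longleftrightarrow>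
    u \<in> H_space b \<and> v \<in> H_space b \<and>
    (\<forall>\<phi>\<in>H_space b.
       integrable M\<^sub>\<Omega> (\<lambda>(t, x). f t x (u (t, x)) * \<phi> (t, x)) \<and>
       L_pairing u \<phi> +
         (\<integral>(t, x). b * u (t, x) * \<phi> (t, x) + \<epsilon> * v (t, x) * \<phi> (t, x)
            + f t x (u (t, x)) * \<phi> (t, x) \<partial>M\<^sub>\<Omega>) = 0) \<and>
    (\<forall>\<psi>\<in>H_space b.
       integrable M\<^sub>\<Omega> (\<lambda>(t, x). g t x (v (t, x)) * \<psi> (t, x)) \<and>
       L_pairing v \<psi> +
         (\<integral>(t, x). b * v (t, x) * \<psi> (t, x) + \<epsilon> * u (t, x) * \<psi> (t, x)
            + g t x (v (t, x)) * \<psi> (t, x) \<partial>M\<^sub>\<Omega>) = 0)"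

definition nontrivial_pair :: "(real \<times> real \<Rightarrow> real) \<Rightarrow> (real \<times> real \<Rightarrow> real) \<Rightarrow> bool"
  where "nontrivial_pair u v \<longleftrightarrow> \<not> (AE z in M\<^sub>\<Omega>. u z = 0 \<and> v z = 0)"

end

(*
  Write L u = k with k = - (b u + eps v + f(t, x, u)). Testing with u itself gives f(t, x, u) in L1,
  hence k in L1. Away from the kernel of L the equation is inverted by an explicit bounded Green
  kernel (the indicator of a backward light cone plus a linear correction), so u = w + y with w bounded and
  y(t, x) = p(t + x) - p(t - x) in the kernel; this uses only completeness of the modes.
  For the kernel part one tests with r(t + x) - r(t - x), where r = sgn p on {|p| > K}
  and r = 0 elsewhere. By monotonicity the nonlinear term is bounded below by its value at w, which leaves
  b * int_{|p| > K} |p| <= C |{|p| > K}| + |eps| * int_{|p| > K} |p'|, p' belonging to v. Adding the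
  symmetric inequality, for |eps| < b / 4 and K large both sets {|p| > K}, {|p'| > K} are null.
*)

theory Submission
  imports Defs "HOL-Library.Periodic_Fun"
begin

subsection \<open>Measures on intervals and on the domain\<close>

text \<open>The obstacle is the infinite-dimensional kernel of L: there the norm of H is only the L2
  norm, so nothing is gained in regularity and the nonlinear term is known merely to lie in L1. For
  such a right-hand side the coefficients of the expansion are only bounded, and dividing them by
  the eigenvalues gives no evident sup bound; an integral operator with bounded kernel does, since
  it maps L1 into bounded functions. The weak norm on the kernel also helps: every travelling wave
  with bounded measurable profile lies in H, so the discontinuous truncated sign is a legitimate
  test profile, and L drops out of the tested equation. The term b u then supplies coercivity on the
  kernel, while (h4) controls the nonlinear term from one side. The coupling is linear, so it can be
  absorbed as soon as |eps| is a small enough fraction of b; the bounded remainders are absorbed by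
  taking the truncation level K large.\<close>

definition ivl :: "real \<Rightarrow> real measure"
  where "ivl a = density lborel (indicator {0..a})"

text \<open>A density, unlike a restricted space, keeps the Borel sets and the whole line as space,
  so functions on the line and their shifts can be integrated without restricting their
  domain.\<close>

lemma sets_ivl [measurable_cong, simp]: "sets (ivl a) = sets borel"
  and space_ivl [simp]: "space (ivl a) = UNIV"
  by (simp_all add: ivl_def)

lemma emeasure_ivl_UNIV: "emeasure (ivl a) UNIV = ennreal (max 0 a)"
  unfolding ivl_def by (subst emeasure_density) (auto simp: max_def)

lemma finite_measure_ivl: "finite_measure (ivl a)"
  by (rule finite_measureI) (simp add: emeasure_ivl_UNIV)

lemma measure_ivl_UNIV: "a \<ge> 0 \<Longrightarrow> measure (ivl a) UNIV = a"
  by (simp add: measure_def emeasure_ivl_UNIV max_def)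

lemma ivl_density_real: "ivl a = density lborel (\<lambda>s. ennreal (indicator {0..a} s))"
  unfolding ivl_def by (intro density_cong) (auto split: split_indicator)

lemma integral_ivl:
  fixes f :: "real \<Rightarrow> real"
  assumes [measurable]: "f \<in> borel_measurable borel"
  shows "integral\<^sup>L (ivl a) f = (\<integral>s. indicator {0..a} s * f s \<partial>lborel)"
  unfolding ivl_density_real by (subst integral_density) auto

lemma integral_interval_FTC:
  fixes f F :: "real \<Rightarrow> real"
  assumes "a \<le> b" and "continuous_on UNIV f"
    and "\<And>s. (F has_field_derivative f s) (at s)"
  shows "(\<integral>s. indicator {a..b} s * f s \<partial>lborel) = F b - F a"
proof -
  have "(\<integral>s. indicator {a..b} s *\<^sub>R f s \<partial>lborel) = F b - F a"
    using assms
    by (intro integral_FTC_atLeastAtMost)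
      (auto simp: has_real_derivative_iff_has_vector_derivative[symmetric]
        intro: has_field_derivative_at_within continuous_on_subset)
  then show ?thesis by simp
qed

lemma integral_ivl_FTC:
  fixes f F :: "real \<Rightarrow> real"
  assumes "0 \<le> a" and "continuous_on UNIV f"
    and "\<And>s. (F has_field_derivative f s) (at s)"
  shows "integral\<^sup>L (ivl a) f = F a - F 0"
proof -
  have "f \<in> borel_measurable borel"
    by (rule borel_measurable_continuous_onI) fact
  then show ?thesis
    using integral_interval_FTC[OF assms] by (simp add: integral_ivl)
qed

lemma AE_ivl_iff: "(AE s in ivl a. P s) \<longleftrightarrow> (AE s in lborel. s \<in> {0..a} \<longrightarrow> P s)"
  unfolding ivl_def by (subst AE_density) (auto simp: indicator_def)

lemma nn_integral_ivl_ico: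
  assumes [measurable]: "g \<in> borel_measurable borel"
  shows "(\<integral>\<^sup>+ s. g s \<partial>ivl a) = (\<integral>\<^sup>+ s. g s * indicator {0..<a} s \<partial>lborel)"
proof -
  have "AE s in lborel. s \<noteq> a"
    using AE_lborel_singleton .
  then have "(\<integral>\<^sup>+ s. indicator {0..a} s * g s \<partial>lborel) = (\<integral>\<^sup>+ s. g s * indicator {0..<a} s \<partial>lborel)"
    by (intro nn_integral_cong_AE) (auto elim!: eventually_mono split: split_indicator)
  then show ?thesis
    unfolding ivl_def by (subst nn_integral_density) auto
qed

section \<open>Periodic functions and rotations of the circle\<close>

definition periodic :: "(real \<Rightarrow> 'a) \<Rightarrow> bool"
  where "periodic g \<longleftrightarrow> (\<forall>s. g (s + 2 * pi) = g s)"

lemma periodic_int: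
  assumes "periodic g"
  shows "g (s + of_int n * (2 * pi)) = g s"
proof -
  interpret periodic_fun_simple g "2 * pi"
    using assms by unfold_locales (simp add: periodic_def)
  show ?thesis using plus_of_int[of s n] by simp
qed

text \<open>Representative modulo 2 pi in [0, 2 pi). Functions on the domain are meaningful on one
  period only; composing with \<open>red\<close> extends them periodically in t.\<close>

definition red :: "real \<Rightarrow> real"
  where "red s = s - of_int \<lfloor>s / (2 * pi)\<rfloor> * (2 * pi)"

lemma red_measurable [measurable]: "red \<in> borel_measurable borel"
proof -
  have "(\<lambda>s. s - of_int \<lfloor>s / (2 * pi)\<rfloor> * (2 * pi)) \<in> borel_measurable borel" by measurable
  then show ?thesis by (simp add: red_def[abs_def])
qed

lemma red_bounds: "0 \<le> red s" "red s < 2 * pi"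
proof -
  have "of_int \<lfloor>s / (2 * pi)\<rfloor> \<le> s / (2 * pi)" "s / (2 * pi) < of_int \<lfloor>s / (2 * pi)\<rfloor> + 1"
    by linarith+
  then have "of_int \<lfloor>s / (2 * pi)\<rfloor> * (2 * pi) \<le> s" "s < (of_int \<lfloor>s / (2 * pi)\<rfloor> + 1) * (2 * pi)"
    by (simp_all only: pos_le_divide_eq pos_divide_less_eq mult_pos_pos pi_gt_zero zero_less_numeral)
  then show "0 \<le> red s" "red s < 2 * pi"
    by (simp_all add: red_def algebra_simps)
qed

lemma periodic_red: "periodic red"
proof -
  have "(s + 2 * pi) / (2 * pi) = s / (2 * pi) + 1" for s by (simp add: field_simps)
  then show ?thesis by (simp add: periodic_def red_def algebra_simps)
qed

lemma red_id: "0 \<le> s \<Longrightarrow> s < 2 * pi \<Longrightarrow> red s = s"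
proof -
  assume "0 \<le> s" "s < 2 * pi"
  then have "\<lfloor>s / (2 * pi)\<rfloor> = 0" by (simp add: floor_eq_iff)
  then show ?thesis by (simp add: red_def)
qed

lemma periodic_add_red: "periodic g \<Longrightarrow> g (s + red a) = g (s + a)"
  using periodic_int[of g "s + a" "- \<lfloor>a / (2 * pi)\<rfloor>"] by (simp add: red_def algebra_simps)

lemma periodic_of_red: "periodic g \<Longrightarrow> g (red a) = g a"
  using periodic_add_red[of g 0 a] by simp

text \<open>After reducing the shift to c in [0, 2 pi), the window [c, c + 2 pi) is cut at 2 pi and
  the overhang is moved back by one period. Half-open intervals make the pieces fit exactly.\<close>

lemma nn_integral_periodic_shift:
  fixes g :: "real \<Rightarrow> ennreal"
  assumes [measurable]: "g \<in> borel_measurable borel" and g: "periodic g"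
  shows "(\<integral>\<^sup>+ s. g (s + a) \<partial>ivl (2 * pi)) = (\<integral>\<^sup>+ s. g s \<partial>ivl (2 * pi))"
proof -
  define c where "c = red a"
  have c: "0 \<le> c" "c < 2 * pi" by (simp_all add: c_def red_bounds)
  have shift: "(\<integral>\<^sup>+ s. h (s + d) \<partial>lborel) = (\<integral>\<^sup>+ s. h s \<partial>lborel)"
    if [measurable]: "h \<in> borel_measurable borel" for h :: "real \<Rightarrow> ennreal" and d
    using nn_integral_real_affine[of h 1 d] by (simp add: add.commute)
  have "(\<integral>\<^sup>+ s. g (s + a) \<partial>ivl (2 * pi)) = (\<integral>\<^sup>+ s. g (s + c) * indicator {0..<2 * pi} s \<partial>lborel)"
    by (simp add: c_def periodic_add_red[OF g] nn_integral_ivl_ico)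
  also have "\<dots> = (\<integral>\<^sup>+ s. (\<lambda>s. g s * indicator {c..<c + 2 * pi} s) (s + c) \<partial>lborel)"
    by (intro nn_integral_cong) (auto split: split_indicator)
  also have "\<dots> = (\<integral>\<^sup>+ s. g s * indicator {c..<c + 2 * pi} s \<partial>lborel)"
    by (rule shift) measurable
  also have "\<dots> = (\<integral>\<^sup>+ s. g s * indicator {c..<2 * pi} s + g s * indicator {2 * pi..<c + 2 * pi} s \<partial>lborel)"
    using c by (intro nn_integral_cong) (auto split: split_indicator)
  also have "\<dots> = (\<integral>\<^sup>+ s. g s * indicator {c..<2 * pi} s \<partial>lborel)
      + (\<integral>\<^sup>+ s. g s * indicator {2 * pi..<c + 2 * pi} s \<partial>lborel)"
    by (rule nn_integral_add) auto
  also have "(\<integral>\<^sup>+ s. g s * indicator {2 * pi..<c + 2 * pi} s \<partial>lborel)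
      = (\<integral>\<^sup>+ s. (\<lambda>s. g s * indicator {2 * pi..<c + 2 * pi} s) (s + 2 * pi) \<partial>lborel)"
    by (rule shift[symmetric]) measurable
  also have "\<dots> = (\<integral>\<^sup>+ s. g s * indicator {0..<c} s \<partial>lborel)"
    using g by (intro nn_integral_cong) (auto simp: periodic_def split: split_indicator)
  also have "(\<integral>\<^sup>+ s. g s * indicator {c..<2 * pi} s \<partial>lborel) + (\<integral>\<^sup>+ s. g s * indicator {0..<c} s \<partial>lborel)
      = (\<integral>\<^sup>+ s. g s * indicator {c..<2 * pi} s + g s * indicator {0..<c} s \<partial>lborel)"
    by (rule nn_integral_add[symmetric]) auto
  also have "\<dots> = (\<integral>\<^sup>+ s. g s * indicator {0..<2 * pi} s \<partial>lborel)"
    using c by (intro nn_integral_cong) (auto split: split_indicator)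
  finally show ?thesis by (simp add: nn_integral_ivl_ico)
qed

text \<open>Stated for measures so that the Bochner integral inherits the invariance with no
  integrability assumption.\<close>

lemma distr_red_shift:
  "distr (ivl (2 * pi)) borel (\<lambda>s. red (s + a)) = distr (ivl (2 * pi)) borel red"
proof (rule measure_eqI)
  fix A assume "A \<in> sets (distr (ivl (2 * pi)) borel (\<lambda>s. red (s + a)))"
  then have [measurable]: "A \<in> sets borel" by simp
  have "(\<integral>\<^sup>+ s. indicator A (red (s + a)) \<partial>ivl (2 * pi)) = (\<integral>\<^sup>+ s. indicator A (red s) \<partial>ivl (2 * pi))"
    using periodic_red by (intro nn_integral_periodic_shift) (auto simp: periodic_def)
  then show "emeasure (distr (ivl (2 * pi)) borel (\<lambda>s. red (s + a))) A
      = emeasure (distr (ivl (2 * pi)) borel red) A"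
    by (simp add: emeasure_distr nn_integral_indicator[symmetric] nn_integral_distr
        del: nn_integral_indicator)
qed simp

lemma integral_periodic_shift:
  fixes g :: "real \<Rightarrow> real"
  assumes [measurable]: "g \<in> borel_measurable borel" and g: "periodic g"
  shows "(\<integral>s. g (s + a) \<partial>ivl (2 * pi)) = (\<integral>s. g s \<partial>ivl (2 * pi))"
proof -
  have "(\<integral>s. g (red (s + a)) \<partial>ivl (2 * pi)) = (\<integral>s. g (red s) \<partial>ivl (2 * pi))"
    using arg_cong[OF distr_red_shift[of a], of "\<lambda>M. integral\<^sup>L M g"] by (simp add: integral_distr)
  then show ?thesis
    by (simp add: periodic_of_red[OF g])
qed

section \<open>The product measure that represents Lebesgue measure on \<open>Omega\<close>\<close>

definition cyl :: "(real \<times> real) measure"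
  where "cyl = ivl (2 * pi) \<Otimes>\<^sub>M ivl pi"

interpretation T: finite_measure "ivl (2 * pi)" by (rule finite_measure_ivl)
interpretation X: finite_measure "ivl pi" by (rule finite_measure_ivl)
interpretation TX: pair_sigma_finite "ivl (2 * pi)" "ivl pi" ..
interpretation XT: pair_sigma_finite "ivl pi" "ivl (2 * pi)" ..

lemma sets_cyl [measurable_cong, simp]: "sets cyl = sets borel"
  using sets_pair_measure_cong[OF sets_ivl sets_ivl, of "2 * pi" pi]
  by (simp only: cyl_def borel_prod)

lemma space_cyl [simp]: "space cyl = UNIV"
  by (simp add: cyl_def space_pair_measure)

lemma cyl_density: "cyl = density lborel (indicator Omega)"
proof -
  have "density lborel (indicator {0..2*pi}) \<Otimes>\<^sub>M density lborel (indicator {0..pi::real})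
     = density (lborel \<Otimes>\<^sub>M lborel) (\<lambda>(x,y). indicator {0..2*pi::real} x * indicator {0..pi} y)"
    using X.sigma_finite_measure_axioms
    by (intro pair_measure_density) (auto simp: ivl_def lborel.sigma_finite_measure_axioms)
  also have "\<dots> = density lborel (indicator Omega)"
    unfolding lborel_prod by (intro arg_cong[of _ _ "density lborel"]) (auto simp: Omega_def split: split_indicator)
  finally show ?thesis by (simp add: cyl_def ivl_def)
qed

lemma Omega_sets [measurable, simp]: "Omega \<in> sets borel"
  unfolding Omega_def by (intro borel_closed closed_Times) auto

lemma Omega_lebesgue [simp]: "Omega \<in> sets lebesgue"
  by (intro sets_completionI_sets) simp

lemma cyl_density_real: "cyl = density lborel (\<lambda>z. ennreal (indicator Omega z))"
  unfolding cyl_density by (intro density_cong) (auto split: split_indicator)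

lemma finite_measure_cyl: "finite_measure cyl"
proof (rule finite_measureI)
  have "emeasure cyl (UNIV \<times> UNIV) = emeasure (ivl (2*pi)) UNIV * emeasure (ivl pi) UNIV"
    unfolding cyl_def by (rule X.emeasure_pair_measure_Times) auto
  also have "\<dots> < \<infinity>"
    by (auto simp: emeasure_ivl_UNIV ennreal_mult_less_top)
  finally show "emeasure cyl (space cyl) \<noteq> \<infinity>" by simp
qed

interpretation TX: finite_measure cyl by (rule finite_measure_cyl)

text \<open>Completion adds only subsets of null sets, so the complete measure of the problem and
  the Borel measure \<open>cyl\<close> have the same almost-everywhere statements, whatever
  \<open>P\<close> is.\<close>

lemma AE_Omega_iff: "(AE z in M\<^sub>\<Omega>. P z) \<longleftrightarrow> (AE z in cyl. P z)"
  unfolding cyl_density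
  by (subst AE_density, simp, subst AE_restrict_space_iff)
    (auto simp: AE_completion_iff indicator_def)

lemma
  fixes F :: "real \<times> real \<Rightarrow> real"
  assumes [measurable]: "F \<in> borel_measurable borel"
  shows integrable_Omega_iff: "integrable M\<^sub>\<Omega> F \<longleftrightarrow> integrable cyl F"
    and integral_Omega: "integral\<^sup>L M\<^sub>\<Omega> F = integral\<^sup>L cyl F"
proof -
  show "integrable M\<^sub>\<Omega> F \<longleftrightarrow> integrable cyl F"
    unfolding cyl_density_real
    by (subst integrable_density, simp, simp, simp, subst integrable_restrict_space)
      (auto simp: integrable_completion)
  show "integral\<^sup>L M\<^sub>\<Omega> F = integral\<^sup>L cyl F"
    unfolding cyl_density_real
    by (subst integral_density, simp, simp, simp, subst integral_restrict_space)
      (auto simp: integral_completion)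
qed

text \<open>Solutions are only Lebesgue measurable, whereas Fubini and the changes of variables
  below live on Borel sets; this is the passage between the two.\<close>

lemma borel_representative:
  fixes u :: "real \<times> real \<Rightarrow> real"
  assumes "u \<in> borel_measurable M\<^sub>\<Omega>"
  obtains u' where "u' \<in> borel_measurable borel" "AE z in M\<^sub>\<Omega>. u z = u' z"
proof -
  have "(\<lambda>z. indicator Omega z *\<^sub>R u z) \<in> borel_measurable lebesgue"
    using assms by (subst (asm) borel_measurable_restrict_space_iff) (auto simp: mult.commute)
  then obtain g where "g \<in> borel_measurable lborel" "AE z in lborel. indicator Omega z *\<^sub>R u z = g z"
    using completion_ex_borel_measurable_real by blast
  moreover from this(2) have "AE z in M\<^sub>\<Omega>. u z = g z"
    by (subst AE_restrict_space_iff) (auto simp: AE_completion_iff elim: eventually_mono)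
  ultimately show ?thesis using that by auto
qed

subsection \<open>Functions of the characteristic variables\<close>

text \<open>For fixed x the shear is a rotation of the circle in t, so Fubini reduces it to shift
  invariance. With c = 1 or c = -1 it straightens one family of characteristics.\<close>

lemma nn_integral_shear:
  fixes F :: "real \<times> real \<Rightarrow> ennreal"
  assumes [measurable]: "F \<in> borel_measurable borel"
  shows "(\<integral>\<^sup>+ z. F (red (fst z + c * snd z), snd z) \<partial>cyl) = (\<integral>\<^sup>+ z. F (red (fst z), snd z) \<partial>cyl)"
proof -
  have [measurable]: "F \<in> borel_measurable (borel \<Otimes>\<^sub>M borel)" by (simp add: borel_prod)
  have per: "periodic (\<lambda>s. F (red s, x))" for x
    using periodic_red by (simp add: periodic_def)
  have "(\<integral>\<^sup>+ z. F (red (fst z + c * snd z), snd z) \<partial>cyl)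
      = (\<integral>\<^sup>+ x. \<integral>\<^sup>+ s. F (red (s + c * x), x) \<partial>ivl (2 * pi) \<partial>ivl pi)"
    unfolding cyl_def by (subst TX.nn_integral_snd[symmetric]) (auto simp: case_prod_beta)
  also have "\<dots> = (\<integral>\<^sup>+ x. \<integral>\<^sup>+ s. F (red s, x) \<partial>ivl (2 * pi) \<partial>ivl pi)"
    by (intro nn_integral_cong nn_integral_periodic_shift per) measurable
  also have "\<dots> = (\<integral>\<^sup>+ z. F (red (fst z), snd z) \<partial>cyl)"
    unfolding cyl_def by (subst TX.nn_integral_snd[symmetric]) (auto simp: case_prod_beta)
  finally show ?thesis .
qed

lemma AE_ivl_red: "AE s in ivl (2 * pi). red s = s"
  unfolding AE_ivl_iff using AE_lborel_singleton[of "2 * pi"]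
  by eventually_elim (auto intro: red_id)

lemma AE_cyl_red: "AE z in cyl. red (fst z) = fst z"
  unfolding cyl_def
proof (rule TX.AE_pair_measure)
  have [measurable]: "(\<lambda>z. red (fst z)) \<in> borel_measurable (ivl (2 * pi) \<Otimes>\<^sub>M ivl pi)" by measurable
  show "{z \<in> space (ivl (2 * pi) \<Otimes>\<^sub>M ivl pi). red (fst z) = fst z} \<in> sets (ivl (2 * pi) \<Otimes>\<^sub>M ivl pi)"
    by measurable
  show "AE s in ivl (2 * pi). AE x in ivl pi. red (fst (s, x)) = fst (s, x)"
    using AE_ivl_red by eventually_elim simp
qed

lemma distr_shear:
  "distr cyl borel (\<lambda>z. (red (fst z + c * snd z), snd z)) = cyl"
proof (rule measure_eqI)
  have m [measurable]: "(\<lambda>z::real\<times>real. (red (fst z + c * snd z), snd z)) \<in> borel_measurable borel" for c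
    unfolding borel_prod[symmetric] by measurable
  have m0 [measurable]: "(\<lambda>z::real\<times>real. (red (fst z), snd z)) \<in> borel_measurable borel"
    using m[of 0] by simp
  fix A assume "A \<in> sets (distr cyl borel (\<lambda>z. (red (fst z + c * snd z), snd z)))"
  then have [measurable]: "A \<in> sets borel" by simp
  have "emeasure (distr cyl borel (\<lambda>z. (red (fst z + c * snd z), snd z))) A
     = (\<integral>\<^sup>+ z. indicator A (red (fst z + c * snd z), snd z) \<partial>cyl)"
    by (simp add: nn_integral_indicator[symmetric] nn_integral_distr del: nn_integral_indicator)
  also have "\<dots> = (\<integral>\<^sup>+ z. indicator A (red (fst z), snd z) \<partial>cyl)"
    by (rule nn_integral_shear) measurable
  also have "\<dots> = (\<integral>\<^sup>+ z. indicator A z \<partial>cyl)"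
    using AE_cyl_red by (intro nn_integral_cong_AE) (auto elim!: eventually_mono)
  finally show "emeasure (distr cyl borel (\<lambda>z. (red (fst z + c * snd z), snd z))) A = emeasure cyl A"
    by simp
qed simp

lemma shear_measurable [measurable]:
  "(\<lambda>z::real\<times>real. (red (fst z + c * snd z), snd z)) \<in> borel_measurable borel"
  unfolding borel_prod[symmetric] by measurable

lemma
  fixes F :: "real \<times> real \<Rightarrow> real"
  assumes [measurable]: "F \<in> borel_measurable borel"
  shows integral_shear: "(\<integral>z. F (red (fst z + c * snd z), snd z) \<partial>cyl) = (\<integral>z. F z \<partial>cyl)"
    and integrable_shear:
      "integrable cyl (\<lambda>z. F (red (fst z + c * snd z), snd z)) \<longleftrightarrow> integrable cyl F"
  using arg_cong[OF distr_shear[of c], of "\<lambda>M. integral\<^sup>L M F"]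
    arg_cong[OF distr_shear[of c], of "\<lambda>M. integrable M F"]
  by (simp_all add: integral_distr integrable_distr_eq)

lemma AE_shear:
  assumes "AE z in cyl. P z" and [measurable]: "Measurable.pred borel P"
  shows "AE z in cyl. P (red (fst z + c * snd z), snd z)"
proof -
  have "AE z in distr cyl borel (\<lambda>z. (red (fst z + c * snd z), snd z)). P z"
    using assms(1) unfolding distr_shear .
  then show ?thesis
    by (subst (asm) AE_distr_iff) auto
qed

text \<open>The functions \<open>travel p\<close> are the kernel of \<open>L\<close>, and \<open>kproj d\<close> is the profile of the projection of
  \<open>d\<close> to it.\<close>

definition travel :: "(real \<Rightarrow> real) \<Rightarrow> real \<times> real \<Rightarrow> real"
  where "travel p z = p (fst z + snd z) - p (fst z - snd z)"

definition kproj :: "(real \<times> real \<Rightarrow> real) \<Rightarrow> real \<Rightarrow> real"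
  where "kproj d s = (\<integral>x. d (red (s - x), x) - d (red (s + x), x) \<partial>ivl pi) / (2 * pi)"

lemma travel_measurable [measurable]:
  assumes [measurable]: "p \<in> borel_measurable borel"
  shows "travel p \<in> borel_measurable borel"
proof -
  have "(\<lambda>z. p (fst z + snd z) - p (fst z - snd z)) \<in> borel_measurable (borel \<Otimes>\<^sub>M borel)"
    by measurable
  then show ?thesis by (simp add: borel_prod travel_def[abs_def])
qed

lemma periodic_kproj: "periodic (kproj d)"
proof -
  have "red (s + 2 * pi - x) = red (s - x)" "red (s + 2 * pi + x) = red (s + x)" for s x
    using periodic_red[unfolded periodic_def, rule_format, of "s - x"]
      periodic_red[unfolded periodic_def, rule_format, of "s + x"]
    by (simp_all add: algebra_simps)
  then show ?thesis by (simp add: periodic_def kproj_def)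
qed

context
  fixes d :: "real \<times> real \<Rightarrow> real" and \<rho> :: "real \<Rightarrow> real"
  assumes d_meas [measurable]: "d \<in> borel_measurable borel"
    and rho_meas [measurable]: "\<rho> \<in> borel_measurable borel"
    and per: "periodic \<rho>"
begin

lemma
  assumes 1: "integrable cyl (\<lambda>z. d z * \<rho> (fst z + c * snd z))"
  shows integrable_sheared: "integrable cyl (\<lambda>z. d (red (fst z - c * snd z), snd z) * \<rho> (fst z))"
    and integral_sheared: "(\<integral>z. d (red (fst z - c * snd z), snd z) * \<rho> (fst z) \<partial>cyl)
      = (\<integral>z. d z * \<rho> (fst z + c * snd z) \<partial>cyl)"
proof -
  have [measurable]: "(\<lambda>z. \<rho> (fst z + c * snd z)) \<in> borel_measurable borel"
    unfolding borel_prod[symmetric] by measurable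
  have *: "\<rho> (red (s - c * x) + c * x) = \<rho> s" for s x
    using periodic_add_red[OF per, of "c * x" "s - c * x"] by (simp add: add.commute)
  show "integrable cyl (\<lambda>z. d (red (fst z - c * snd z), snd z) * \<rho> (fst z))"
    using 1 integrable_shear[of "\<lambda>z. d z * \<rho> (fst z + c * snd z)" "- c"] by (simp add: *)
  show "(\<integral>z. d (red (fst z - c * snd z), snd z) * \<rho> (fst z) \<partial>cyl)
      = (\<integral>z. d z * \<rho> (fst z + c * snd z) \<partial>cyl)"
    using integral_shear[of "\<lambda>z. d z * \<rho> (fst z + c * snd z)" "- c"] by (simp add: *)
qed

text \<open>Shearing along each family of characteristics turns the argument of
  \<open>\<rho>\<close> into t alone; integrating x out leaves \<open>kproj d\<close>. Integrability
  is assumed for the products because the roles vary: a bounded \<open>\<rho>\<close> meets an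
  integrable \<open>d\<close>, and later an integrable profile meets a mode.\<close>

lemma travel_adjoint:
  assumes I: "\<And>c. integrable cyl (\<lambda>z. d z * \<rho> (fst z + c * snd z))"
  shows "integrable cyl (\<lambda>z. d z * travel \<rho> z)"
    and "(\<integral>z. d z * travel \<rho> z \<partial>cyl) = 2 * pi * (\<integral>s. \<rho> s * kproj d s \<partial>ivl (2 * pi))"
proof -
  note I' = integrable_sheared[OF I]
  show "integrable cyl (\<lambda>z. d z * travel \<rho> z)"
    using Bochner_Integration.integrable_diff[OF I[of 1] I[of "-1"]]
    by (simp add: travel_def algebra_simps)
  have "(\<integral>z. d z * travel \<rho> z \<partial>cyl)
      = (\<integral>z. d z * \<rho> (fst z + 1 * snd z) - d z * \<rho> (fst z + (-1) * snd z) \<partial>cyl)"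
    by (simp add: travel_def algebra_simps)
  also have "\<dots> = (\<integral>z. d (red (fst z - 1 * snd z), snd z) * \<rho> (fst z) \<partial>cyl)
     - (\<integral>z. d (red (fst z - (-1) * snd z), snd z) * \<rho> (fst z) \<partial>cyl)"
    unfolding integral_sheared[OF I] by (intro Bochner_Integration.integral_diff I)
  also have "\<dots> = (\<integral>z. d (red (fst z - 1 * snd z), snd z) * \<rho> (fst z)
     - d (red (fst z - (-1) * snd z), snd z) * \<rho> (fst z) \<partial>cyl)"
    by (intro Bochner_Integration.integral_diff[symmetric] I')
  also have "\<dots> = (\<integral>(s, x). \<rho> s * (d (red (s - x), x) - d (red (s + x), x)) \<partial>(ivl (2 * pi) \<Otimes>\<^sub>M ivl pi))"
    unfolding cyl_def by (intro Bochner_Integration.integral_cong) (auto simp: algebra_simps)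
  also have "\<dots> = (\<integral>s. (\<integral>x. \<rho> s * (d (red (s - x), x) - d (red (s + x), x)) \<partial>ivl pi) \<partial>ivl (2 * pi))"
    using Bochner_Integration.integrable_diff[OF I'[of 1] I'[of "-1"]]
    by (intro TX.integral_fst[symmetric]) (simp add: cyl_def case_prod_unfold algebra_simps)
  also have "\<dots> = 2 * pi * (\<integral>s. \<rho> s * kproj d s \<partial>ivl (2 * pi))"
    by (subst integral_mult_right_zero[symmetric])
      (auto simp: kproj_def intro!: Bochner_Integration.integral_cong)
  finally show "(\<integral>z. d z * travel \<rho> z \<partial>cyl) = 2 * pi * (\<integral>s. \<rho> s * kproj d s \<partial>ivl (2 * pi))" .
qed

end

lemma kproj_integrable:
  assumes d: "integrable cyl d"
  shows "integrable (ivl (2 * pi)) (kproj d)"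
proof -
  have "d \<in> borel_measurable borel" using borel_measurable_integrable[OF d] by simp
  then have "integrable cyl (\<lambda>z. d (red (fst z - c * snd z), snd z))" for c
    using integrable_sheared[of d "\<lambda>_. 1" c] d by (simp add: periodic_def)
  from Bochner_Integration.integrable_diff[OF this[of 1] this[of "-1"]]
  have "integrable (ivl (2 * pi) \<Otimes>\<^sub>M ivl pi) (\<lambda>(s, x). d (red (s - x), x) - d (red (s + x), x))"
    by (simp add: cyl_def case_prod_unfold)
  from TX.integrable_fst[OF this] show ?thesis
    unfolding kproj_def[abs_def] by simp
qed

lemma
  fixes p :: "real \<Rightarrow> real"
  assumes p: "integrable (ivl (2 * pi)) p" and per: "periodic p"
  shows integrable_char: "integrable cyl (\<lambda>z. p (fst z + c * snd z))"
    and integral_char: "(\<integral>z. p (fst z + c * snd z) \<partial>cyl) = pi * (\<integral>s. p s \<partial>ivl (2 * pi))"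
proof -
  have [measurable]: "p \<in> borel_measurable borel" 
    using borel_measurable_integrable[OF p] by simp
  have [measurable]: "(\<lambda>z::real\<times>real. p (fst z)) \<in> borel_measurable borel"
    unfolding borel_prod[symmetric] by measurable
  have 1: "integrable cyl (\<lambda>z. p (fst z))"
    unfolding cyl_def by (rule TX.Fubini_integrable) (use p in auto)
  show "integrable cyl (\<lambda>z. p (fst z + c * snd z))"
    using 1 integrable_shear[of "\<lambda>z. p (fst z)" c] by (simp add: periodic_of_red[OF per])
  have "(\<integral>z. p (fst z + c * snd z) \<partial>cyl) = (\<integral>z. p (fst z) \<partial>cyl)"
    using integral_shear[of "\<lambda>z. p (fst z)" c] by (simp add: periodic_of_red[OF per])
  also have "\<dots> = (\<integral>s. (\<integral>x. p s \<partial>ivl pi) \<partial>ivl (2 * pi))"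
    using TX.integral_fst'[of "\<lambda>z. p (fst z)"] 1 by (simp add: cyl_def)
  also have "\<dots> = pi * (\<integral>s. p s \<partial>ivl (2 * pi))"
    by (simp add: measure_ivl_UNIV)
  finally show "(\<integral>z. p (fst z + c * snd z) \<partial>cyl) = pi * (\<integral>s. p s \<partial>ivl (2 * pi))" .
qed

text \<open>A null set of profiles gives a null set of the form N x [0, pi], and the shear preserves
  null sets.\<close>

lemma AE_char:
  assumes "AE s in ivl (2 * pi). P s" and [measurable]: "Measurable.pred borel P" and "periodic P"
  shows "AE z in cyl. P (fst z + c * snd z)"
proof -
  have [measurable]: "Measurable.pred borel (\<lambda>z::real\<times>real. P (fst z))"
    unfolding borel_prod[symmetric] by measurable
  have "AE z in cyl. P (fst z)"
    unfolding cyl_def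
  proof (rule TX.AE_pair_measure)
    show "AE s in ivl (2 * pi). AE x in ivl pi. P (fst (s, x))"
      using assms(1) by eventually_elim simp
    have "Measurable.pred (ivl (2 * pi) \<Otimes>\<^sub>M ivl pi) (\<lambda>z. P (fst z))" by measurable
    then show "{z \<in> space (ivl (2 * pi) \<Otimes>\<^sub>M ivl pi). P (fst z)} \<in> sets (ivl (2 * pi) \<Otimes>\<^sub>M ivl pi)"
      by (simp add: pred_def)
  qed
  from AE_shear[OF this, of c] show ?thesis
    by (simp add: periodic_of_red[OF assms(3)])
qed

subsection \<open>Completeness of the modes\<close>

text \<open>The free phase \<open>\<theta>\<close> covers cosine and sine in t at once, so real
  functions and frequencies \<open>k\<close> in the naturals suffice.\<close>

definition mode :: "nat \<Rightarrow> nat \<Rightarrow> real \<Rightarrow> real \<times> real \<Rightarrow> real"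
  where "mode j k \<theta> z = sin (j * snd z) * cos (k * fst z + \<theta>)"

lemma mode_measurable [measurable]: "mode j k \<theta> \<in> borel_measurable borel"
  unfolding mode_def[abs_def] by (intro borel_measurable_continuous_onI continuous_intros)

lemma mode_le_1: "\<bar>mode j k \<theta> z\<bar> \<le> 1"
  unfolding mode_def by (simp add: abs_mult mult_le_one)

lemma integrable_cyl_bounded:
  fixes F :: "real \<times> real \<Rightarrow> real"
  assumes "F \<in> borel_measurable borel" and "\<And>z. \<bar>F z\<bar> \<le> B"
  shows "integrable cyl F"
  by (rule TX.integrable_const_bound[where B=B]) (use assms in auto)

lemma integrable_mult_bounded_AE:
  fixes d F :: "'a \<Rightarrow> real"
  assumes d: "integrable M d" and F: "F \<in> borel_measurable M" "AE z in M. \<bar>F z\<bar> \<le> B"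
  shows "integrable M (\<lambda>z. d z * F z)"
proof (rule Bochner_Integration.integrable_bound[where f="\<lambda>z. \<bar>B\<bar> * d z"])
  show "AE z in M. norm (d z * F z) \<le> norm (\<bar>B\<bar> * d z)"
    using F(2)
  proof eventually_elim
    case (elim z)
    then have "\<bar>d z\<bar> * \<bar>F z\<bar> \<le> \<bar>d z\<bar> * \<bar>B\<bar>" by (intro mult_left_mono) auto
    then show ?case by (simp only: real_norm_def abs_mult abs_abs mult.commute)
  qed
qed (use d F(1) in auto)

lemma integrable_mult_bounded:
  fixes d F :: "'a \<Rightarrow> real"
  assumes "integrable M d" and "F \<in> borel_measurable M" and "\<And>z. \<bar>F z\<bar> \<le> B"
  shows "integrable M (\<lambda>z. d z * F z)"
  using assms by (intro integrable_mult_bounded_AE[where B=B]) auto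

lemma periodic_cos: "periodic (\<lambda>s. cos (real k * s + \<theta>))"
proof -
  have "cos (real k * (s + 2 * pi) + \<theta>) = cos (real k * s + \<theta>)" for s
    using cos.plus_of_nat[of "real k * s + \<theta>" k] by (simp add: algebra_simps)
  then show ?thesis by (simp add: periodic_def)
qed

lemma periodic_sin: "periodic (\<lambda>s. sin (real k * s + \<theta>))"
  using periodic_cos[of k "\<theta> - pi / 2"]
  by (simp add: periodic_def cos_diff cos_add algebra_simps sin_add)

lemma integral_sin_sin:
  assumes "j \<noteq> 0"
  shows "(\<integral>x. sin (real j * x) * sin (real k * x) \<partial>ivl pi) = (if j = k then pi / 2 else 0)"
proof (cases "j = k")
  case True
  have "(\<integral>x. sin (real j * x) * sin (real k * x) \<partial>ivl pi)
    = (\<lambda>x. x / 2 - sin (2 * real j * x) / (4 * j)) pi - (\<lambda>x. x / 2 - sin (2 * real j * x) / (4 * j)) 0"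
  proof (rule integral_ivl_FTC)
    fix s :: real
    have "((\<lambda>x. x / 2 - sin (2 * real j * x) / (4 * j)) has_field_derivative 1 / 2 - cos (2 * (j * s)) / 2) (at s)"
      using assms by (auto intro!: derivative_eq_intros simp: field_simps)
    also have "1 / 2 - cos (2 * (j * s)) / 2 = sin (real j * s) * sin (real k * s)"
      unfolding cos_double_sin using True by (simp add: power2_eq_square field_simps)
    finally show "((\<lambda>x. x / 2 - sin (2 * real j * x) / (4 * j))
        has_field_derivative sin (real j * s) * sin (real k * s)) (at s)" .
  qed (auto intro!: continuous_intros)
  moreover have "sin (2 * real j * pi) = 0" using sin_npi[of "2 * j"] by simp
  ultimately show ?thesis using True by simp
next
  case False
  then have ne: "real j - real k \<noteq> 0" "real j + real k \<noteq> 0" using assms by auto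
  have D: "((\<lambda>x. sin (a * x) / (2 * a)) has_field_derivative cos (a * s) / 2) (at s)"
    if "a \<noteq> 0" for a s :: real
    using that by (auto intro!: derivative_eq_intros)
  define F where "F x = sin ((real j - real k) * x) / (2 * (real j - real k))
    - sin ((real j + real k) * x) / (2 * (real j + real k))" for x
  have "(\<integral>x. sin (real j * x) * sin (real k * x) \<partial>ivl pi) = F pi - F 0"
  proof (rule integral_ivl_FTC)
    fix s
    have "(F has_field_derivative (cos ((real j - real k) * s) / 2 - cos ((real j + real k) * s) / 2)) (at s)"
      unfolding F_def[abs_def] by (intro DERIV_diff D ne)
    also have "cos ((real j - real k) * s) / 2 - cos ((real j + real k) * s) / 2
        = sin (real j * s) * sin (real k * s)"
      unfolding left_diff_distrib distrib_right cos_diff cos_add by (simp add: field_simps)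
    finally show "(F has_field_derivative sin (real j * s) * sin (real k * s)) (at s)" .
  qed (auto intro!: continuous_intros)
  also have "F pi - F 0 = 0"
    by (simp add: F_def left_diff_distrib distrib_right sin_diff sin_add)
  finally show ?thesis using False by simp
qed

text \<open>The difference of the two cosines is a product in which x enters as sin (j x) sin (k x),
  so orthogonality in x leaves only j = k. Compared with \<open>mode_diag\<close>, this says that
  \<open>kproj\<close> recovers the profile of a diagonal mode.\<close>

lemma kproj_mode:
  assumes "j \<noteq> 0"
  shows "kproj (mode j k \<theta>) s = (if j = k then sin (j * s + \<theta>) / 2 else 0)"
proof -
  have "mode j k \<theta> (red (s - x), x) - mode j k \<theta> (red (s + x), x)
      = 2 * sin (k * s + \<theta>) * (sin (j * x) * sin (k * x))" for x :: real
  proof -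
    have "mode j k \<theta> (red (s - x), x) - mode j k \<theta> (red (s + x), x)
      = sin (j * x) * (cos ((k * s + \<theta>) - k * x) - cos ((k * s + \<theta>) + k * x))"
      unfolding mode_def fst_conv snd_conv periodic_of_red[OF periodic_cos[of k \<theta>]]
      by (simp add: algebra_simps)
    then show ?thesis unfolding cos_diff cos_add by (simp add: algebra_simps)
  qed
  then show ?thesis
    by (simp add: kproj_def integral_sin_sin[OF assms])
qed

lemma mode_diag: "mode j j \<theta> z = travel (\<lambda>s. sin (j * s + \<theta>)) z / 2"
proof -
  have "travel (\<lambda>s. sin (j * s + \<theta>)) z
      = sin ((j * fst z + \<theta>) + j * snd z) - sin ((j * fst z + \<theta>) - j * snd z)"
    by (simp add: travel_def algebra_simps)
  then show ?thesis by (simp add: mode_def sin_diff sin_add)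
qed

lemma AE_cyl_interior: "AE z in cyl. 0 < fst z \<and> fst z < 2 * pi \<and> 0 < snd z \<and> snd z < pi"
proof -
  have [measurable]: "Measurable.pred (ivl (2 * pi) \<Otimes>\<^sub>M ivl pi) (\<lambda>z. 0 < fst z \<and> fst z < 2 * pi \<and> 0 < snd z \<and> snd z < pi)"
    by measurable
  have i: "AE s in ivl a. 0 < s \<and> s < a" for a
    unfolding AE_ivl_iff using AE_lborel_singleton[of 0] AE_lborel_singleton[of a]
    by eventually_elim auto
  show ?thesis
    unfolding cyl_def
  proof (rule TX.AE_pair_measure)
    show "{z \<in> space (ivl (2 * pi) \<Otimes>\<^sub>M ivl pi). 0 < fst z \<and> fst z < 2 * pi \<and> 0 < snd z \<and> snd z < pi}
        \<in> sets (ivl (2 * pi) \<Otimes>\<^sub>M ivl pi)"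
      by measurable
    show "AE s in ivl (2 * pi). AE x in ivl pi. 0 < fst (s, x) \<and> fst (s, x) < 2 * pi \<and> 0 < snd (s, x) \<and> snd (s, x) < pi"
      using i[of "2 * pi"] by eventually_elim (use i[of pi] in \<open>auto elim: eventually_mono\<close>)
  qed
qed

section \<open>An algebra of trigonometric functions and its link to polynomials\<close>

inductive_set trig :: "(real \<times> real \<Rightarrow> real) set" where
  base: "(\<lambda>z. c * (cos (of_int m * snd z) * cos (of_int k * fst z + \<theta>))) \<in> trig"
| add: "f \<in> trig \<Longrightarrow> g \<in> trig \<Longrightarrow> (\<lambda>z. f z + g z) \<in> trig"

text \<open>Product-to-sum formulas in both variables. The indices are integers because differences
  of frequencies occur, and the free phase absorbs \<open>\<theta> - \<theta>'\<close> and
  \<open>\<theta> + \<theta>'\<close>.\<close>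

lemma trig_mult:
  assumes "f \<in> trig" "g \<in> trig"
  shows "(\<lambda>z. f z * g z) \<in> trig"
  using assms(1)
proof induction
  case (base c m k \<theta>)
  show ?case using assms(2)
  proof induction
    case (base c' m' k' \<theta>')
    let ?b = "\<lambda>m'' k'' \<theta>'' z. c * c' / 4 * (cos (of_int m'' * snd z) * cos (of_int k'' * fst z + \<theta>''))"
    have eq: "(\<lambda>z. c * (cos (of_int m * snd z) * cos (of_int k * fst z + \<theta>)) *
         (c' * (cos (of_int m' * snd z) * cos (of_int k' * fst z + \<theta>'))))
      = (\<lambda>z. (?b (m - m') (k - k') (\<theta> - \<theta>') z + ?b (m + m') (k - k') (\<theta> - \<theta>') z)
        + (?b (m - m') (k + k') (\<theta> + \<theta>') z + ?b (m + m') (k + k') (\<theta> + \<theta>') z))"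
    proof
      fix z :: "real \<times> real"
      have *: "a * (cos p * cos q) * (a' * (cos p' * cos q'))
        = (a * a' / 4 * (cos (p - p') * cos (q - q')) + a * a' / 4 * (cos (p + p') * cos (q - q')))
        + (a * a' / 4 * (cos (p - p') * cos (q + q')) + a * a' / 4 * (cos (p + p') * cos (q + q')))"
        for a p q a' p' q' :: real
        unfolding cos_diff cos_add by (simp add: algebra_simps)
      show "c * (cos (of_int m * snd z) * cos (of_int k * fst z + \<theta>)) *
         (c' * (cos (of_int m' * snd z) * cos (of_int k' * fst z + \<theta>')))
        = (?b (m - m') (k - k') (\<theta> - \<theta>') z + ?b (m + m') (k - k') (\<theta> - \<theta>') z)
        + (?b (m - m') (k + k') (\<theta> + \<theta>') z + ?b (m + m') (k + k') (\<theta> + \<theta>') z)"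
        unfolding * by (simp add: algebra_simps)
    qed
    show ?case unfolding eq by (intro trig.intros)
  next
    case (add f g)
    then show ?case unfolding distrib_left by (intro trig.add)
  qed
next
  case (add f g)
  then show ?case unfolding distrib_right by (intro trig.add)
qed

text \<open>A cylinder in R^3: t enters as a point of the circle, x through cos x, which is
  injective on [0, pi]. Polynomials in these coordinates are members of \<open>trig\<close>, so
  Stone-Weierstrass on a cube yields approximation by functions that the modes can test.\<close>

definition embed :: "real \<times> real \<Rightarrow> real \<times> real \<times> real"
  where "embed z = (cos (snd z), cos (fst z), sin (fst z))"

lemma trig_real_polynomial_function:
  assumes "real_polynomial_function g"
  shows "(\<lambda>z. g (embed z)) \<in> trig"
  using assms
proof induction
  case (linear f)
  interpret bounded_linear f by fact
  have "f (embed z) = f (1,0,0) * (cos (of_int 1 * snd z) * cos (of_int 0 * fst z + 0))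
    + (f (0,1,0) * (cos (of_int 0 * snd z) * cos (of_int 1 * fst z + 0))
      + f (0,0,1) * (cos (of_int 0 * snd z) * cos (of_int 1 * fst z + (- pi / 2))))" for z
  proof -
    have "embed z = cos (snd z) *\<^sub>R (1,0,0) + (cos (fst z) *\<^sub>R (0,1,0) + sin (fst z) *\<^sub>R (0,0,1))"
      by (simp add: embed_def)
    then have "f (embed z) = cos (snd z) * f (1,0,0) + (cos (fst z) * f (0,1,0) + sin (fst z) * f (0,0,1))"
      by (simp only: add scaleR) simp
    then show ?thesis by (simp add: cos_diff)
  qed
  then show ?case by (simp only:) (intro trig.intros)
next
  case (const c)
  show ?case using trig.base[of c 0 0 0] by simp
next
  case (add f g)
  then show ?case by (intro trig.add)
next
  case (mult f g)
  then show ?case by (intro trig_mult)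
qed

lemma trig_continuous: "f \<in> trig \<Longrightarrow> continuous_on UNIV f"
  by (induction rule: trig.induct) (auto intro!: continuous_intros)

lemma trig_bounded: "f \<in> trig \<Longrightarrow> \<exists>B. \<forall>z. \<bar>f z\<bar> \<le> B"
proof (induction rule: trig.induct)
  case (base c m k \<theta>)
  have "\<bar>c * (cos (of_int m * snd z) * cos (of_int k * fst z + \<theta>))\<bar> \<le> \<bar>c\<bar> * 1" for z :: "real \<times> real"
    unfolding abs_mult by (intro mult_left_mono mult_le_one) auto
  then show ?case by blast
next
  case (add f g)
  then obtain A B where "\<And>z. \<bar>f z\<bar> \<le> A" "\<And>z. \<bar>g z\<bar> \<le> B" by blast
  then have "\<bar>f z + g z\<bar> \<le> A + B" for z by (meson abs_triangle_ineq add_mono order.trans)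
  then show ?case by blast
qed

section \<open>Integrable functions orthogonal to all modes vanish\<close>

context
  fixes d :: "real \<times> real \<Rightarrow> real"
  assumes d_int: "integrable cyl d"
    and d_orth: "\<And>j k \<theta>. j \<noteq> 0 \<Longrightarrow> (\<integral>z. d z * mode j k \<theta> z \<partial>cyl) = 0"
begin

private lemma dm [measurable]: "d \<in> borel_measurable borel"
  using borel_measurable_integrable[OF d_int] by simp

private lemma snd_m [measurable]: "(\<lambda>z::real\<times>real. sin (snd z)) \<in> borel_measurable borel"
  by (intro borel_measurable_continuous_onI continuous_intros)

text \<open>The factor \<open>sin x\<close> turns orthogonality to the modes into orthogonality to \<open>cos (m x) cos (k t + \<theta>)\<close>,
  and these functions span an algebra.\<close>

definition sine_weighted where "sine_weighted z = d z * sin (snd z)"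

private lemma dsm [measurable]: "sine_weighted \<in> borel_measurable borel"
  unfolding sine_weighted_def[abs_def] by measurable

private lemma ds_int: "integrable cyl sine_weighted"
  unfolding sine_weighted_def[abs_def] by (rule integrable_mult_bounded[OF d_int, of _ 1]) auto

private lemma trig_mult_int:
  assumes "f \<in> trig" shows "integrable cyl (\<lambda>z. sine_weighted z * f z)"
  using trig_bounded[OF assms] borel_measurable_continuous_onI[OF trig_continuous[OF assms]]
  by (auto intro!: integrable_mult_bounded[OF ds_int])

private lemma ds_trig: 
  assumes "f \<in> trig" shows "(\<integral>z. sine_weighted z * f z \<partial>cyl) = 0"
  using assms
proof induction
  case (base c m k \<theta>)
  \<comment> \<open>Cosine is even, so the sign of m is dropped and the sign of k is moved into the
    phase.\<close>
  define m' k' \<theta>' where "m' = nat \<bar>m\<bar>" and "k' = nat \<bar>k\<bar>" and "\<theta>' = (if k \<ge> 0 then \<theta> else - \<theta>)"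
  have c: "cos (of_int m * x) = cos (real m' * x)" for x
    by (cases "m \<ge> 0") (auto simp: m'_def)
  have c': "cos (of_int k * t + \<theta>) = cos (real k' * t + \<theta>')" for t
    using cos_minus[of "of_int k * t + \<theta>"]
    by (cases "k \<ge> 0") (auto simp: k'_def \<theta>'_def)
  have I: "integrable cyl (\<lambda>z. d z * mode j k' \<theta>' z)" for j
    by (rule integrable_mult_bounded[OF d_int _ mode_le_1]) simp
  \<comment> \<open>The index j = 0 is included: it occurs as m' - 1 when m' = 1, and there the mode
    is identically zero.\<close>
  have Z: "(\<integral>z. d z * mode j k' \<theta>' z \<partial>cyl) = 0" for j
    by (cases "j = 0") (auto simp: d_orth, simp add: mode_def)
  \<comment> \<open>The case m' = 0 is separate, since the natural number m' - 1 would then be 0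
    instead of -1.\<close>
  have s: "sin x * cos (real m' * x) = (if m' = 0 then sin (real 1 * x)
      else (sin (real (m' + 1) * x) - sin (real (m' - 1) * x)) / 2)" for x
    by (auto simp: of_nat_diff algebra_simps sin_add sin_diff)
  have "(\<lambda>z. sine_weighted z * (c * (cos (of_int m * snd z) * cos (of_int k * fst z + \<theta>))))
    = (\<lambda>z. if m' = 0 then c * (d z * mode 1 k' \<theta>' z)
      else c * ((d z * mode (m' + 1) k' \<theta>' z - d z * mode (m' - 1) k' \<theta>' z) / 2))"
  proof
    fix z
    have "sine_weighted z * (c * (cos (of_int m * snd z) * cos (of_int k * fst z + \<theta>)))
      = c * d z * (sin (snd z) * cos (real m' * snd z)) * cos (real k' * fst z + \<theta>')"
      unfolding sine_weighted_def c c' by simp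
    also have "\<dots> = (if m' = 0 then c * (d z * mode 1 k' \<theta>' z)
      else c * ((d z * mode (m' + 1) k' \<theta>' z - d z * mode (m' - 1) k' \<theta>' z) / 2))"
      unfolding s mode_def by (simp add: algebra_simps)
    finally show "sine_weighted z * (c * (cos (of_int m * snd z) * cos (of_int k * fst z + \<theta>)))
      = (if m' = 0 then c * (d z * mode 1 k' \<theta>' z)
      else c * ((d z * mode (m' + 1) k' \<theta>' z - d z * mode (m' - 1) k' \<theta>' z) / 2))" .
  qed
  then show ?case using I Z by (cases "m' = 0") simp_all
next
  case (add f g)
  then show ?case using trig_mult_int by (simp add: distrib_left)
qed

private lemma embed_cont: "continuous_on S embed"
  unfolding embed_def[abs_def] by (intro continuous_intros)

private lemma embed_m [measurable]: "embed \<in> borel_measurable borel"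
  by (rule borel_measurable_continuous_onI[OF embed_cont])

text \<open>A polynomial within e of \<open>\<psi>\<close> on the cube containing the range of
  \<open>embed\<close> integrates to 0 against \<open>sine_weighted\<close>, so the integral is at
  most e times the L1 norm of \<open>sine_weighted\<close>.\<close>

private lemma ds_cont:
  fixes \<psi> :: "real \<times> real \<times> real \<Rightarrow> real"
  assumes "continuous_on UNIV \<psi>" and b: "\<And>y. \<bar>\<psi> y\<bar> \<le> B"
  shows "(\<integral>z. sine_weighted z * \<psi> (embed z) \<partial>cyl) = 0"
proof -
  have [measurable]: "\<psi> \<in> borel_measurable borel"
    using assms(1) by (rule borel_measurable_continuous_onI)
  have I: "integrable cyl (\<lambda>z. sine_weighted z * \<psi> (embed z))"
    by (rule integrable_mult_bounded[OF ds_int _ b]) measurable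
  have "\<bar>\<integral>z. sine_weighted z * \<psi> (embed z) \<partial>cyl\<bar> \<le> e * (\<integral>z. \<bar>sine_weighted z\<bar> \<partial>cyl)" if "e > 0" for e
  proof -
    define S where "S = ({-1..1} \<times> {-1..1} \<times> {-1..1} :: (real \<times> real \<times> real) set)"
    have "compact S" unfolding S_def by (intro compact_Times compact_Icc)
    from Stone_Weierstrass_real_polynomial_function[OF this continuous_on_subset[OF assms(1) subset_UNIV] that]
    obtain g where g: "real_polynomial_function g" "\<And>y. y \<in> S \<Longrightarrow> \<bar>\<psi> y - g y\<bar> < e" by blast
    have e: "embed z \<in> S" for z by (simp add: S_def embed_def)
    note t = trig_real_polynomial_function[OF g(1)]
    have "(\<integral>z. sine_weighted z * \<psi> (embed z) \<partial>cyl) = (\<integral>z. sine_weighted z * \<psi> (embed z) - sine_weighted z * g (embed z) \<partial>cyl)"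
      using I trig_mult_int[OF t] ds_trig[OF t] by simp
    also have "\<bar>\<dots>\<bar> \<le> (\<integral>z. \<bar>sine_weighted z * \<psi> (embed z) - sine_weighted z * g (embed z)\<bar> \<partial>cyl)"
      by (rule integral_abs_bound)
    also have "\<dots> \<le> (\<integral>z. e * \<bar>sine_weighted z\<bar> \<partial>cyl)"
    proof (rule integral_mono)
      show "integrable cyl (\<lambda>z. \<bar>sine_weighted z * \<psi> (embed z) - sine_weighted z * g (embed z)\<bar>)"
        using I trig_mult_int[OF t] by (intro integrable_abs Bochner_Integration.integrable_diff)
      show "integrable cyl (\<lambda>z. e * \<bar>sine_weighted z\<bar>)" using ds_int by simp
      fix z
      have "\<bar>sine_weighted z * \<psi> (embed z) - sine_weighted z * g (embed z)\<bar> = \<bar>\<psi> (embed z) - g (embed z)\<bar> * \<bar>sine_weighted z\<bar>"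
        by (simp add: abs_mult[symmetric] algebra_simps)
      also have "\<dots> \<le> e * \<bar>sine_weighted z\<bar>" using g(2)[OF e[of z]] by (intro mult_right_mono) auto
      finally show "\<bar>sine_weighted z * \<psi> (embed z) - sine_weighted z * g (embed z)\<bar> \<le> e * \<bar>sine_weighted z\<bar>" .
    qed
    finally show ?thesis by simp
  qed
  note bound = this
  define A where "A = (\<integral>z. \<bar>sine_weighted z\<bar> \<partial>cyl)"
  have "A \<ge> 0" by (simp add: A_def)
  have "\<bar>\<integral>z. sine_weighted z * \<psi> (embed z) \<partial>cyl\<bar> \<le> 0 + e" if "e > 0" for e
  proof -
    \<comment> \<open>Dividing by A + 1 rather than A covers the case A = 0.\<close>
    have "\<bar>\<integral>z. sine_weighted z * \<psi> (embed z) \<partial>cyl\<bar> \<le> e / (A + 1) * A"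
      using bound[of "e / (A + 1)"] that \<open>A \<ge> 0\<close> unfolding A_def[symmetric] by simp
    also have "\<dots> \<le> e" using that \<open>A \<ge> 0\<close> by (simp add: field_simps)
    finally show ?thesis by simp
  qed
  then have "\<bar>\<integral>z. sine_weighted z * \<psi> (embed z) \<partial>cyl\<bar> \<le> 0" by (rule field_le_epsilon)
  then show ?thesis by simp
qed

text \<open>The indicator of a closed set is the pointwise limit of continuous cut-offs of the
  distance, and dominated convergence applies with \<open>\<bar>sine_weighted\<bar>\<close>.
  Nonemptiness is assumed because \<open>infdist\<close> to the empty set is 0 by convention, which
  would make the cut-offs equal to 1 everywhere.\<close>

private lemma ds_closed_embed:
  assumes "closed C" and "C \<noteq> {}"
  shows "(\<integral>z. sine_weighted z * indicator C (embed z) \<partial>cyl) = 0"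
proof -
  define \<psi> where "\<psi> n y = max 0 (1 - real n * infdist y C)" for n and y :: "real \<times> real \<times> real"
  have c: "continuous_on UNIV (\<psi> n)" for n
    unfolding \<psi>_def[abs_def] by (intro continuous_intros)
  have [measurable]: "\<psi> n \<in> borel_measurable borel" for n
    by (rule borel_measurable_continuous_onI[OF c])
  have [measurable]: "C \<in> sets borel" using assms(1) by simp
  have b: "\<bar>\<psi> n y\<bar> \<le> 1" for n y by (simp add: \<psi>_def infdist_nonneg)
  have lim: "(\<lambda>n. \<psi> n y) \<longlonglongrightarrow> indicator C y" for y
  proof (cases "y \<in> C")
    case True
    then show ?thesis by (simp add: \<psi>_def)
  next
    case False
    then have pos: "infdist y C > 0"
      using assms in_closed_iff_infdist_zero[of C y] infdist_nonneg[of y C] by auto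
    obtain N where N: "real N > 1 / infdist y C" using reals_Archimedean2 by blast
    have "\<psi> n y = 0" if "n \<ge> N" for n
    proof -
      have "1 < real N * infdist y C" using N pos by (simp add: field_simps)
      also have "\<dots> \<le> real n * infdist y C" using that pos by (intro mult_right_mono) auto
      finally show ?thesis by (simp add: \<psi>_def)
    qed
    then have "eventually (\<lambda>n. \<psi> n y = 0) sequentially" by (auto simp: eventually_sequentially)
    then show ?thesis using False by (simp add: tendsto_eventually)
  qed
  have "(\<lambda>n. \<integral>z. sine_weighted z * \<psi> n (embed z) \<partial>cyl) \<longlonglongrightarrow> (\<integral>z. sine_weighted z * indicator C (embed z) \<partial>cyl)"
  proof (rule integral_dominated_convergence[where w="\<lambda>z. \<bar>sine_weighted z\<bar>"])
    show "integrable cyl (\<lambda>z. \<bar>sine_weighted z\<bar>)" using ds_int by simp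
    show "AE z in cyl. (\<lambda>n. sine_weighted z * \<psi> n (embed z)) \<longlonglongrightarrow> sine_weighted z * indicator C (embed z)"
      by (intro AE_I2 tendsto_mult tendsto_const lim)
    show "AE z in cyl. norm (sine_weighted z * \<psi> n (embed z)) \<le> \<bar>sine_weighted z\<bar>" for n
      using b by (intro AE_I2) (simp add: abs_mult mult_left_le)
  qed measurable
  then show ?thesis by (simp add: ds_cont[OF c b] LIMSEQ_const_iff)
qed

text \<open>The hypotheses are asymmetric because t = 0 and t = 2 pi have the same image: it is
  enough that one of the two points avoids both ends.\<close>

private lemma embed_inj:
  assumes "0 < fst z" "fst z < 2 * pi" "0 \<le> snd z" "snd z \<le> pi" "z' \<in> Omega" "embed z = embed z'"
  shows "z = z'"
proof -
  have z': "0 \<le> fst z'" "fst z' \<le> 2 * pi" "0 \<le> snd z'" "snd z' \<le> pi"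
    using assms(5) by (cases z', simp add: Omega_def)+
  have e: "cos (snd z) = cos (snd z')" "cos (fst z) = cos (fst z')" "sin (fst z) = sin (fst z')"
    using assms(6) by (simp_all add: embed_def)
  have "snd z = snd z'"
    by (rule cos_inj_pi[OF assms(3,4) z'(3,4) e(1)])
  moreover obtain n :: int where n: "fst z = fst z' + 2 * pi * n"
    using sin_cos_eq_iff[of "fst z" "fst z'"] e(2,3) by blast
  moreover have "n = 0"
  proof -
    from n z' assms(1,2) have "2 * pi * n < 2 * pi * 1" "2 * pi * (-1) < 2 * pi * n" by linarith+
    then have "real_of_int n < 1" "-1 < real_of_int n" by (simp_all only: mult_less_cancel_left_pos pi_gt_zero mult_pos_pos zero_less_numeral)
    then show ?thesis by linarith
  qed
  ultimately show ?thesis by (simp add: prod_eq_iff)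
qed

text \<open>The image of K within the compact domain is compact, hence closed, and almost everywhere
  membership in it is membership in K because \<open>embed\<close> is injective away from the end
  points in t.\<close>

private lemma ds_closed:
  assumes "closed K"
  shows "(\<integral>z. sine_weighted z * indicator K z \<partial>cyl) = 0"
proof (cases "K \<inter> Omega = {}")
  case True
  have "AE z in cyl. sine_weighted z * indicator K z = 0"
    using AE_cyl_interior
  proof eventually_elim
    case (elim z)
    then have "z \<in> Omega" by (cases z) (simp add: Omega_def)
    with True show ?case by (auto simp: indicator_def)
  qed
  then show ?thesis by (rule integral_eq_zero_AE)
next
  case False
  have [measurable]: "K \<in> sets borel" using assms by simp
  define C where "C = embed ` (K \<inter> Omega)"
  have "compact Omega" unfolding Omega_def by (intro compact_Times compact_Icc)
  then have "compact C" unfolding C_def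
    by (intro compact_continuous_image embed_cont) (use assms in \<open>auto intro: closed_Int_compact\<close>)
  then have cl: "closed C" by (rule compact_imp_closed)
  then have [measurable]: "C \<in> sets borel" by simp
  have "(\<integral>z. sine_weighted z * indicator K z \<partial>cyl) = (\<integral>z. sine_weighted z * indicator C (embed z) \<partial>cyl)"
  proof (rule integral_cong_AE)
    show "AE z in cyl. sine_weighted z * indicator K z = sine_weighted z * indicator C (embed z)"
      using AE_cyl_interior
    proof eventually_elim
      case (elim z)
      then have "z \<in> Omega" by (cases z) (simp add: Omega_def)
      then have "z \<in> K \<longleftrightarrow> embed z \<in> C"
        unfolding C_def using elim embed_inj[of z] by fastforce
      then show ?case by (simp add: indicator_def)
    qed
  qed measurable
  also have "\<dots> = 0" using False by (intro ds_closed_embed cl) (auto simp: C_def)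
  finally show ?thesis .
qed

private lemma ds_K_int:
  assumes [measurable]: "K \<in> sets borel"
  shows "integrable cyl (\<lambda>z. sine_weighted z * indicator K z)"
proof (rule integrable_mult_bounded[OF ds_int])
  show "indicator K \<in> borel_measurable cyl" by (rule borel_measurable_indicator) simp
  show "\<bar>indicator K z :: real\<bar> \<le> 1" for z by (auto simp: indicator_def)
qed

private lemma UNIV_borel: "(UNIV :: (real \<times> real) set) \<in> sets borel" by simp

text \<open>The positive and negative parts of \<open>sine_weighted\<close> are densities of two
  finite measures that agree on closed sets. Closed sets are stable under intersection and generate
  the Borel sets, so the measures and then the densities agree, which forces
  \<open>sine_weighted\<close> to vanish; finally sin x > 0 in the interior is divided out.\<close>

lemma AE_zero_of_orthogonal_modes: "AE z in cyl. d z = 0"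
proof -
  have fin: "(\<integral>\<^sup>+ z. ennreal (sine_weighted z * indicator K z) \<partial>cyl) < \<infinity>"
    "(\<integral>\<^sup>+ z. ennreal (- (sine_weighted z * indicator K z)) \<partial>cyl) < \<infinity>" if "K \<in> sets borel" for K
  proof -
    from ds_K_int[OF that] show "(\<integral>\<^sup>+ z. ennreal (sine_weighted z * indicator K z) \<partial>cyl) < \<infinity>"
      "(\<integral>\<^sup>+ z. ennreal (- (sine_weighted z * indicator K z)) \<partial>cyl) < \<infinity>"
      unfolding real_integrable_def infinity_ennreal_def less_top[symmetric] by blast+
  qed
  have e: "emeasure (density cyl (\<lambda>z. ennreal (sine_weighted z))) K = (\<integral>\<^sup>+ z. ennreal (sine_weighted z * indicator K z) \<partial>cyl)"
    "emeasure (density cyl (\<lambda>z. ennreal (- sine_weighted z))) K = (\<integral>\<^sup>+ z. ennreal (- (sine_weighted z * indicator K z)) \<partial>cyl)"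
    if [measurable]: "K \<in> sets borel" for K
  proof -
    have "ennreal (sine_weighted z) * indicator K z = ennreal (sine_weighted z * indicator K z)"
      "ennreal (- sine_weighted z) * indicator K z = ennreal (- (sine_weighted z * indicator K z))" for z
      by (simp_all split: split_indicator)
    then show "emeasure (density cyl (\<lambda>z. ennreal (sine_weighted z))) K = (\<integral>\<^sup>+ z. ennreal (sine_weighted z * indicator K z) \<partial>cyl)"
      "emeasure (density cyl (\<lambda>z. ennreal (- sine_weighted z))) K = (\<integral>\<^sup>+ z. ennreal (- (sine_weighted z * indicator K z)) \<partial>cyl)"
      by (simp_all add: emeasure_density)
  qed
  have sb: "sets (borel :: (real \<times> real) measure) = sigma_sets UNIV {K. closed K}"
    by (subst borel_eq_closed) (rule sets_measure_of, simp)
  have eq: "density cyl (\<lambda>z. ennreal (sine_weighted z)) = density cyl (\<lambda>z. ennreal (- sine_weighted z))"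
  proof (rule measure_eqI_generator_eq[where E="{K. closed K}" and \<Omega>=UNIV and A="\<lambda>_. UNIV"])
    show "Int_stable {K :: (real \<times> real) set. closed K}" by (auto simp: Int_stable_def)
    show "emeasure (density cyl (\<lambda>z. ennreal (sine_weighted z))) UNIV \<noteq> \<infinity>"
      using fin(1)[OF UNIV_borel] unfolding e(1)[OF UNIV_borel] infinity_ennreal_def less_top[symmetric]
      by blast
    show "sets (density cyl (\<lambda>z. ennreal (sine_weighted z))) = sigma_sets UNIV {K. closed K}"
      "sets (density cyl (\<lambda>z. ennreal (- sine_weighted z))) = sigma_sets UNIV {K. closed K}"
      using sb by simp_all
    fix K :: "(real \<times> real) set" assume "K \<in> {K. closed K}"
    then have K: "closed K" "K \<in> sets borel" by auto
    have "enn2real (\<integral>\<^sup>+ z. ennreal (sine_weighted z * indicator K z) \<partial>cyl)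
      = enn2real (\<integral>\<^sup>+ z. ennreal (- (sine_weighted z * indicator K z)) \<partial>cyl)"
      using ds_closed[OF K(1)] unfolding real_lebesgue_integral_def[OF ds_K_int[OF K(2)]] by simp
    then show "emeasure (density cyl (\<lambda>z. ennreal (sine_weighted z))) K = emeasure (density cyl (\<lambda>z. ennreal (- sine_weighted z))) K"
      unfolding e[OF K(2)] using fin[OF K(2)] by (metis ennreal_enn2real infinity_ennreal_def)
  qed auto
  have "AE z in cyl. ennreal (sine_weighted z) = ennreal (- sine_weighted z)"
    using eq by (subst (asm) TX.density_unique_iff) auto
  with AE_cyl_interior show ?thesis
  proof eventually_elim
    case (elim z)
    then have "sine_weighted z = 0"
      by (cases "sine_weighted z \<ge> 0") (auto simp: ennreal_neg)
    moreover have "sin (snd z) > 0" using elim by (intro sin_gt_zero) auto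
    ultimately show ?case by (simp add: sine_weighted_def)
  qed
qed

end

subsection \<open>The Green kernel\<close>

text \<open>The integral of cos (k s) over |s| < \<delta>.\<close>

definition arc_weight :: "nat \<Rightarrow> real \<Rightarrow> real"
  where "arc_weight k \<delta> = (if k = 0 then 2 * \<delta> else 2 * sin (k * \<delta>) / k)"

text \<open>The condition on the cosines selects an arc of half-width \<delta> centred at \<tau>,
  modulo 2 pi; the odd part of the integrand about \<tau> cancels.\<close>

lemma integral_cos_arc:
  fixes k :: nat and \<delta> \<theta> \<tau> :: real
  assumes \<delta>: "0 < \<delta>" "\<delta> \<le> pi"
  shows "(\<integral>t. of_bool (cos (t - \<tau>) > cos \<delta>) * cos (k * t + \<theta>) \<partial>ivl (2 * pi))
    = cos (k * \<tau> + \<theta>) * arc_weight k \<delta>"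
proof -
  define g where "g t = of_bool (cos (t - \<tau>) > cos \<delta>) * cos (real k * t + \<theta>)" for t :: real
  have [measurable]: "g \<in> borel_measurable borel" unfolding g_def[abs_def] by measurable
  have "periodic g"
  proof -
    have "cos (s + 2 * pi - \<tau>) = cos (s - \<tau>)" for s
      using cos_periodic[of "s - \<tau>"] by (simp add: algebra_simps)
    then show ?thesis using periodic_cos[of k \<theta>] by (simp add: periodic_def g_def)
  qed
  define \<phi> where "\<phi> = k * \<tau> + \<theta>"
  define f where "f s = cos (real k * (s - pi) + \<phi>)" for s :: real
  \<comment> \<open>Shifting by \<tau> - pi centres the arc at pi, so it does not wrap around the
    ends of [0, 2 pi].\<close>
  have "(\<integral>t. g t \<partial>ivl (2 * pi)) = (\<integral>s. g (s + (\<tau> - pi)) \<partial>ivl (2 * pi))"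
    using \<open>periodic g\<close> by (simp add: integral_periodic_shift)
  also have "\<dots> = (\<integral>s. indicator {0..2 * pi} s * g (s + (\<tau> - pi)) \<partial>lborel)"
    by (rule integral_ivl) measurable
  also have "\<dots> = (\<integral>s. indicator {pi - \<delta>..pi + \<delta>} s * f s \<partial>lborel)"
  proof (rule integral_cong_AE)
    show "AE s in lborel. indicator {0..2 * pi} s * g (s + (\<tau> - pi)) = indicator {pi - \<delta>..pi + \<delta>} s * f s"
      using AE_lborel_singleton[of "pi - \<delta>"] AE_lborel_singleton[of "pi + \<delta>"]
    proof eventually_elim
      case (elim s)
      have "g (s + (\<tau> - pi)) = of_bool (cos (s - pi) > cos \<delta>) * f s"
        by (simp add: g_def f_def \<phi>_def algebra_simps)
      moreover have "cos (s - pi) > cos \<delta> \<longleftrightarrow> pi - \<delta> < s \<and> s < pi + \<delta>" if "0 \<le> s" "s \<le> 2 * pi"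
      proof -
        have "cos (s - pi) > cos \<delta> \<longleftrightarrow> cos \<bar>s - pi\<bar> > cos \<delta>" by (simp add: abs_if)
        also have "\<dots> \<longleftrightarrow> \<bar>s - pi\<bar> < \<delta>" using \<delta> that by (intro cos_mono_less_eq) auto
        finally show ?thesis by auto
      qed
      ultimately show ?case using elim \<delta> by (auto simp: indicator_def)
    qed
    show "(\<lambda>s. indicator {pi - \<delta>..pi + \<delta>} s * f s) \<in> borel_measurable lborel"
      unfolding f_def by measurable
  qed measurable
  also have "\<dots> = cos \<phi> * arc_weight k \<delta>"
  proof (cases "k = 0")
    case True
    have "(\<integral>s. indicator {pi - \<delta>..pi + \<delta>} s * f s \<partial>lborel)
      = (\<lambda>s. s * cos \<phi>) (pi + \<delta>) - (\<lambda>s. s * cos \<phi>) (pi - \<delta>)"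
      using \<delta> True unfolding f_def
      by (intro integral_interval_FTC) (auto intro!: continuous_intros derivative_eq_intros)
    then show ?thesis using True by (simp add: arc_weight_def algebra_simps)
  next
    case False
    have "(\<integral>s. indicator {pi - \<delta>..pi + \<delta>} s * f s \<partial>lborel)
      = (\<lambda>s. sin (real k * (s - pi) + \<phi>) / k) (pi + \<delta>) - (\<lambda>s. sin (real k * (s - pi) + \<phi>) / k) (pi - \<delta>)"
      using \<delta> False unfolding f_def
      by (intro integral_interval_FTC) (auto intro!: continuous_intros derivative_eq_intros)
    also have "\<dots> = (sin (\<phi> + k * \<delta>) - sin (\<phi> - k * \<delta>)) / k"
      by (simp add: algebra_simps diff_divide_distrib)
    finally show ?thesis using False by (simp add: arc_weight_def sin_add sin_diff algebra_simps)
  qed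
  finally show ?thesis by (simp add: g_def \<phi>_def)
qed

lemma integral_sin_arc_weight:
  fixes j k :: nat and \<xi> :: real
  assumes j: "j \<noteq> 0" "j \<noteq> k" and \<xi>: "0 \<le> \<xi>" "\<xi> \<le> pi"
  shows "(\<integral>x. sin (j * x) * (of_bool (x < \<xi>) * arc_weight k (\<xi> - x)) \<partial>ivl pi)
    = (if k = 0 then 2 * (\<xi> / j - sin (j * \<xi>) / (real j)^2)
       else 2 * (sin (j * \<xi>) - real j / real k * sin (k * \<xi>)) / ((real k)^2 - (real j)^2))"
proof -
  define f :: "real \<Rightarrow> real" where "f x = sin (real j * x) * arc_weight k (\<xi> - x)" for x
  have cf: "continuous_on UNIV f"
    unfolding f_def arc_weight_def by (cases "k = 0") (auto intro!: continuous_intros)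
  then have [measurable]: "f \<in> borel_measurable borel" by (rule borel_measurable_continuous_onI)
  have [measurable]: "arc_weight k \<in> borel_measurable borel"
    unfolding arc_weight_def[abs_def] by measurable
  have "(\<integral>x. sin (j * x) * (of_bool (x < \<xi>) * arc_weight k (\<xi> - x)) \<partial>ivl pi)
    = (\<integral>x. indicator {0..pi} x * (sin (j * x) * (of_bool (x < \<xi>) * arc_weight k (\<xi> - x))) \<partial>lborel)"
    by (rule integral_ivl) measurable
  also have "\<dots> = (\<integral>x. indicator {0..\<xi>} x * f x \<partial>lborel)"
    using \<xi> AE_lborel_singleton[of \<xi>]
    by (intro integral_cong_AE) (auto elim!: eventually_mono simp: f_def indicator_def)
  also have "\<dots> = (if k = 0 then 2 * (\<xi> / j - sin (j * \<xi>) / (real j)^2)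
       else 2 * (sin (j * \<xi>) - real j / real k * sin (k * \<xi>)) / ((real k)^2 - (real j)^2))"
  proof (cases "k = 0")
    case True
    \<comment> \<open>Found by integrating (\<xi> - x) sin (j x) by parts.\<close>
    define F where "F x = 2 * (- (\<xi> - x) * cos (j * x) / j - sin (j * x) / (real j)^2)" for x :: real
    have "(\<integral>x. indicator {0..\<xi>} x * f x \<partial>lborel) = F \<xi> - F 0"
    proof (rule integral_interval_FTC[OF \<xi>(1) cf])
      fix s :: real
      show "(F has_field_derivative f s) (at s)"
        unfolding F_def[abs_def] f_def arc_weight_def using j True
        by (auto intro!: derivative_eq_intros simp: field_simps power2_eq_square)
    qed
    then show ?thesis using True by (simp add: F_def)
  next
    case False
    define D where "D = (real k)^2 - (real j)^2"
    have D: "D \<noteq> 0" using j unfolding D_def by (simp add: power2_eq_iff)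
    \<comment> \<open>A Wronskian-type expression: on differentiation the two cos cos terms cancel
      and (k^2 - j^2) sin sin remains.\<close>
    define F where "F x = 2 / (k * D) * (j * cos (j * x) * sin (k * (\<xi> - x)) + k * sin (j * x) * cos (k * (\<xi> - x)))" for x :: real
    have "(\<integral>x. indicator {0..\<xi>} x * f x \<partial>lborel) = F \<xi> - F 0"
    proof (rule integral_interval_FTC[OF \<xi>(1) cf])
      fix s :: real
      have "(F has_field_derivative 2 / (k * D) * (((real k)^2 - (real j)^2) * (sin (j * s) * sin (k * (\<xi> - s))))) (at s)"
        unfolding F_def[abs_def]
        by (rule derivative_eq_intros refl | simp add: algebra_simps power2_eq_square)+
      also have "2 / (k * D) * (((real k)^2 - (real j)^2) * (sin (j * s) * sin (k * (\<xi> - s)))) = f s"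
        using False D by (simp add: f_def arc_weight_def D_def[symmetric])
      finally show "(F has_field_derivative f s) (at s)" .
    qed
    also have "F \<xi> - F 0 = 2 * (sin (j * \<xi>) - real j / real k * sin (k * \<xi>)) / D"
      using False D by (simp add: F_def field_simps)
    finally show ?thesis using False by (simp add: D_def)
  qed
  finally show ?thesis .
qed

text \<open>Backward light cone in \<open>x\<close>: modulo \<open>2 pi\<close> the condition on the cosines is \<open>\<bar>t - \<tau>\<bar> < \<xi> - x\<close>.\<close>

definition arc :: "real \<times> real \<Rightarrow> real \<times> real \<Rightarrow> real"
  where "arc z \<zeta> = of_bool (snd z < snd \<zeta> \<and> cos (fst z - fst \<zeta>) > cos (snd \<zeta> - snd z))"

lemma arc_measurable [measurable]:
  "(\<lambda>(z, \<zeta>). arc z \<zeta>) \<in> borel_measurable (borel \<Otimes>\<^sub>M borel)"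
  unfolding arc_def by (simp add: case_prod_unfold borel_prod[symmetric])

lemma arc_bounds: "\<bar>arc z \<zeta>\<bar> \<le> 1"
  by (simp add: arc_def)

text \<open>Up to the factor 2 / (k^2 - j^2) the value is the mode at \<zeta> plus a solution of the
  homogeneous wave equation: a multiple of sin (k x) cos (k t + \<theta>) for k \<noteq> 0 and of x
  for k = 0. These extra terms are what \<open>wave_part_mode\<close> has to remove.\<close>

lemma integral_arc_mode:
  fixes j k :: nat and \<theta> :: real and \<zeta> :: "real \<times> real"
  assumes j: "j \<noteq> 0" "j \<noteq> k" and \<zeta>: "\<zeta> \<in> Omega"
  shows "(\<integral>z. arc z \<zeta> * mode j k \<theta> z \<partial>cyl) = cos (k * fst \<zeta> + \<theta>) *
    (if k = 0 then 2 * (snd \<zeta> / j - sin (j * snd \<zeta>) / (real j)^2)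
       else 2 * (sin (j * snd \<zeta>) - real j / real k * sin (k * snd \<zeta>)) / ((real k)^2 - (real j)^2))"
proof -
  obtain \<tau> \<xi> where eq: "\<zeta> = (\<tau>, \<xi>)" and \<xi>: "0 \<le> \<xi>" "\<xi> \<le> pi" using \<zeta> by (cases \<zeta>) (auto simp: Omega_def)
  have [measurable]: "(\<lambda>z. arc z \<zeta>) \<in> borel_measurable borel"
    by measurable
  have I: "integrable cyl (\<lambda>z. arc z \<zeta> * mode j k \<theta> z)"
    by (intro integrable_cyl_bounded[where B=1])
      (auto simp: abs_mult intro!: mult_le_one arc_bounds mode_le_1)
  have "(\<integral>z. arc z \<zeta> * mode j k \<theta> z \<partial>cyl)
    = (\<integral>x. (\<integral>t. arc (t, x) \<zeta> * mode j k \<theta> (t, x) \<partial>ivl (2 * pi)) \<partial>ivl pi)"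
    using TX.integral_snd[of "\<lambda>t x. arc (t, x) \<zeta> * mode j k \<theta> (t, x)"] I
    by (simp add: cyl_def case_prod_unfold)
  also have "\<dots> = (\<integral>x. cos (k * \<tau> + \<theta>) * (sin (j * x) * (of_bool (x < \<xi>) * arc_weight k (\<xi> - x))) \<partial>ivl pi)"
  proof (rule integral_cong_AE)
    have [measurable]: "arc_weight k \<in> borel_measurable borel"
      unfolding arc_weight_def[abs_def] by measurable
    show "(\<lambda>x. cos (k * \<tau> + \<theta>) * (sin (j * x) * (of_bool (x < \<xi>) * arc_weight k (\<xi> - x)))) \<in> borel_measurable (ivl pi)"
      by measurable
    have [measurable]: "(\<lambda>z. arc z \<zeta> * mode j k \<theta> z) \<in> borel_measurable (borel \<Otimes>\<^sub>M borel)"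
      unfolding borel_prod by measurable
    show "(\<lambda>x. \<integral>t. arc (t, x) \<zeta> * mode j k \<theta> (t, x) \<partial>ivl (2 * pi)) \<in> borel_measurable (ivl pi)"
      by measurable
    have "AE x in lborel. x \<noteq> (0::real)" by (rule AE_lborel_singleton)
    then show "AE x in ivl pi. (\<integral>t. arc (t, x) \<zeta> * mode j k \<theta> (t, x) \<partial>ivl (2 * pi))
        = cos (k * \<tau> + \<theta>) * (sin (j * x) * (of_bool (x < \<xi>) * arc_weight k (\<xi> - x)))"
      unfolding AE_ivl_iff
    proof eventually_elim
      case (elim x)
      show ?case
      proof
        assume x: "x \<in> {0..pi}"
        show "(\<integral>t. arc (t, x) \<zeta> * mode j k \<theta> (t, x) \<partial>ivl (2 * pi))
          = cos (k * \<tau> + \<theta>) * (sin (j * x) * (of_bool (x < \<xi>) * arc_weight k (\<xi> - x)))"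
        proof (cases "x < \<xi>")
          case True
          have "(\<integral>t. arc (t, x) \<zeta> * mode j k \<theta> (t, x) \<partial>ivl (2 * pi))
            = (\<integral>t. sin (j * x) * (of_bool (cos (t - \<tau>) > cos (\<xi> - x)) * cos (k * t + \<theta>)) \<partial>ivl (2 * pi))"
            using True by (intro Bochner_Integration.integral_cong) (auto simp: arc_def mode_def eq)
          also have "\<dots> = sin (j * x) * (cos (k * \<tau> + \<theta>) * arc_weight k (\<xi> - x))"
            using True x \<xi> by (subst integral_mult_right_zero, subst integral_cos_arc) auto
          finally show ?thesis using True by simp
        qed (simp add: arc_def eq)
      qed
    qed
  qed
  also have "\<dots> = cos (k * \<tau> + \<theta>) * (if k = 0 then 2 * (\<xi> / j - sin (j * \<xi>) / (real j)^2)
       else 2 * (sin (j * \<xi>) - real j / real k * sin (k * \<xi>)) / ((real k)^2 - (real j)^2))"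
    unfolding integral_mult_right_zero integral_sin_arc_weight[OF j \<xi>] ..
  finally show ?thesis by (simp add: eq)
qed

interpretation CC: pair_sigma_finite cyl cyl ..

lemma AE_cyl_Omega: "AE z in cyl. z \<in> Omega"
  using AE_cyl_interior by eventually_elim (auto simp: Omega_def mem_Times_iff)

lemma
  fixes a c :: "real \<Rightarrow> real"
  assumes a: "integrable (ivl (2 * pi)) a" and c: "integrable (ivl pi) c"
  shows integrable_cyl_product: "integrable cyl (\<lambda>z. a (fst z) * c (snd z))"
    and integral_cyl_product:
      "(\<integral>z. a (fst z) * c (snd z) \<partial>cyl) = (\<integral>t. a t \<partial>ivl (2 * pi)) * (\<integral>x. c x \<partial>ivl pi)"
proof -
  show I: "integrable cyl (\<lambda>z. a (fst z) * c (snd z))"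
    unfolding cyl_def
  proof (rule TX.Fubini_integrable)
    show "integrable (ivl (2 * pi)) (\<lambda>x. \<integral>y. norm (a (fst (x, y)) * c (snd (x, y))) \<partial>ivl pi)"
      using a c by (simp add: abs_mult)
  qed (use a c in auto)
  have "(\<integral>z. a (fst z) * c (snd z) \<partial>cyl) = (\<integral>t. (\<integral>x. a t * c x \<partial>ivl pi) \<partial>ivl (2 * pi))"
    using TX.integral_fst[of "\<lambda>t x. a t * c x"] I by (simp add: cyl_def case_prod_unfold)
  then show "(\<integral>z. a (fst z) * c (snd z) \<partial>cyl) = (\<integral>t. a t \<partial>ivl (2 * pi)) * (\<integral>x. c x \<partial>ivl pi)"
    by simp
qed

lemma integrable_ivl_continuous:
  fixes f :: "real \<Rightarrow> real"
  assumes "continuous_on UNIV f"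
  shows "integrable (ivl a) f"
proof -
  have [measurable]: "f \<in> borel_measurable borel"
    using assms by (rule borel_measurable_continuous_onI)
  have "set_integrable lborel {0..a} f"
    using assms by (intro borel_integrable_atLeastAtMost') (rule continuous_on_subset, auto)
  then show ?thesis
    unfolding ivl_density_real by (subst integrable_density) (auto simp: set_integrable_def)
qed

lemma integral_cos_period:
  fixes \<theta> :: real
  shows "(\<integral>t. cos (real k * t + \<theta>) \<partial>ivl (2 * pi)) = (if k = 0 then 2 * pi * cos \<theta> else 0)"
proof (cases "k = 0")
  case True
  then show ?thesis by (simp add: measure_ivl_UNIV)
next
  case False
  have "(\<integral>t. cos (real k * t + \<theta>) \<partial>ivl (2 * pi))
    = (\<lambda>t. sin (real k * t + \<theta>) / k) (2 * pi) - (\<lambda>t. sin (real k * t + \<theta>) / k) 0"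
    using False by (intro integral_ivl_FTC) (auto intro!: continuous_intros derivative_eq_intros)
  also have "\<dots> = 0"
    using periodic_sin[of k \<theta>, unfolded periodic_def, rule_format, of 0] by simp
  finally show ?thesis using False by simp
qed

lemma integral_linear_mode:
  assumes "j \<noteq> 0"
  shows "(\<integral>z. (pi - snd z) / pi * mode j k \<theta> z \<partial>cyl) = (if k = 0 then 2 * pi * cos \<theta> / j else 0)"
    and "integrable cyl (\<lambda>z. (pi - snd z) / pi * mode j k \<theta> z)"
proof -
  define c where "c x = (pi - x) / pi * sin (real j * x)" for x
  define F where "F x = - (pi - x) * cos (real j * x) / (j * pi) - sin (real j * x) / (j^2 * pi)" for x
  have c_cont: "continuous_on UNIV c" unfolding c_def by (intro continuous_intros) simp
  have "(\<integral>x. c x \<partial>ivl pi) = F pi - F 0"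
  proof (rule integral_ivl_FTC[OF _ c_cont])
    fix s show "(F has_field_derivative c s) (at s)"
      unfolding F_def[abs_def] c_def using assms
      by (auto intro!: derivative_eq_intros simp: field_simps power2_eq_square)
  qed simp
  then have c: "(\<integral>x. c x \<partial>ivl pi) = 1 / j" by (simp add: F_def)
  have a: "integrable (ivl (2 * pi)) (\<lambda>t. cos (real k * t + \<theta>))"
    by (intro integrable_ivl_continuous continuous_intros)
  have eq: "(\<lambda>z. (pi - snd z) / pi * mode j k \<theta> z) = (\<lambda>z. cos (real k * fst z + \<theta>) * c (snd z))"
    by (auto simp: mode_def c_def)
  show "(\<integral>z. (pi - snd z) / pi * mode j k \<theta> z \<partial>cyl) = (if k = 0 then 2 * pi * cos \<theta> / j else 0)"
    unfolding eq integral_cyl_product[OF a integrable_ivl_continuous[OF c_cont]] integral_cos_period c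
    by simp
  show "integrable cyl (\<lambda>z. (pi - snd z) / pi * mode j k \<theta> z)"
    unfolding eq by (rule integrable_cyl_product[OF a integrable_ivl_continuous[OF c_cont]])
qed

text \<open>For a source orthogonal to the kernel of \<open>L\<close> this solves \<open>L w = \<kappa>\<close>; the linear term restores the
  boundary condition at \<open>x = 0\<close>.\<close>

definition wave_part :: "(real \<times> real \<Rightarrow> real) \<Rightarrow> real \<times> real \<Rightarrow> real"
  where "wave_part \<kappa> z = - (\<integral>\<zeta>. arc z \<zeta> * \<kappa> \<zeta> \<partial>cyl) / 2
    + (\<integral>\<zeta>. snd \<zeta> * \<kappa> \<zeta> \<partial>cyl) / (2 * pi) * ((pi - snd z) / pi)"

context
  fixes \<kappa> :: "real \<times> real \<Rightarrow> real"
  assumes kap: "integrable cyl \<kappa>"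
begin

private lemma kap_meas [measurable]: "\<kappa> \<in> borel_measurable borel"
  using borel_measurable_integrable[OF kap] by simp

private lemma cc: "sets (cyl \<Otimes>\<^sub>M cyl) = sets (borel \<Otimes>\<^sub>M borel)"
  by (intro sets_pair_measure_cong) auto

private lemma arc_kap_meas [measurable]:
  "(\<lambda>(z, \<zeta>). arc z \<zeta> * \<kappa> \<zeta>) \<in> borel_measurable (cyl \<Otimes>\<^sub>M cyl)"
  unfolding measurable_cong_sets[OF cc refl] by measurable

private lemma arc_part_measurable [measurable]:
  "(\<lambda>z. \<integral>\<zeta>. arc z \<zeta> * \<kappa> \<zeta> \<partial>cyl) \<in> borel_measurable borel"
proof -
  have "(\<lambda>z. \<integral>\<zeta>. arc z \<zeta> * \<kappa> \<zeta> \<partial>cyl) \<in> borel_measurable cyl"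
    by measurable
  then show ?thesis by simp
qed

private lemma snd_meas [measurable]: "(\<lambda>z::real\<times>real. snd z) \<in> borel_measurable borel"
  by (intro borel_measurable_continuous_onI continuous_intros)

lemma wave_part_measurable [measurable]: "wave_part \<kappa> \<in> borel_measurable borel"
  unfolding wave_part_def[abs_def] by measurable

private lemma arc_part_bound: "\<bar>\<integral>\<zeta>. arc z \<zeta> * \<kappa> \<zeta> \<partial>cyl\<bar> \<le> (\<integral>\<zeta>. \<bar>\<kappa> \<zeta>\<bar> \<partial>cyl)"
proof -
  have "\<bar>\<integral>\<zeta>. arc z \<zeta> * \<kappa> \<zeta> \<partial>cyl\<bar> \<le> (\<integral>\<zeta>. \<bar>arc z \<zeta> * \<kappa> \<zeta>\<bar> \<partial>cyl)" by (rule integral_abs_bound)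
  also have "\<dots> \<le> (\<integral>\<zeta>. \<bar>\<kappa> \<zeta>\<bar> \<partial>cyl)"
  proof (rule integral_mono)
    have [measurable]: "(\<lambda>\<zeta>. arc z \<zeta>) \<in> borel_measurable borel" by measurable
    show "integrable cyl (\<lambda>\<zeta>. \<bar>arc z \<zeta> * \<kappa> \<zeta>\<bar>)"
      using integrable_mult_bounded[OF kap, of "arc z" 1] arc_bounds by (simp add: mult.commute)
  qed (use kap arc_bounds in \<open>auto simp: abs_mult mult_left_le_one_le\<close>)
  finally show ?thesis .
qed

text \<open>Only the L1 norm of the source enters the cone term, since \<open>arc\<close> takes
  values 0 and 1. The bound holds at every point of the domain, not just almost everywhere.\<close>

lemma wave_part_bound:
  assumes "z \<in> Omega"
  shows "\<bar>wave_part \<kappa> z\<bar> \<le> (\<integral>\<zeta>. \<bar>\<kappa> \<zeta>\<bar> \<partial>cyl) / 2 + \<bar>\<integral>\<zeta>. snd \<zeta> * \<kappa> \<zeta> \<partial>cyl\<bar> / (2 * pi)"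
proof -
  have "\<bar>(pi - snd z) / pi\<bar> \<le> 1" using assms by (cases z) (auto simp: Omega_def field_simps)
  then have "\<bar>(\<integral>\<zeta>. snd \<zeta> * \<kappa> \<zeta> \<partial>cyl) / (2 * pi) * ((pi - snd z) / pi)\<bar>
      \<le> \<bar>(\<integral>\<zeta>. snd \<zeta> * \<kappa> \<zeta> \<partial>cyl) / (2 * pi)\<bar> * 1"
    unfolding abs_mult by (intro mult_left_mono) auto
  moreover have "\<bar>- (\<integral>\<zeta>. arc z \<zeta> * \<kappa> \<zeta> \<partial>cyl) / 2\<bar> \<le> (\<integral>\<zeta>. \<bar>\<kappa> \<zeta>\<bar> \<partial>cyl) / 2"
    using arc_part_bound[of z] by simp
  ultimately show ?thesis
    unfolding wave_part_def by (intro order.trans[OF abs_triangle_ineq] add_mono) auto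
qed

private lemma kap_snd: "integrable cyl (\<lambda>\<zeta>. snd \<zeta> * \<kappa> \<zeta>)"
proof -
  have "AE z in cyl. \<bar>snd z\<bar> \<le> pi" using AE_cyl_interior by eventually_elim auto
  then have "integrable cyl (\<lambda>\<zeta>. \<kappa> \<zeta> * snd \<zeta>)"
    by (intro integrable_mult_bounded_AE[OF kap]) measurable
  then show ?thesis by (simp add: mult.commute)
qed

private lemma kap_mode: "integrable cyl (\<lambda>\<zeta>. \<kappa> \<zeta> * mode j k \<theta> \<zeta>)"
  by (rule integrable_mult_bounded[OF kap _ mode_le_1]) measurable

private lemma arc_fubini:
  shows "(\<integral>z. (\<integral>\<zeta>. arc z \<zeta> * \<kappa> \<zeta> \<partial>cyl) * mode j k \<theta> z \<partial>cyl)
    = (\<integral>\<zeta>. \<kappa> \<zeta> * (\<integral>z. arc z \<zeta> * mode j k \<theta> z \<partial>cyl) \<partial>cyl)" (is ?eq)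
    and "integrable cyl (\<lambda>z. (\<integral>\<zeta>. arc z \<zeta> * \<kappa> \<zeta> \<partial>cyl) * mode j k \<theta> z)" (is ?int)
proof -
  define h where "h z \<zeta> = arc z \<zeta> * \<kappa> \<zeta> * mode j k \<theta> z" for z \<zeta>
  have k2: "integrable (cyl \<Otimes>\<^sub>M cyl) (\<lambda>(z, \<zeta>). \<kappa> \<zeta>)"
  proof (rule CC.Fubini_integrable)
    show "(\<lambda>(z, \<zeta>). \<kappa> \<zeta>) \<in> borel_measurable (cyl \<Otimes>\<^sub>M cyl)"
      unfolding measurable_cong_sets[OF cc refl] by measurable
  qed (use kap in auto)
  have bm: "(\<lambda>x. arc (fst x) (snd x) * mode j k \<theta> (fst x)) \<in> borel_measurable (cyl \<Otimes>\<^sub>M cyl)"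
    unfolding measurable_cong_sets[OF cc refl] using arc_measurable by (simp add: case_prod_unfold)
  have "integrable (cyl \<Otimes>\<^sub>M cyl) (\<lambda>x. (\<lambda>(z, \<zeta>). \<kappa> \<zeta>) x * (arc (fst x) (snd x) * mode j k \<theta> (fst x)))"
    using mode_le_1 arc_bounds
    by (intro integrable_mult_bounded[OF k2 bm, where B=1]) (auto simp: abs_mult intro!: mult_le_one)
  then have I: "integrable (cyl \<Otimes>\<^sub>M cyl) (case_prod h)"
    by (simp add: h_def case_prod_unfold mult_ac)
  have "(\<integral>z. (\<integral>\<zeta>. h z \<zeta> \<partial>cyl) \<partial>cyl) = (\<integral>\<zeta>. (\<integral>z. h z \<zeta> \<partial>cyl) \<partial>cyl)"
    using CC.Fubini_integral[OF I] by simp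
  moreover have "(\<lambda>z. h z \<zeta>) = (\<lambda>z. \<kappa> \<zeta> * (arc z \<zeta> * mode j k \<theta> z))" for \<zeta>
    by (auto simp: h_def)
  then have "(\<integral>z. h z \<zeta> \<partial>cyl) = \<kappa> \<zeta> * (\<integral>z. arc z \<zeta> * mode j k \<theta> z \<partial>cyl)" for \<zeta>
    by (simp only: integral_mult_right_zero)
  moreover have "(\<integral>\<zeta>. h z \<zeta> \<partial>cyl) = (\<integral>\<zeta>. arc z \<zeta> * \<kappa> \<zeta> \<partial>cyl) * mode j k \<theta> z" for z
    unfolding h_def by (rule integral_mult_left_zero)
  ultimately show ?eq by simp
  show ?int using CC.integrable_fst[OF I] by (simp add: h_def)
qed

text \<open>Fubini moves the cone integral onto the mode. For k \<noteq> 0 the homogeneous remainder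
  is a multiple of the kernel mode and disappears by the solvability condition \<open>res\<close>.
  For k = 0 it is - cos \<theta> / j times the first moment c of the source in x, and the linear
  correction contributes exactly the opposite; this fixes the factor 1 / (2 pi) in
  \<open>wave_part\<close>.\<close>

lemma wave_part_mode:
  assumes j: "j \<noteq> 0" "j \<noteq> k" and res: "k \<noteq> 0 \<Longrightarrow> (\<integral>z. \<kappa> z * mode k k \<theta> z \<partial>cyl) = 0"
  shows "(\<integral>z. wave_part \<kappa> z * mode j k \<theta> z \<partial>cyl) = (\<integral>z. \<kappa> z * mode j k \<theta> z \<partial>cyl) / ((real j)^2 - (real k)^2)"
proof -
  define c where "c = (\<integral>\<zeta>. snd \<zeta> * \<kappa> \<zeta> \<partial>cyl)"
  define m where "m = (\<integral>z. \<kappa> z * mode j k \<theta> z \<partial>cyl)"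
  have arcs: "(\<integral>\<zeta>. \<kappa> \<zeta> * (\<integral>z. arc z \<zeta> * mode j k \<theta> z \<partial>cyl) \<partial>cyl)
    = (if k = 0 then 2 * cos \<theta> / j * c - 2 / (real j)^2 * m else 2 / ((real k)^2 - (real j)^2) * m)"
  proof (cases "k = 0")
    case True
    have "(\<integral>\<zeta>. \<kappa> \<zeta> * (\<integral>z. arc z \<zeta> * mode j k \<theta> z \<partial>cyl) \<partial>cyl)
      = (\<integral>\<zeta>. 2 * cos \<theta> / j * (snd \<zeta> * \<kappa> \<zeta>) - 2 / (real j)^2 * (\<kappa> \<zeta> * mode j k \<theta> \<zeta>) \<partial>cyl)"
    proof (rule Bochner_Integration.integral_cong_AE)
      show "AE \<zeta> in cyl. \<kappa> \<zeta> * (\<integral>z. arc z \<zeta> * mode j k \<theta> z \<partial>cyl)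
          = 2 * cos \<theta> / j * (snd \<zeta> * \<kappa> \<zeta>) - 2 / (real j)^2 * (\<kappa> \<zeta> * mode j k \<theta> \<zeta>)"
        using AE_cyl_Omega
      proof eventually_elim
        case (elim \<zeta>)
        show ?case unfolding integral_arc_mode[OF j elim] using True by (simp add: mode_def algebra_simps)
      qed
    qed measurable
    also have "\<dots> = 2 * cos \<theta> / j * c - 2 / (real j)^2 * m"
      unfolding c_def m_def using kap_snd kap_mode by simp
    finally show ?thesis using True by simp
  next
    case False
    have "(\<integral>\<zeta>. \<kappa> \<zeta> * (\<integral>z. arc z \<zeta> * mode j k \<theta> z \<partial>cyl) \<partial>cyl)
      = (\<integral>\<zeta>. 2 / ((real k)^2 - (real j)^2) * (\<kappa> \<zeta> * mode j k \<theta> \<zeta> - real j / real k * (\<kappa> \<zeta> * mode k k \<theta> \<zeta>)) \<partial>cyl)"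
    proof (rule Bochner_Integration.integral_cong_AE)
      show "AE \<zeta> in cyl. \<kappa> \<zeta> * (\<integral>z. arc z \<zeta> * mode j k \<theta> z \<partial>cyl)
          = 2 / ((real k)^2 - (real j)^2) * (\<kappa> \<zeta> * mode j k \<theta> \<zeta> - real j / real k * (\<kappa> \<zeta> * mode k k \<theta> \<zeta>))"
        using AE_cyl_Omega
      proof eventually_elim
        case (elim \<zeta>)
        show ?case unfolding integral_arc_mode[OF j elim] using False
          by (simp add: mode_def algebra_simps diff_divide_distrib)
      qed
    qed measurable
    also have "\<dots> = 2 / ((real k)^2 - (real j)^2) * m"
      unfolding m_def using kap_mode res[OF False] by simp
    finally show ?thesis using False by simp
  qed
  have "(\<integral>z. wave_part \<kappa> z * mode j k \<theta> z \<partial>cyl)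
    = (\<integral>z. - (1 / 2) * ((\<integral>\<zeta>. arc z \<zeta> * \<kappa> \<zeta> \<partial>cyl) * mode j k \<theta> z) + c / (2 * pi) * ((pi - snd z) / pi * mode j k \<theta> z) \<partial>cyl)"
    unfolding wave_part_def c_def[symmetric] distrib_right mult.assoc by simp
  also have "\<dots> = - (1 / 2) * (\<integral>z. (\<integral>\<zeta>. arc z \<zeta> * \<kappa> \<zeta> \<partial>cyl) * mode j k \<theta> z \<partial>cyl)
    + c / (2 * pi) * (\<integral>z. (pi - snd z) / pi * mode j k \<theta> z \<partial>cyl)"
    unfolding integral_mult_right_zero[symmetric]
    by (intro Bochner_Integration.integral_add integrable_mult_right arc_fubini(2) integral_linear_mode(2)[OF j(1)])
  also have "\<dots> = m / ((real j)^2 - (real k)^2)"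
    unfolding arc_fubini(1) arcs integral_linear_mode(1)[OF j(1)]
    using j by (auto simp: field_simps power2_eq_iff)
  finally show ?thesis by (simp add: m_def)
qed

end

section \<open>Splitting a solution into a bounded part and a travelling wave\<close>

lemma integrable_travel:
  assumes p: "integrable (ivl (2 * pi)) p" "periodic p"
  shows "integrable cyl (travel p)"
  using Bochner_Integration.integrable_diff[OF integrable_char[OF p, of 1] integrable_char[OF p, of "-1"]]
  by (simp add: travel_def[abs_def])

lemma integral_travel_mode:
  assumes p: "integrable (ivl (2 * pi)) p" "periodic p" and j: "j \<noteq> 0"
  shows "(\<integral>z. travel p z * mode j k \<theta> z \<partial>cyl)
    = (if j = k then pi * (\<integral>s. p s * sin (j * s + \<theta>) \<partial>ivl (2 * pi)) else 0)"
proof -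
  have [measurable]: "p \<in> borel_measurable borel" using borel_measurable_integrable[OF p(1)] by simp
  have "integrable cyl (\<lambda>z. mode j k \<theta> z * p (fst z + c * snd z))" for c
    using integrable_mult_bounded[OF integrable_char[OF p, of c], of "mode j k \<theta>" 1] mode_le_1
    by (simp add: mult.commute)
  from travel_adjoint(2)[OF _ _ p(2) this]
  have "(\<integral>z. travel p z * mode j k \<theta> z \<partial>cyl) = 2 * pi * (\<integral>s. p s * kproj (mode j k \<theta>) s \<partial>ivl (2 * pi))"
    by (simp add: mult.commute)
  then show ?thesis unfolding kproj_mode[OF j] by auto
qed

lemma travel_adjoint_bounded:
  assumes d: "integrable cyl d" and \<rho>: "\<rho> \<in> borel_measurable borel" "periodic \<rho>" "\<And>s. \<bar>\<rho> s\<bar> \<le> B"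
  shows "integrable cyl (\<lambda>z. d z * travel \<rho> z)"
    and "(\<integral>z. d z * travel \<rho> z \<partial>cyl) = 2 * pi * (\<integral>s. \<rho> s * kproj d s \<partial>ivl (2 * pi))"
proof -
  note [measurable] = \<rho>(1)
  have [measurable]: "d \<in> borel_measurable borel" using borel_measurable_integrable[OF d] by simp
  have [measurable]: "(\<lambda>z. \<rho> (fst z + c * snd z)) \<in> borel_measurable borel" for c
    unfolding borel_prod[symmetric] by measurable
  have I: "integrable cyl (\<lambda>z. d z * \<rho> (fst z + c * snd z))" for c
    by (rule integrable_mult_bounded[OF d _ \<rho>(3)]) measurable
  show "integrable cyl (\<lambda>z. d z * travel \<rho> z)"
    and "(\<integral>z. d z * travel \<rho> z \<partial>cyl) = 2 * pi * (\<integral>s. \<rho> s * kproj d s \<partial>ivl (2 * pi))"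
    using travel_adjoint[OF _ \<rho>(1,2) I] by simp_all
qed

text \<open>The difference u - w and the travelling wave have the same coefficients. Off the
  diagonal both vanish, because w inherits the coefficients of u after division by the nonzero
  eigenvalue; on the diagonal they agree since \<open>kproj\<close> is adjoint to
  \<open>travel\<close>. Completeness then gives equality.\<close>

lemma wave_decomposition:
  assumes u: "integrable cyl u" and \<kappa>: "integrable cyl \<kappa>"
    and H: "\<And>j k \<theta>. j \<noteq> 0 \<Longrightarrow>
      ((real j)^2 - (real k)^2) * (\<integral>z. u z * mode j k \<theta> z \<partial>cyl) = (\<integral>z. \<kappa> z * mode j k \<theta> z \<partial>cyl)"
  defines "p \<equiv> kproj (\<lambda>z. u z - wave_part \<kappa> z)"
  shows "AE z in cyl. u z = wave_part \<kappa> z + travel p z"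
    and "integrable cyl (wave_part \<kappa>)"
proof -
  define w where "w = wave_part \<kappa>"
  have [measurable]: "w \<in> borel_measurable borel" unfolding w_def by (rule wave_part_measurable[OF \<kappa>])
  obtain B where "\<And>z. z \<in> Omega \<Longrightarrow> \<bar>w z\<bar> \<le> B"
    unfolding w_def using wave_part_bound[OF \<kappa>] by blast
  then have "AE z in cyl. norm (w z) \<le> B"
    using AE_cyl_Omega by (auto elim: eventually_mono)
  then have w: "integrable cyl w" by (rule TX.integrable_const_bound) simp
  then show "integrable cyl (wave_part \<kappa>)" by (simp add: w_def)
  have d: "integrable cyl (\<lambda>z. u z - w z)" using u w by simp
  have p: "integrable (ivl (2 * pi)) p" "periodic p"
    unfolding p_def w_def[symmetric] by (rule kproj_integrable[OF d], rule periodic_kproj)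
  have dm: "(\<integral>z. (u z - w z) * mode j k \<theta> z \<partial>cyl) = (\<integral>z. travel p z * mode j k \<theta> z \<partial>cyl)" if j: "j \<noteq> 0" for j k \<theta>
  proof (cases "j = k")
    case True
    have eq: "mode j j \<theta> z = travel (\<lambda>s. sin (j * s + \<theta>)) z / 2" for z by (rule mode_diag)
    have [measurable]: "(\<lambda>s. sin (real j * s + \<theta>)) \<in> borel_measurable borel" by measurable
    have "(\<integral>z. (u z - w z) * mode j j \<theta> z \<partial>cyl) = pi * (\<integral>s. sin (j * s + \<theta>) * p s \<partial>ivl (2 * pi))"
      unfolding eq p_def w_def[symmetric]
      using travel_adjoint_bounded(2)[OF d, of "\<lambda>s. sin (j * s + \<theta>)" 1] periodic_sin[of j \<theta>] by simp
    then show ?thesis unfolding integral_travel_mode[OF p j] using True by (simp add: mult.commute)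
  next
    case False
    have ne: "(real j)^2 - (real k)^2 \<noteq> 0" using False by (simp add: power2_eq_iff)
    \<comment> \<open>The eigenvalue of the diagonal mode is 0, so the equation itself supplies the
      solvability condition.\<close>
    have "(\<integral>z. \<kappa> z * mode k k \<theta> z \<partial>cyl) = 0" if "k \<noteq> 0" using H[OF that, of k \<theta>] by simp
    from wave_part_mode[OF \<kappa> j False this]
    have "(\<integral>z. w z * mode j k \<theta> z \<partial>cyl) = (\<integral>z. u z * mode j k \<theta> z \<partial>cyl)"
      unfolding w_def using H[OF j, of k \<theta>, symmetric] ne by simp
    moreover have "integrable cyl (\<lambda>z. u z * mode j k \<theta> z)" "integrable cyl (\<lambda>z. w z * mode j k \<theta> z)"
      by (rule integrable_mult_bounded[OF u _ mode_le_1], simp, rule integrable_mult_bounded[OF w _ mode_le_1], simp)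
    ultimately show ?thesis unfolding integral_travel_mode[OF p j] using False by (simp add: left_diff_distrib)
  qed
  have "AE z in cyl. u z - w z - travel p z = 0"
  proof (rule AE_zero_of_orthogonal_modes)
    show "integrable cyl (\<lambda>z. u z - w z - travel p z)" using d integrable_travel[OF p] by simp
    fix j k :: nat and \<theta> :: real assume j: "j \<noteq> 0"
    have "integrable cyl (\<lambda>z. (u z - w z) * mode j k \<theta> z)" "integrable cyl (\<lambda>z. travel p z * mode j k \<theta> z)"
      by (rule integrable_mult_bounded[OF d _ mode_le_1], simp,
        rule integrable_mult_bounded[OF integrable_travel[OF p] _ mode_le_1], simp)
    then show "(\<integral>z. (u z - w z - travel p z) * mode j k \<theta> z \<partial>cyl) = 0"
      using dm[OF j, of k \<theta>] by (simp add: left_diff_distrib[of "_ - _"])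
  qed
  then show "AE z in cyl. u z = wave_part \<kappa> z + travel p z"
    unfolding w_def by eventually_elim simp
qed

subsection \<open>Test functions in \<open>H\<close>\<close>

lemma integral_cos_cos:
  fixes k l :: nat and \<theta> \<phi> :: real
  shows "(\<integral>t. cos (k * t + \<theta>) * cos (l * t + \<phi>) \<partial>ivl (2 * pi))
    = (if k \<noteq> l then 0 else if k = 0 then 2 * pi * cos \<theta> * cos \<phi> else pi * cos (\<theta> - \<phi>))"
proof -
  have "(\<integral>t. cos (real k * t + \<theta>) * cos (real l * t + \<phi>) \<partial>ivl (2 * pi))
    = (\<integral>t. cos (real (k + l) * t + (\<theta> + \<phi>)) / 2 + cos ((real k - real l) * t + (\<theta> - \<phi>)) / 2 \<partial>ivl (2 * pi))"
  proof (intro Bochner_Integration.integral_cong refl)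
    fix t :: real
    have "cos a * cos c = cos (a + c) / 2 + cos (a - c) / 2" for a c :: real
      unfolding cos_add cos_diff by (simp add: field_simps)
    from this[of "real k * t + \<theta>" "real l * t + \<phi>"]
    show "cos (real k * t + \<theta>) * cos (real l * t + \<phi>)
      = cos (real (k + l) * t + (\<theta> + \<phi>)) / 2 + cos ((real k - real l) * t + (\<theta> - \<phi>)) / 2"
      by (simp add: algebra_simps)
  qed
  also have "\<dots> = (\<integral>t. cos (real (k + l) * t + (\<theta> + \<phi>)) / 2 \<partial>ivl (2 * pi))
    + (\<integral>t. cos ((real k - real l) * t + (\<theta> - \<phi>)) / 2 \<partial>ivl (2 * pi))"
    by (intro Bochner_Integration.integral_add integrable_ivl_continuous continuous_intros) auto
  also have "(\<integral>t. cos ((real k - real l) * t + (\<theta> - \<phi>)) / 2 \<partial>ivl (2 * pi))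
    = (if k = l then pi * cos (\<theta> - \<phi>) else 0)"
  proof (cases "l \<le> k")
    case True
    then show ?thesis using integral_cos_period[of "k - l" "\<theta> - \<phi>"] by (simp add: of_nat_diff)
  next
    case False
    have "(real k - real l) * t + (\<theta> - \<phi>) = - (real (l - k) * t + (\<phi> - \<theta>))" for t
      using False by (simp add: of_nat_diff algebra_simps)
    then have "cos ((real k - real l) * t + (\<theta> - \<phi>)) = cos (real (l - k) * t + (\<phi> - \<theta>))" for t
      by (simp only: cos_minus)
    then show ?thesis using integral_cos_period[of "l - k" "\<phi> - \<theta>"] False by simp
  qed
  also have "(\<integral>t. cos (real (k + l) * t + (\<theta> + \<phi>)) / 2 \<partial>ivl (2 * pi))
    = (if k + l = 0 then pi * cos (\<theta> + \<phi>) else 0)"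
    using integral_cos_period[of "k + l" "\<theta> + \<phi>"] by (simp del: of_nat_add)
  finally show ?thesis by (auto simp: cos_add cos_diff algebra_simps)
qed

lemma integral_mode_mode:
  assumes "j \<noteq> 0"
  shows "(\<integral>z. mode j k \<theta> z * mode i l \<phi> z \<partial>cyl) = (if i \<noteq> j \<or> k \<noteq> l then 0
    else if k = 0 then pi\<^sup>2 * cos \<theta> * cos \<phi> else pi\<^sup>2 / 2 * cos (\<theta> - \<phi>))"
proof -
  have "(\<integral>z. mode j k \<theta> z * mode i l \<phi> z \<partial>cyl)
    = (\<integral>z. (\<lambda>t. cos (k * t + \<theta>) * cos (l * t + \<phi>)) (fst z) * (\<lambda>x. sin (j * x) * sin (i * x)) (snd z) \<partial>cyl)"
    by (intro Bochner_Integration.integral_cong) (auto simp: mode_def)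
  also have "\<dots> = (\<integral>t. cos (k * t + \<theta>) * cos (l * t + \<phi>) \<partial>ivl (2 * pi)) * (\<integral>x. sin (j * x) * sin (i * x) \<partial>ivl pi)"
    by (intro integral_cyl_product integrable_ivl_continuous continuous_intros)
  finally show ?thesis
    unfolding integral_cos_cos integral_sin_sin[OF assms] by (auto simp: power2_eq_square)
qed

lemma mode_angle: "mode j k \<theta> z = cos \<theta> * mode j k 0 z - sin \<theta> * mode j k (- pi / 2) z"
  by (simp add: mode_def cos_add cos_diff algebra_simps)

section \<open>Real coefficients, the complex expansion, and the pairing with a mode\<close>

definition mcoef :: "(real \<times> real \<Rightarrow> real) \<Rightarrow> nat \<Rightarrow> nat \<Rightarrow> real \<Rightarrow> real"
  where "mcoef u j k \<theta> = (\<integral>z. u z * mode j k \<theta> z \<partial>M\<^sub>\<Omega>)"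

lemma borel_measurable_Omega: "F \<in> borel_measurable borel \<Longrightarrow> F \<in> borel_measurable M\<^sub>\<Omega>"
  by (intro measurable_restrict_space1 measurable_completion) simp

lemma integrable_mode_mult:
  assumes "integrable M\<^sub>\<Omega> u"
  shows "integrable M\<^sub>\<Omega> (\<lambda>z. u z * mode j k \<theta> z)"
  by (rule integrable_mult_bounded[OF assms borel_measurable_Omega[OF mode_measurable] mode_le_1])

lemma mcoef_angle:
  assumes "integrable M\<^sub>\<Omega> u"
  shows "mcoef u j k \<theta> = cos \<theta> * mcoef u j k 0 - sin \<theta> * mcoef u j k (- pi / 2)"
proof -
  have "mcoef u j k \<theta> = (\<integral>z. cos \<theta> * (u z * mode j k 0 z) - sin \<theta> * (u z * mode j k (- pi / 2) z) \<partial>M\<^sub>\<Omega>)"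
    unfolding mcoef_def by (subst mode_angle) (simp add: algebra_simps)
  then show ?thesis
    using integrable_mode_mult[OF assms] by (simp add: mcoef_def)
qed

text \<open>A sine in t is a cosine with phase - pi / 2, with the sign of k in front; at k = 0 the
  factor \<open>sgn k\<close> correctly kills the imaginary part.\<close>

lemma fourier_coeff_mcoef:
  assumes u: "integrable M\<^sub>\<Omega> u"
  shows "fourier_coeff u j k = Complex (mcoef u j (nat \<bar>k\<bar>) 0 / pi\<^sup>2)
    (- (of_int (sgn k) * mcoef u j (nat \<bar>k\<bar>) (- pi / 2) / pi\<^sup>2))"
proof -
  define G where "G z = complex_of_real (u z * sin (real j * snd z)) * cis (- (real_of_int k * fst z))" for z
  have "(\<lambda>z. complex_of_real (sin (real j * snd z)) * cis (- (real_of_int k * fst z))) \<in> borel_measurable borel"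
    by (intro borel_measurable_continuous_onI continuous_intros)
  note trig_meas = borel_measurable_Omega[OF this]
  have "(\<lambda>z. complex_of_real (u z)) \<in> borel_measurable M\<^sub>\<Omega>"
    by (rule measurable_compose[OF borel_measurable_integrable[OF u] borel_measurable_of_real])
  from borel_measurable_times[OF this trig_meas]
  have Gm: "G \<in> borel_measurable M\<^sub>\<Omega>"
    by (simp add: G_def[abs_def] mult.assoc)
  have G: "integrable M\<^sub>\<Omega> G"
    by (rule Bochner_Integration.integrable_bound[OF u Gm])
      (auto simp: G_def norm_mult abs_mult intro!: mult_left_le)
  have sgn: "sin (real_of_int k * t) = of_int (sgn k) * cos (real (nat \<bar>k\<bar>) * t + (- pi / 2))" for t
    by (cases "k \<ge> 0") (auto simp: cos_add cos_diff sgn_if)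
  have c: "cos (real_of_int k * t) = cos (real (nat \<bar>k\<bar>) * t + 0)" for t
    by (cases "k \<ge> 0") auto
  have "Re (integral\<^sup>L M\<^sub>\<Omega> G) = (\<integral>z. Re (G z) \<partial>M\<^sub>\<Omega>)"
    using G by simp
  also have "\<dots> = mcoef u j (nat \<bar>k\<bar>) 0"
    unfolding mcoef_def by (intro Bochner_Integration.integral_cong) (auto simp: G_def mode_def c)
  finally have re: "Re (integral\<^sup>L M\<^sub>\<Omega> G) = mcoef u j (nat \<bar>k\<bar>) 0" .
  have "Im (integral\<^sup>L M\<^sub>\<Omega> G) = (\<integral>z. Im (G z) \<partial>M\<^sub>\<Omega>)"
    using G by simp
  also have "\<dots> = (\<integral>z. - of_int (sgn k) * (u z * mode j (nat \<bar>k\<bar>) (- pi / 2) z) \<partial>M\<^sub>\<Omega>)"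
    by (intro Bochner_Integration.integral_cong refl) (simp add: G_def mode_def sgn)
  also have "\<dots> = - of_int (sgn k) * mcoef u j (nat \<bar>k\<bar>) (- pi / 2)"
    unfolding mcoef_def by (rule integral_mult_right_zero)
  finally have im: "Im (integral\<^sup>L M\<^sub>\<Omega> G) = - of_int (sgn k) * mcoef u j (nat \<bar>k\<bar>) (- pi / 2)" .
  have "fourier_coeff u j k = integral\<^sup>L M\<^sub>\<Omega> G / complex_of_real (pi\<^sup>2)"
    unfolding fourier_coeff_def G_def by (simp add: case_prod_unfold)
  then show ?thesis
    by (simp add: complex_eq_iff re im Re_divide_of_real Im_divide_of_real del: of_real_power)
qed

lemma integrable_Omega_const: "integrable M\<^sub>\<Omega> (\<lambda>_. c :: real)"
  by (subst integrable_Omega_iff) auto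

lemma L2_integrable:
  assumes "u \<in> L2" shows "integrable M\<^sub>\<Omega> u"
proof (rule Bochner_Integration.integrable_bound[where f="\<lambda>z. 1 + (u z)\<^sup>2"])
  show "integrable M\<^sub>\<Omega> (\<lambda>z. 1 + (u z)\<^sup>2)"
    using assms integrable_Omega_const[of 1] by (auto simp: L2_def)
  have "\<bar>x\<bar> \<le> 1 + x\<^sup>2" for x :: real
    using zero_le_power2[of "\<bar>x\<bar> - 1"] unfolding power2_diff by simp
  then show "AE z in M\<^sub>\<Omega>. norm (u z) \<le> norm (1 + (u z)\<^sup>2)"
    by (intro AE_I2) (simp add: abs_of_nonneg)
qed (use assms in \<open>auto simp: L2_def\<close>)

lemma L2_bounded:
  assumes F: "F \<in> borel_measurable borel" "\<And>z. \<bar>F z\<bar> \<le> B"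
  shows "F \<in> L2"
proof -
  have "\<bar>(F z)\<^sup>2\<bar> \<le> B\<^sup>2" for z
    using power_mono[OF F(2)[of z], of 2] by simp
  then have "integrable cyl (\<lambda>z. (F z)\<^sup>2)"
    using F by (intro integrable_cyl_bounded[of _ "B\<^sup>2"]) auto
  then show ?thesis
    using F borel_measurable_Omega[OF F(1)] by (simp add: L2_def integrable_Omega_iff)
qed

lemma mcoef_borel:
  assumes "F \<in> borel_measurable borel"
  shows "mcoef F j k \<theta> = (\<integral>z. F z * mode j k \<theta> z \<partial>cyl)"
  unfolding mcoef_def by (rule integral_Omega) (use assms in measurable)

lemma fourier_coeff_mode:
  assumes j: "j \<noteq> 0"
  shows "fourier_coeff (mode j k \<theta>) i l = (if i \<noteq> j \<or> nat \<bar>l\<bar> \<noteq> k then 0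
    else if k = 0 then of_real (cos \<theta>) else Complex (cos \<theta> / 2) (of_int (sgn l) * sin \<theta> / 2))"
  unfolding fourier_coeff_mcoef[OF L2_integrable[OF L2_bounded[OF mode_measurable mode_le_1]]]
    mcoef_borel[OF mode_measurable] integral_mode_mode[OF j]
  by (auto simp: complex_eq_iff cos_add)

lemma mode_in_H:
  assumes j: "j \<noteq> 0"
  shows "mode j k \<theta> \<in> H_space b"
proof -
  have "(\<lambda>(i, l). pi\<^sup>2 * H_weight b i l * (cmod (fourier_coeff (mode j k \<theta>) i l))\<^sup>2) summable_on modes"
  proof (rule finite_nonzero_values_imp_summable_on)
    have "{x \<in> modes. (\<lambda>(i, l). pi\<^sup>2 * H_weight b i l * (cmod (fourier_coeff (mode j k \<theta>) i l))\<^sup>2) x \<noteq> 0}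
        \<subseteq> {(j, int k), (j, - int k)}"
      by (auto simp: fourier_coeff_mode[OF j] split: if_splits)
    then show "finite {x \<in> modes. (\<lambda>(i, l). pi\<^sup>2 * H_weight b i l * (cmod (fourier_coeff (mode j k \<theta>) i l))\<^sup>2) x \<noteq> 0}"
      by (rule finite_subset) simp
  qed
  then show ?thesis
    using L2_bounded[OF mode_measurable mode_le_1] by (simp add: H_space_def)
qed

text \<open>A mode has coefficients only at (j, k) and (j, - k), so the series collapses to these.
  At k = 0 the two indices coincide, which is why that case is treated apart.\<close>

lemma L_pairing_mode:
  assumes j: "j \<noteq> 0" and u: "integrable M\<^sub>\<Omega> u"
  shows "L_pairing u (mode j k \<theta>) = ((real j)\<^sup>2 - (real k)\<^sup>2) * mcoef u j k \<theta>"
proof -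
  define T where "T = (\<lambda>(i, l). complex_of_real (eigval i l) * fourier_coeff u i l * cnj (fourier_coeff (mode j k \<theta>) i l))"
  have sub: "{(j, int k), (j, - int k)} \<subseteq> modes" using j by (auto simp: modes_def)
  have "infsum T modes = infsum T {(j, int k), (j, - int k)}"
    using sub by (intro infsum_cong_neutral) (auto simp: T_def fourier_coeff_mode[OF j] split: if_splits)
  also have "\<dots> = sum T {(j, int k), (j, - int k)}" by simp
  finally have T: "infsum T modes = sum T {(j, int k), (j, - int k)}" .
  show ?thesis
  proof (cases "k = 0")
    case True
    then show ?thesis
      unfolding L_pairing_def T_def[symmetric] T mcoef_angle[OF u, of j k \<theta>]
      by (simp add: T_def fourier_coeff_mode[OF j] fourier_coeff_mcoef[OF u] eigval_def mcoef_def mode_def)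
  next
    case False
    define P where "P = pi\<^sup>2"
    have P: "P \<noteq> 0" by (simp add: P_def)
    from False show ?thesis
      unfolding L_pairing_def T_def[symmetric] T mcoef_angle[OF u, of j k \<theta>]
      by (simp add: T_def fourier_coeff_mode[OF j] fourier_coeff_mcoef[OF u] eigval_def P_def[symmetric])
        (use P in \<open>simp add: field_simps\<close>)
  qed
qed

section \<open>Travelling waves with bounded profile as test functions\<close>

lemma integral_sin_sin_period:
  assumes "i \<noteq> 0" "j \<noteq> 0"
  shows "(\<integral>s. sin (real i * s + \<theta>) * sin (real j * s + \<theta>) \<partial>ivl (2 * pi)) = (if i = j then pi else 0)"
proof -
  have "sin (x + \<theta>) = cos (x + (\<theta> - pi / 2))" for x :: real
    by (simp add: cos_add cos_diff sin_add sin_diff)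
  then show ?thesis using assms by (simp add: integral_cos_cos)
qed

text \<open>Bessel's inequality from the square of \<rho> minus its partial sum. The index 0 is
  excluded since sin \<theta> is a constant whose square norm over the period is not pi in
  general.\<close>

lemma bessel_sin:
  assumes m [measurable]: "\<rho> \<in> borel_measurable borel" and b: "\<And>s. \<bar>\<rho> s\<bar> \<le> B"
    and F: "finite F" "0 \<notin> F"
  shows "(\<Sum>j\<in>F. (\<integral>s. \<rho> s * sin (real j * s + \<theta>) \<partial>ivl (2 * pi))\<^sup>2) \<le> pi * (\<integral>s. (\<rho> s)\<^sup>2 \<partial>ivl (2 * pi))"
proof -
  define e where "e j s = sin (real j * s + \<theta>)" for j and s :: real
  define a where "a j = (\<integral>s. \<rho> s * e j s \<partial>ivl (2 * pi))" for j
  have ib: "integrable (ivl (2 * pi)) h" if "h \<in> borel_measurable borel" "\<And>s. \<bar>h s\<bar> \<le> C" for h :: "real \<Rightarrow> real" and C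
    by (rule T.integrable_const_bound[where B=C]) (use that in auto)
  have [measurable]: "e j \<in> borel_measurable borel" for j unfolding e_def[abs_def] by measurable
  have e1: "\<bar>e j s\<bar> \<le> 1" for j s by (simp add: e_def)
  have rr: "integrable (ivl (2 * pi)) \<rho>" by (rule ib[OF m b])
  have r2: "integrable (ivl (2 * pi)) (\<lambda>s. (\<rho> s)\<^sup>2)"
    unfolding power2_eq_square by (rule integrable_mult_bounded[OF rr _ b]) simp
  have re: "integrable (ivl (2 * pi)) (\<lambda>s. \<rho> s * e j s)" for j
    by (rule integrable_mult_bounded[OF rr _ e1]) simp
  have ee: "integrable (ivl (2 * pi)) (\<lambda>s. e i s * e j s)" for i j
    by (rule integrable_mult_bounded[OF ib[OF _ e1] _ e1]) simp_all
  have "0 \<le> (\<integral>s. (\<rho> s - (\<Sum>j\<in>F. a j / pi * e j s))\<^sup>2 \<partial>ivl (2 * pi))"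
    by simp
  also have "\<dots> = (\<integral>s. (\<rho> s)\<^sup>2 - 2 * (\<Sum>j\<in>F. a j / pi * (\<rho> s * e j s))
      + (\<Sum>i\<in>F. \<Sum>j\<in>F. a i / pi * (a j / pi) * (e i s * e j s)) \<partial>ivl (2 * pi))"
    by (intro Bochner_Integration.integral_cong refl)
      (simp add: power2_diff power2_eq_square[of "sum _ _"] sum_product sum_distrib_left mult_ac)
  also have "\<dots> = (\<integral>s. (\<rho> s)\<^sup>2 \<partial>ivl (2 * pi)) - 2 * (\<Sum>j\<in>F. a j / pi * a j)
      + (\<Sum>i\<in>F. \<Sum>j\<in>F. a i / pi * (a j / pi) * (\<integral>s. e i s * e j s \<partial>ivl (2 * pi)))"
    using r2 re ee by (simp add: a_def[symmetric])
  also have "(\<Sum>i\<in>F. \<Sum>j\<in>F. a i / pi * (a j / pi) * (\<integral>s. e i s * e j s \<partial>ivl (2 * pi)))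
      = (\<Sum>i\<in>F. \<Sum>j\<in>F. if i = j then a i / pi * a i else 0)"
  proof (intro sum.cong refl)
    fix i j assume "i \<in> F" "j \<in> F"
    then have "i \<noteq> 0" "j \<noteq> 0" using F(2) by metis+
    then show "a i / pi * (a j / pi) * (\<integral>s. e i s * e j s \<partial>ivl (2 * pi)) = (if i = j then a i / pi * a i else 0)"
      unfolding e_def by (simp add: integral_sin_sin_period)
  qed
  also have "\<dots> = (\<Sum>i\<in>F. a i / pi * a i)"
    using F(1) by simp
  finally have "(\<Sum>i\<in>F. a i / pi * a i) \<le> (\<integral>s. (\<rho> s)\<^sup>2 \<partial>ivl (2 * pi))" by simp
  moreover have "(\<Sum>i\<in>F. a i / pi * a i) = (\<Sum>j\<in>F. (a j)\<^sup>2) / pi"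
    by (simp add: sum_divide_distrib power2_eq_square)
  ultimately have "(\<Sum>j\<in>F. (a j)\<^sup>2) \<le> pi * (\<integral>s. (\<rho> s)\<^sup>2 \<partial>ivl (2 * pi))"
    by (simp add: pos_divide_le_eq mult.commute)
  then show ?thesis by (simp only: a_def e_def)
qed

context
  fixes \<rho> :: "real \<Rightarrow> real" and B :: real
  assumes rho [measurable]: "\<rho> \<in> borel_measurable borel" and per: "periodic \<rho>" and bd: "\<And>s. \<bar>\<rho> s\<bar> \<le> B"
begin

private lemma travel_bounded: "\<bar>travel \<rho> z\<bar> \<le> 2 * B"
  using bd[of "fst z + snd z"] bd[of "fst z - snd z"] by (simp add: travel_def)

private lemma rho_int: "integrable (ivl (2 * pi)) \<rho>"
  by (rule T.integrable_const_bound[where B=B]) (use bd in auto)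

private lemma travel_L2: "travel \<rho> \<in> L2"
  by (rule L2_bounded[OF travel_measurable[OF rho] travel_bounded])

private lemma fourier_coeff_travel:
  assumes "j \<noteq> 0"
  shows "fourier_coeff (travel \<rho>) j k = (if int j = \<bar>k\<bar> then
    Complex ((\<integral>s. \<rho> s * sin (real j * s + 0) \<partial>ivl (2 * pi)) / pi)
      (- (of_int (sgn k) * (\<integral>s. \<rho> s * sin (real j * s + - pi / 2) \<partial>ivl (2 * pi)) / pi)) else 0)"
proof -
  have "j = nat \<bar>k\<bar> \<longleftrightarrow> int j = \<bar>k\<bar>" by auto
  then show ?thesis
  unfolding fourier_coeff_mcoef[OF L2_integrable[OF travel_L2]] mcoef_borel[OF travel_measurable[OF rho]]
    integral_travel_mode[OF rho_int per assms] by (auto simp: power2_eq_square complex_eq_iff)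
qed

text \<open>Only indices with j = |k| occur, and there the weight of H is 1, so square summability
  is all that is required and no regularity of the profile. The index set is the union of the
  half-lines (j, j) and (j, - j), disjoint because j \<ge> 1; on both the summand is the sum of the
  squares of the cosine and sine coefficients of \<rho>.\<close>

lemma travel_in_H: "travel \<rho> \<in> H_space b"
proof -
  define a where "a \<theta> j = (\<integral>s. \<rho> s * sin (real j * s + \<theta>) \<partial>ivl (2 * pi))" for \<theta> j
  define G where "G = (\<lambda>(j, k). pi\<^sup>2 * H_weight b j k * (cmod (fourier_coeff (travel \<rho>) j k))\<^sup>2)"
  have a: "(\<lambda>j. (a \<theta> j)\<^sup>2) summable_on {1..}" for \<theta>
  proof (rule nonneg_bdd_above_summable_on)
    show "bdd_above (sum (\<lambda>j. (a \<theta> j)\<^sup>2) ` {F. F \<subseteq> {1..} \<and> finite F})"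
      unfolding a_def using bessel_sin[OF rho bd, where \<theta>=\<theta>]
      by (intro bdd_aboveI2[where M="pi * (\<integral>s. (\<rho> s)\<^sup>2 \<partial>ivl (2 * pi))"]) auto
  qed simp
  have G: "G (j, k) = (a 0 j)\<^sup>2 + (a (- pi / 2) j)\<^sup>2" if "j \<noteq> 0" "int j = \<bar>k\<bar>" for j k
  proof -
    have "(real_of_int (sgn k))\<^sup>2 = 1" using that by (auto simp: sgn_if)
    then show ?thesis
      using that fourier_coeff_travel[OF that(1), of k]
      by (simp add: G_def H_weight_def cmod_power2 a_def[symmetric] power_divide power_mult_distrib
          add_divide_distrib[symmetric]) (simp add: a_def)
  qed
  have "G summable_on (\<lambda>j. (j, int j)) ` {1..}"
  proof (subst summable_on_reindex)
    have "(\<lambda>j. (a 0 j)\<^sup>2 + (a (- pi / 2) j)\<^sup>2) summable_on {1..}"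
      by (intro summable_on_add a)
    then show "G \<circ> (\<lambda>j. (j, int j)) summable_on {1..}"
      by (rule summable_on_cong[THEN iffD1, rotated]) (simp add: G)
  qed (auto simp: inj_on_def)
  moreover have "G summable_on (\<lambda>j. (j, - int j)) ` {1..}"
  proof (subst summable_on_reindex)
    have "(\<lambda>j. (a 0 j)\<^sup>2 + (a (- pi / 2) j)\<^sup>2) summable_on {1..}"
      by (intro summable_on_add a)
    then show "G \<circ> (\<lambda>j. (j, - int j)) summable_on {1..}"
      by (rule summable_on_cong[THEN iffD1, rotated]) (simp add: G)
  qed (auto simp: inj_on_def)
  ultimately have "G summable_on ((\<lambda>j. (j, int j)) ` {1..} \<union> (\<lambda>j. (j, - int j)) ` {1..})"
    by (rule summable_on_Un_disjoint) auto
  then have "G summable_on modes"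
  proof (rule summable_on_cong_neutral[THEN iffD1, rotated -1])
    fix x assume x: "x \<in> modes - ((\<lambda>j. (j, int j)) ` {1..} \<union> (\<lambda>j. (j, - int j)) ` {1..})"
    obtain j k where jk: "x = (j, k)" by (cases x)
    have "j \<noteq> 0" "int j \<noteq> \<bar>k\<bar>" using x unfolding jk by (auto simp: modes_def image_iff abs_if split: if_splits)
    then show "G x = 0" by (simp add: jk G_def fourier_coeff_travel)
  qed (auto simp: modes_def)
  then show ?thesis using travel_L2 by (simp add: H_space_def G_def)
qed

text \<open>Every term has a vanishing eigenvalue on the diagonal or a vanishing coefficient off it,
  so testing with a travelling wave removes L from the equation.\<close>

lemma L_pairing_travel: "L_pairing u (travel \<rho>) = 0"
proof -
  have "(\<Sum>\<^sub>\<infinity>(j, k)\<in>modes. complex_of_real (eigval j k) * fourier_coeff u j k * cnj (fourier_coeff (travel \<rho>) j k)) = 0"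
  proof (rule infsum_0)
    fix x assume "x \<in> modes"
    then obtain j k where jk: "x = (j, k)" "j \<noteq> 0" by (cases x) (auto simp: modes_def)
    have "eigval j k = 0" if "int j = \<bar>k\<bar>"
    proof -
      have "real j = \<bar>real_of_int k\<bar>" using that by linarith
      then show ?thesis by (simp add: eigval_def)
    qed
    then show "(case x of (j, k) \<Rightarrow> complex_of_real (eigval j k) * fourier_coeff u j k * cnj (fourier_coeff (travel \<rho>) j k)) = 0"
      using jk by (simp add: fourier_coeff_travel)
  qed
  then show ?thesis by (simp add: L_pairing_def)
qed

end

subsection \<open>Boundedness of weak solutions\<close>

text \<open>Continuity is given only over the closed domain; extending f by zero yields a Borel
  function on the whole space, which composes with z \<mapsto> (z, u z).\<close>

lemma nonlinearity_measurable:
  fixes f :: "real \<Rightarrow> real \<Rightarrow> real \<Rightarrow> real"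
  assumes f: "continuous_on (Omega \<times> UNIV) (\<lambda>((t, x), \<xi>). f t x \<xi>)" and u: "u \<in> borel_measurable M\<^sub>\<Omega>"
  shows "(\<lambda>z. f (fst z) (snd z) (u z)) \<in> borel_measurable M\<^sub>\<Omega>"
proof -
  define F where "F y = indicator (Omega \<times> UNIV) y *\<^sub>R (\<lambda>((t, x), \<xi>). f t x \<xi>) y" for y
  have "closed Omega" unfolding Omega_def by (intro closed_Times) auto
  then have F: "F \<in> borel_measurable borel"
    unfolding F_def[abs_def] using f
    by (intro borel_measurable_continuous_on_indicator borel_closed closed_Times) auto
  have id: "(\<lambda>z. z) \<in> borel_measurable M\<^sub>\<Omega>"
    by (rule borel_measurable_Omega) simp
  have "(\<lambda>z. F (z, u z)) \<in> borel_measurable M\<^sub>\<Omega>"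
    by (rule measurable_compose[OF _ F]) (rule borel_measurable_Pair[OF id u])
  moreover have "F (z, u z) = f (fst z) (snd z) (u z)" if "z \<in> space M\<^sub>\<Omega>" for z
    using that by (simp add: F_def space_restrict_space case_prod_unfold)
  ultimately show ?thesis by (rule measurable_cong[THEN iffD1, rotated])
qed

definition source :: "real \<Rightarrow> real \<Rightarrow> (real \<Rightarrow> real \<Rightarrow> real \<Rightarrow> real) \<Rightarrow>
    (real \<times> real \<Rightarrow> real) \<Rightarrow> (real \<times> real \<Rightarrow> real) \<Rightarrow> real \<times> real \<Rightarrow> real"
  where "source b \<epsilon> f u v z = - (b * u z + \<epsilon> * v z + f (fst z) (snd z) (u z))"

section \<open>The truncated sign and its pairing with travelling waves\<close>

definition clip :: "real \<Rightarrow> real \<Rightarrow> real"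
  where "clip K y = (if y > K then 1 else if y < - K then -1 else 0)"

lemma clip_mono: "0 \<le> K \<Longrightarrow> mono (clip K)"
  by (auto simp: mono_def clip_def)

lemma clip_measurable [measurable]: "clip K \<in> borel_measurable borel"
  unfolding clip_def[abs_def] by measurable

lemma clip_le_1: "\<bar>clip K y\<bar> \<le> 1"
  by (simp add: clip_def)

lemma clip_mult: "0 \<le> K \<Longrightarrow> clip K y * y = \<bar>clip K y\<bar> * \<bar>y\<bar>"
  by (auto simp: clip_def)

lemma integral_abs_travel_le:
  assumes m: "\<rho> \<in> borel_measurable borel" and per: "periodic \<rho>" and b: "\<And>s. \<bar>\<rho> s\<bar> \<le> B"
  shows "(\<integral>z. \<bar>travel \<rho> z\<bar> \<partial>cyl) \<le> 2 * pi * (\<integral>s. \<bar>\<rho> s\<bar> \<partial>ivl (2 * pi))"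
    and "integrable cyl (travel \<rho>)"
proof -
  note [measurable] = m
  have i: "integrable (ivl (2 * pi)) \<rho>"
    by (rule T.integrable_const_bound[where B=B]) (use b in auto)
  then have a: "integrable (ivl (2 * pi)) (\<lambda>s. \<bar>\<rho> s\<bar>)" "periodic (\<lambda>s. \<bar>\<rho> s\<bar>)"
    using per by (auto simp: periodic_def)
  show I: "integrable cyl (travel \<rho>)" by (rule integrable_travel[OF i per])
  have "(\<integral>z. \<bar>travel \<rho> z\<bar> \<partial>cyl) \<le> (\<integral>z. \<bar>\<rho> (fst z + 1 * snd z)\<bar> + \<bar>\<rho> (fst z + (-1) * snd z)\<bar> \<partial>cyl)"
    by (intro integral_mono integrable_abs I Bochner_Integration.integrable_add integrable_char[OF a])
      (simp add: travel_def)
  also have "\<dots> = (\<integral>z. \<bar>\<rho> (fst z + 1 * snd z)\<bar> \<partial>cyl) + (\<integral>z. \<bar>\<rho> (fst z + (-1) * snd z)\<bar> \<partial>cyl)"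
    by (intro Bochner_Integration.integral_add integrable_char[OF a])
  also have "\<dots> = 2 * pi * (\<integral>s. \<bar>\<rho> s\<bar> \<partial>ivl (2 * pi))"
    unfolding integral_char[OF a] by simp
  finally show "(\<integral>z. \<bar>travel \<rho> z\<bar> \<partial>cyl) \<le> 2 * pi * (\<integral>s. \<bar>\<rho> s\<bar> \<partial>ivl (2 * pi))" .
qed

text \<open>Write U = (U - w) + w. The first part pairs with the profile exactly by adjointness; the
  bounded part costs at most B times the L1 norm of the travelling wave, which is controlled by the
  two characteristic families.\<close>

lemma travel_test:
  assumes U: "integrable cyl U" and w: "integrable cyl w" "\<And>z. z \<in> Omega \<Longrightarrow> \<bar>w z\<bar> \<le> B"
    and m: "\<rho> \<in> borel_measurable borel" and per: "periodic \<rho>" and b: "\<And>s. \<bar>\<rho> s\<bar> \<le> 1"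
  shows "\<bar>(\<integral>z. U z * travel \<rho> z \<partial>cyl) - 2 * pi * (\<integral>s. \<rho> s * kproj (\<lambda>z. U z - w z) s \<partial>ivl (2 * pi))\<bar>
      \<le> B * (2 * pi * (\<integral>s. \<bar>\<rho> s\<bar> \<partial>ivl (2 * pi)))"
    and "integrable cyl (\<lambda>z. U z * travel \<rho> z)"
proof -
  have d: "integrable cyl (\<lambda>z. U z - w z)" using U w by simp
  note A = travel_adjoint_bounded[OF _ m per b]
  show "integrable cyl (\<lambda>z. U z * travel \<rho> z)" by (rule A(1)[OF U])
  have B: "0 \<le> B" using w(2)[of "(0, 0)"] by (force simp: Omega_def)
  have "(\<integral>z. U z * travel \<rho> z \<partial>cyl) - 2 * pi * (\<integral>s. \<rho> s * kproj (\<lambda>z. U z - w z) s \<partial>ivl (2 * pi))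
    = (\<integral>z. w z * travel \<rho> z \<partial>cyl)"
    unfolding A(2)[OF d, symmetric] using A(1)[OF U] A(1)[OF w(1)] by (simp add: left_diff_distrib)
  also have "\<bar>\<dots>\<bar> \<le> (\<integral>z. \<bar>w z * travel \<rho> z\<bar> \<partial>cyl)" by (rule integral_abs_bound)
  also have "\<dots> \<le> (\<integral>z. B * \<bar>travel \<rho> z\<bar> \<partial>cyl)"
  proof (rule integral_mono_AE)
    show "integrable cyl (\<lambda>z. \<bar>w z * travel \<rho> z\<bar>)" using A(1)[OF w(1)] by simp
    show "integrable cyl (\<lambda>z. B * \<bar>travel \<rho> z\<bar>)" using integral_abs_travel_le(2)[OF m per b] by simp
    show "AE z in cyl. \<bar>w z * travel \<rho> z\<bar> \<le> B * \<bar>travel \<rho> z\<bar>"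
      using AE_cyl_Omega by eventually_elim (simp add: abs_mult mult_right_mono w(2))
  qed
  also have "\<dots> \<le> B * (2 * pi * (\<integral>s. \<bar>\<rho> s\<bar> \<partial>ivl (2 * pi)))"
    using integral_abs_travel_le(1)[OF m per b] B by (simp add: mult_left_mono)
  finally show "\<bar>(\<integral>z. U z * travel \<rho> z \<partial>cyl) - 2 * pi * (\<integral>s. \<rho> s * kproj (\<lambda>z. U z - w z) s \<partial>ivl (2 * pi))\<bar>
      \<le> B * (2 * pi * (\<integral>s. \<bar>\<rho> s\<bar> \<partial>ivl (2 * pi)))" .
qed

text \<open>Both components are truncated at the same level \<open>K\<close>. The coupling term is absorbed because
  \<open>\<bar>r\<bar> \<le> K \<le> \<bar>q\<bar>\<close> where only \<open>q\<close> exceeds \<open>K\<close>.\<close>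

lemma coupled_truncation_bound:
  fixes q r :: "real \<Rightarrow> real"
  assumes q: "integrable M q" and r: "integrable M r" and fin: "finite_measure M"
    and b: "0 < b" and e: "0 \<le> e" "e < b / 4" and C: "0 \<le> C"
    and Q: "\<And>K. 0 < K \<Longrightarrow> b * (\<integral>s. clip K (q s) * q s \<partial>M)
      \<le> C * (\<integral>s. \<bar>clip K (q s)\<bar> \<partial>M) + e * (\<integral>s. \<bar>clip K (q s)\<bar> * \<bar>r s\<bar> \<partial>M)"
    and R: "\<And>K. 0 < K \<Longrightarrow> b * (\<integral>s. clip K (r s) * r s \<partial>M)
      \<le> C * (\<integral>s. \<bar>clip K (r s)\<bar> \<partial>M) + e * (\<integral>s. \<bar>clip K (r s)\<bar> * \<bar>q s\<bar> \<partial>M)"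
  obtains K where "AE s in M. \<bar>q s\<bar> \<le> K" "AE s in M. \<bar>r s\<bar> \<le> K"
proof -
  interpret finite_measure M by fact
  \<comment> \<open>Large enough that C times the measure of a superlevel set is at most b / 4 times
    the integral over it; the 1 keeps K positive when C = 0.\<close>
  define K where "K = 4 * C / b + 1"
  have K: "0 < K" "C / K \<le> b / 4" using b C unfolding K_def by (auto simp: field_simps add_pos_nonneg)
  note [measurable] = borel_measurable_integrable[OF q] borel_measurable_integrable[OF r]
  have int: "integrable M (\<lambda>s. \<bar>clip K (x s)\<bar> * \<bar>y s\<bar>)"
    if [measurable]: "x \<in> borel_measurable M" and "integrable M y" for x y :: "real \<Rightarrow> real"
    using integrable_mult_bounded[of M "\<lambda>s. \<bar>y s\<bar>" "\<lambda>s. \<bar>clip K (x s)\<bar>" 1] that clip_le_1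
    by (simp add: mult.commute)
  have int1: "integrable M (\<lambda>s. \<bar>clip K (x s)\<bar>)" if "x \<in> borel_measurable M" for x :: "real \<Rightarrow> real"
    using int[OF that, of "\<lambda>_. 1"] by simp
  have main: "b * (\<integral>s. \<bar>clip K (x s)\<bar> * \<bar>x s\<bar> \<partial>M) \<le> (b / 4 + e) * (\<integral>s. \<bar>clip K (x s)\<bar> * \<bar>x s\<bar> \<partial>M)
      + e * (\<integral>s. \<bar>clip K (y s)\<bar> * \<bar>y s\<bar> \<partial>M)"
    if x: "integrable M x" and y: "integrable M y"
      and H: "b * (\<integral>s. clip K (x s) * x s \<partial>M)
      \<le> C * (\<integral>s. \<bar>clip K (x s)\<bar> \<partial>M) + e * (\<integral>s. \<bar>clip K (x s)\<bar> * \<bar>y s\<bar> \<partial>M)" for x y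
  proof -
    note [measurable] = borel_measurable_integrable[OF x] borel_measurable_integrable[OF y]
    define a where "a = (\<integral>s. \<bar>clip K (x s)\<bar> \<partial>M)"
    define A where "A = (\<integral>s. \<bar>clip K (x s)\<bar> * \<bar>x s\<bar> \<partial>M)"
    define A' where "A' = (\<integral>s. \<bar>clip K (y s)\<bar> * \<bar>y s\<bar> \<partial>M)"
    have "K * a = (\<integral>s. K * \<bar>clip K (x s)\<bar> \<partial>M)" by (simp add: a_def)
    also have "\<dots> \<le> A" unfolding A_def
      using K by (intro integral_mono integrable_mult_right int1 int x) (auto simp: clip_def)
    finally have Ka: "K * a \<le> A" .
    have "(\<integral>s. \<bar>clip K (x s)\<bar> * \<bar>y s\<bar> \<partial>M) \<le> (\<integral>s. \<bar>clip K (y s)\<bar> * \<bar>y s\<bar> + K * \<bar>clip K (x s)\<bar> \<partial>M)"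
      using K by (intro integral_mono Bochner_Integration.integrable_add integrable_mult_right int1 int x y)
        (auto simp: clip_def)
    also have "\<dots> = A' + K * a"
      unfolding A'_def a_def using int[OF _ y, of y] int1[of x] by simp
    finally have cross: "(\<integral>s. \<bar>clip K (x s)\<bar> * \<bar>y s\<bar> \<partial>M) \<le> A' + A" using Ka by simp
    have "A \<ge> 0" by (simp add: A_def)
    have "C * a \<le> C * (A / K)" using Ka K C by (intro mult_left_mono) (auto simp: field_simps)
    also have "\<dots> \<le> b / 4 * A" using mult_right_mono[OF K(2) \<open>A \<ge> 0\<close>] by simp
    finally have "C * a \<le> b / 4 * A" .
    moreover have "e * (\<integral>s. \<bar>clip K (x s)\<bar> * \<bar>y s\<bar> \<partial>M) \<le> e * (A' + A)"
      using cross e by (intro mult_left_mono)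
    moreover have "(\<integral>s. clip K (x s) * x s \<partial>M) = A"
      unfolding A_def using K by (intro Bochner_Integration.integral_cong) (auto simp: clip_mult)
    ultimately show ?thesis using H
      unfolding A_def[symmetric] A'_def[symmetric] a_def[symmetric] by (simp add: algebra_simps)
  qed
  define A where "A = (\<integral>s. \<bar>clip K (q s)\<bar> * \<bar>q s\<bar> \<partial>M)"
  define A' where "A' = (\<integral>s. \<bar>clip K (r s)\<bar> * \<bar>r s\<bar> \<partial>M)"
  have nn: "A \<ge> 0" "A' \<ge> 0" by (simp_all add: A_def A'_def)
  have "b * A \<le> (b / 4 + e) * A + e * A'" "b * A' \<le> (b / 4 + e) * A' + e * A"
    unfolding A_def A'_def using main[OF q r Q[OF K(1)]] main[OF r q R[OF K(1)]] by auto
  moreover have "(b / 4 + 2 * e) * (A + A') = ((b / 4 + e) * A + e * A') + ((b / 4 + e) * A' + e * A)"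
    "b * (A + A') = b * A + b * A'"
    by algebra+
  ultimately have "b * (A + A') \<le> (b / 4 + 2 * e) * (A + A')" by linarith
  \<comment> \<open>The threshold on e is used here: a quarter of b pays for C, and 2 e < b / 2 pays
    for both coupling terms, so a quarter of b remains.\<close>
  moreover have "(b / 4 + 2 * e) * (A + A') \<le> (3 * b / 4) * (A + A')"
    using e nn by (intro mult_right_mono) auto
  moreover have "b / 4 * (A + A') = b * (A + A') - (3 * b / 4) * (A + A')" by (simp add: field_simps)
  ultimately have "b / 4 * (A + A') \<le> 0" by linarith
  then have "A + A' \<le> 0" using b by (simp add: mult_le_0_iff)
  then have z: "A = 0" "A' = 0" using nn by auto
  have *: "AE s in M. \<bar>x s\<bar> \<le> K" if "integrable M x" "(\<integral>s. \<bar>clip K (x s)\<bar> * \<bar>x s\<bar> \<partial>M) = 0" for x :: "real \<Rightarrow> real"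
  proof -
    have "AE s in M. \<bar>clip K (x s)\<bar> * \<bar>x s\<bar> = 0"
      using that int[OF borel_measurable_integrable[OF that(1)] that(1)]
      by (subst (asm) integral_nonneg_eq_0_iff_AE) auto
    then show ?thesis
      by eventually_elim (use K in \<open>auto simp: clip_def split: if_splits\<close>)
  qed
  show ?thesis
    by (rule that[of K]) (use * q r z in \<open>auto simp: A_def A'_def\<close>)
qed

lemma Linf_bounded:
  assumes "u \<in> borel_measurable M\<^sub>\<Omega>" "0 \<le> C" "AE z in M\<^sub>\<Omega>. \<bar>u z\<bar> \<le> C"
  shows "u \<in> Linf"
proof -
  have "Linf_norm u \<le> ennreal C"
    unfolding Linf_norm_def using assms by (intro INF_lower) auto
  then have "Linf_norm u < \<infinity>" using order.strict_trans1[OF _ ennreal_less_top] by auto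
  then show ?thesis using assms(1) by (simp add: Linf_def)
qed

text \<open>A profile bound holds along both characteristics for almost every point, so the
  travelling wave is at most 2 K. The absolute value around B + 2 K only provides the nonnegative
  bound that \<open>Linf_norm\<close> asks for.\<close>

lemma Linf_of_decomposition:
  assumes U: "AE z in M\<^sub>\<Omega>. u z = w z + travel q z" "u \<in> borel_measurable M\<^sub>\<Omega>"
    and w: "\<And>z. z \<in> Omega \<Longrightarrow> \<bar>w z\<bar> \<le> B"
    and q: "q \<in> borel_measurable borel" "periodic q" "AE s in ivl (2 * pi). \<bar>q s\<bar> \<le> K"
  shows "u \<in> Linf"
proof -
  note [measurable] = q(1)
  have per: "periodic (\<lambda>s. \<bar>q s\<bar> \<le> K)" using q(2) by (simp add: periodic_def)
  have c: "AE z in cyl. \<bar>q (fst z + c * snd z)\<bar> \<le> K" for c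
    by (rule AE_char[OF q(3) _ per]) measurable
  have "AE z in M\<^sub>\<Omega>. \<bar>u z\<bar> \<le> \<bar>B + 2 * K\<bar>"
    using U(1) AE_cyl_Omega[folded AE_Omega_iff] c[of 1, folded AE_Omega_iff] c[of "-1", folded AE_Omega_iff]
  proof eventually_elim
    case (elim z)
    then show ?case using w[of z] by (simp add: travel_def)
  qed
  then show ?thesis by (intro Linf_bounded[OF U(2)]) auto
qed

section \<open>One equation of the system, with the other component as a given function\<close>

context
  fixes b \<epsilon> c\<^sub>0 p :: real and f :: "real \<Rightarrow> real \<Rightarrow> real \<Rightarrow> real" and u v :: "real \<times> real \<Rightarrow> real"
  assumes c0: "c\<^sub>0 > 0" and p1: "p > 1"
    and adm: "admissible_nonlinearity c\<^sub>0 p f"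
    and uH: "u \<in> H_space b" and vH: "v \<in> H_space b"
    and weak: "\<forall>\<phi>\<in>H_space b.
       integrable M\<^sub>\<Omega> (\<lambda>(t, x). f t x (u (t, x)) * \<phi> (t, x)) \<and>
       L_pairing u \<phi> +
         (\<integral>(t, x). b * u (t, x) * \<phi> (t, x) + \<epsilon> * v (t, x) * \<phi> (t, x)
            + f t x (u (t, x)) * \<phi> (t, x) \<partial>M\<^sub>\<Omega>) = 0"
begin

private lemma u_int: "integrable M\<^sub>\<Omega> u" and v_int: "integrable M\<^sub>\<Omega> v"
  using uH vH by (auto simp: H_space_def intro: L2_integrable)

private lemma growth: "z \<in> Omega \<Longrightarrow> \<bar>f (fst z) (snd z) \<xi>\<bar> \<le> c\<^sub>0 * (1 + \<bar>\<xi>\<bar> powr p)"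
  using adm by (cases z) (auto simp: admissible_nonlinearity_def)

private lemma f_mono: "z \<in> Omega \<Longrightarrow> \<xi> \<le> \<eta> \<Longrightarrow> f (fst z) (snd z) \<xi> \<le> f (fst z) (snd z) \<eta>"
  using adm by (cases z) (auto simp: admissible_nonlinearity_def mono_def)

private lemma growth_bounded:
  assumes "z \<in> Omega" "\<bar>\<xi>\<bar> \<le> B"
  shows "\<bar>f (fst z) (snd z) \<xi>\<bar> \<le> c\<^sub>0 * (1 + B powr p)"
proof -
  have "\<bar>\<xi>\<bar> powr p \<le> B powr p" using assms(2) p1 by (intro powr_mono2) auto
  then have "c\<^sub>0 * (1 + \<bar>\<xi>\<bar> powr p) \<le> c\<^sub>0 * (1 + B powr p)" using c0 by simp
  with growth[OF assms(1), of \<xi>] show ?thesis by linarith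
qed

text \<open>Since u itself is in H, the weak formulation makes f(t, x, u) u integrable. It dominates
  |f(t, x, u)| where |u| > 1; where |u| \<le> 1 the growth condition gives a constant.\<close>

private lemma f_int: "integrable M\<^sub>\<Omega> (\<lambda>z. f (fst z) (snd z) (u z))"
proof (rule Bochner_Integration.integrable_bound)
  have "integrable M\<^sub>\<Omega> (\<lambda>z. f (fst z) (snd z) (u z) * u z)"
    using weak uH by (auto simp: case_prod_unfold)
  then show "integrable M\<^sub>\<Omega> (\<lambda>z. c\<^sub>0 * (1 + 1 powr p) + \<bar>f (fst z) (snd z) (u z) * u z\<bar>)"
    by (intro Bochner_Integration.integrable_add integrable_abs integrable_Omega_const)
  show "(\<lambda>z. f (fst z) (snd z) (u z)) \<in> borel_measurable M\<^sub>\<Omega>"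
    by (rule nonlinearity_measurable[OF conjunct1[OF adm[unfolded admissible_nonlinearity_def]]
        borel_measurable_integrable[OF u_int]])
  have "AE z in M\<^sub>\<Omega>. z \<in> Omega" using AE_space[of "M\<^sub>\<Omega>"] by (simp add: space_restrict_space)
  then show "AE z in M\<^sub>\<Omega>. norm (f (fst z) (snd z) (u z))
      \<le> norm (c\<^sub>0 * (1 + 1 powr p) + \<bar>f (fst z) (snd z) (u z) * u z\<bar>)"
  proof eventually_elim
    case (elim z)
    have "\<bar>f (fst z) (snd z) (u z)\<bar> \<le> c\<^sub>0 * (1 + 1 powr p) + \<bar>f (fst z) (snd z) (u z) * u z\<bar>"
    proof (cases "\<bar>u z\<bar> \<le> 1")
      case True
      then show ?thesis using growth_bounded[OF elim True] by linarith
    next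
      case False
      then have "\<bar>f (fst z) (snd z) (u z)\<bar> * 1 \<le> \<bar>f (fst z) (snd z) (u z)\<bar> * \<bar>u z\<bar>"
        by (intro mult_left_mono) auto
      moreover have "c\<^sub>0 * (1 + 1 powr p) \<ge> 0" using c0 by simp
      ultimately show ?thesis by (simp add: abs_mult)
    qed
    then show ?case by simp
  qed
qed

lemma source_integrable: "integrable M\<^sub>\<Omega> (source b \<epsilon> f u v)"
  unfolding source_def using u_int v_int f_int by simp

private lemma weak_source:
  assumes "\<phi> \<in> H_space b"
  shows "L_pairing u \<phi> = (\<integral>z. source b \<epsilon> f u v z * \<phi> z \<partial>M\<^sub>\<Omega>)"
proof -
  have "(\<integral>(t, x). b * u (t, x) * \<phi> (t, x) + \<epsilon> * v (t, x) * \<phi> (t, x) + f t x (u (t, x)) * \<phi> (t, x) \<partial>M\<^sub>\<Omega>)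
    = (\<integral>z. - (source b \<epsilon> f u v z * \<phi> z) \<partial>M\<^sub>\<Omega>)"
    by (intro Bochner_Integration.integral_cong) (auto simp: source_def algebra_simps)
  moreover have "L_pairing u \<phi> + (\<integral>(t, x). b * u (t, x) * \<phi> (t, x) + \<epsilon> * v (t, x) * \<phi> (t, x)
     + f t x (u (t, x)) * \<phi> (t, x) \<partial>M\<^sub>\<Omega>) = 0"
    using weak assms by blast
  ultimately show ?thesis by simp
qed

lemma source_mode:
  assumes "j \<noteq> 0"
  shows "((real j)\<^sup>2 - (real k)\<^sup>2) * mcoef u j k \<theta> = mcoef (source b \<epsilon> f u v) j k \<theta>"
  using weak_source[OF mode_in_H[OF assms]] L_pairing_mode[OF assms u_int] by (simp add: mcoef_def)

lemma source_travel:
  assumes "\<rho> \<in> borel_measurable borel" "periodic \<rho>" "\<And>s. \<bar>\<rho> s\<bar> \<le> B"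
  shows "(\<integral>z. source b \<epsilon> f u v z * travel \<rho> z \<partial>M\<^sub>\<Omega>) = 0"
  using weak_source[OF travel_in_H[OF assms]] L_pairing_travel[OF assms, of u] by simp

text \<open>Where \<open>travel \<rho> \<ge> 0\<close> also \<open>travel q \<ge> 0\<close>, so \<open>u \<ge> w\<close> and monotonicity of \<open>f\<close> replaces
  \<open>u\<close> by the bounded part \<open>w\<close>; where \<open>travel \<rho> \<le> 0\<close> all signs are reversed.\<close>

lemma source_travel_upper:
  assumes dec: "AE z in M\<^sub>\<Omega>. u z = w z + travel q z" and w: "\<And>z. z \<in> Omega \<Longrightarrow> \<bar>w z\<bar> \<le> B"
    and g: "mono g"
  defines "\<rho> \<equiv> \<lambda>s. g (q s)"
  shows "AE z in M\<^sub>\<Omega>. source b \<epsilon> f u v z * travel \<rho> z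
    \<le> c\<^sub>0 * (1 + B powr p) * \<bar>travel \<rho> z\<bar> - b * (u z * travel \<rho> z) - \<epsilon> * (v z * travel \<rho> z)"
proof -
  have "AE z in M\<^sub>\<Omega>. z \<in> Omega" using AE_space[of "M\<^sub>\<Omega>"] by (simp add: space_restrict_space)
  with dec show ?thesis
  proof eventually_elim
    case (elim z)
    define C where "C = c\<^sub>0 * (1 + B powr p)"
    have fw: "\<bar>f (fst z) (snd z) (w z)\<bar> \<le> C"
      unfolding C_def by (rule growth_bounded[OF elim(2) w[OF elim(2)]])
    have "- (f (fst z) (snd z) (u z) * travel \<rho> z) \<le> C * \<bar>travel \<rho> z\<bar>"
    proof (cases "travel \<rho> z > 0")
      case True
      then have "\<not> q (fst z + snd z) \<le> q (fst z - snd z)"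
        using monoD[OF g, of "q (fst z + snd z)" "q (fst z - snd z)"] by (auto simp: travel_def \<rho>_def)
      then have "w z \<le> u z" using elim(1) by (simp add: travel_def)
      then have "- f (fst z) (snd z) (u z) \<le> C" using f_mono[OF elim(2), of "w z" "u z"] fw by linarith
      then have "- f (fst z) (snd z) (u z) * travel \<rho> z \<le> C * travel \<rho> z"
        using True by (intro mult_right_mono) auto
      then show ?thesis using True by simp
    next
      case False
      show ?thesis
      proof (cases "travel \<rho> z = 0")
        case ne: False
        then have "travel \<rho> z < 0" using False by simp
        then have "\<not> q (fst z - snd z) \<le> q (fst z + snd z)"
          using monoD[OF g, of "q (fst z - snd z)" "q (fst z + snd z)"] by (auto simp: travel_def \<rho>_def)
        then have "u z \<le> w z" using elim(1) by (simp add: travel_def)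
        then have "f (fst z) (snd z) (u z) \<le> C" using f_mono[OF elim(2), of "u z" "w z"] fw by linarith
        then have "f (fst z) (snd z) (u z) * - travel \<rho> z \<le> C * - travel \<rho> z"
          using False by (intro mult_right_mono) auto
        then show ?thesis using False by simp
      qed simp
    qed
    moreover have "source b \<epsilon> f u v z * travel \<rho> z
        = - (f (fst z) (snd z) (u z) * travel \<rho> z) - b * (u z * travel \<rho> z) - \<epsilon> * (v z * travel \<rho> z)"
      by (simp add: source_def algebra_simps)
    ultimately show ?case unfolding C_def by linarith
  qed
qed


text \<open>Borel representatives of the solution and of its source satisfy the coefficient
  identities, so the splitting on \<open>cyl\<close> applies. The profile is expressed through the
  representative \<open>U\<close>, which makes it a Borel function.\<close>

lemma solution_decomposition:
  obtains U w B where
    "integrable cyl U" "AE z in M\<^sub>\<Omega>. u z = U z"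
    "integrable cyl w" "\<And>z. z \<in> Omega \<Longrightarrow> \<bar>w z\<bar> \<le> B"
    "AE z in M\<^sub>\<Omega>. u z = w z + travel (kproj (\<lambda>z. U z - w z)) z"
proof -
  have u: "integrable M\<^sub>\<Omega> u" using uH by (auto simp: H_space_def intro: L2_integrable)
  note s = source_integrable
  obtain U where [measurable]: "U \<in> borel_measurable borel" and U: "AE z in M\<^sub>\<Omega>. u z = U z"
    using borel_representative[OF borel_measurable_integrable[OF u]] by blast
  obtain S where [measurable]: "S \<in> borel_measurable borel" and S: "AE z in M\<^sub>\<Omega>. source b \<epsilon> f u v z = S z"
    using borel_representative[OF borel_measurable_integrable[OF s]] by blast
  have bm: "U \<in> borel_measurable M\<^sub>\<Omega>" "S \<in> borel_measurable M\<^sub>\<Omega>" "mode j k \<theta> \<in> borel_measurable M\<^sub>\<Omega>" for j k \<theta>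
    by (simp_all add: borel_measurable_Omega)
  have iU: "integrable cyl U"
    using integrable_cong_AE[OF borel_measurable_integrable[OF u] bm(1) U] u by (simp add: integrable_Omega_iff)
  have iS: "integrable cyl S"
    using integrable_cong_AE[OF borel_measurable_integrable[OF s] bm(2) S] s by (simp add: integrable_Omega_iff)
  have H: "((real j)^2 - (real k)^2) * (\<integral>z. U z * mode j k \<theta> z \<partial>cyl) = (\<integral>z. S z * mode j k \<theta> z \<partial>cyl)"
    if "j \<noteq> 0" for j k \<theta>
  proof -
    have "mcoef u j k \<theta> = mcoef U j k \<theta>"
      unfolding mcoef_def
      by (intro integral_cong_AE borel_measurable_times bm borel_measurable_integrable[OF u])
        (use U in \<open>auto elim: eventually_mono\<close>)
    moreover have "mcoef (source b \<epsilon> f u v) j k \<theta> = mcoef S j k \<theta>"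
      unfolding mcoef_def
      by (intro integral_cong_AE borel_measurable_times bm borel_measurable_integrable[OF s])
        (use S in \<open>auto elim: eventually_mono\<close>)
    ultimately show ?thesis
      using source_mode[OF that, of k \<theta>] by (simp add: mcoef_borel)
  qed
  have D: "AE z in cyl. U z = wave_part S z + travel (kproj (\<lambda>z. U z - wave_part S z)) z"
    "integrable cyl (wave_part S)"
    by (rule wave_decomposition[OF iU iS], rule H, assumption)+
  show ?thesis
  proof (rule that[OF iU U D(2) wave_part_bound[OF iS]])
    show "AE z in M\<^sub>\<Omega>. u z = wave_part S z + travel (kproj (\<lambda>z. U z - wave_part S z)) z"
      using U D(1)[folded AE_Omega_iff] by eventually_elim simp
  qed
qed

text \<open>The source is orthogonal to T = travel \<rho>, so its pointwise upper bound has
  nonnegative integral. In the constant, \<open>c\<^sub>0 * (1 + B powr p)\<close> bounds f at the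
  bounded part w, b B comes from w inside b u, and the term with B' from w' inside the coupling.
  None of these depends on K, which is what allows K to be chosen afterwards.\<close>

lemma kernel_estimate:
  assumes U: "integrable cyl U" "AE z in M\<^sub>\<Omega>. u z = U z"
    and w: "integrable cyl w" "\<And>z. z \<in> Omega \<Longrightarrow> \<bar>w z\<bar> \<le> B"
    and dec: "AE z in M\<^sub>\<Omega>. u z = w z + travel (kproj (\<lambda>z. U z - w z)) z"
    and V: "integrable cyl V" "AE z in M\<^sub>\<Omega>. v z = V z"
    and w': "integrable cyl w'" "\<And>z. z \<in> Omega \<Longrightarrow> \<bar>w' z\<bar> \<le> B'"
    and b: "0 < b" and K: "0 < K"
  defines "q \<equiv> kproj (\<lambda>z. U z - w z)" and "r \<equiv> kproj (\<lambda>z. V z - w' z)"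
  shows "b * (\<integral>s. clip K (q s) * q s \<partial>ivl (2 * pi))
    \<le> (c\<^sub>0 * (1 + B powr p) + b * B + \<bar>\<epsilon>\<bar> * B') * (\<integral>s. \<bar>clip K (q s)\<bar> \<partial>ivl (2 * pi))
      + \<bar>\<epsilon>\<bar> * (\<integral>s. \<bar>clip K (q s)\<bar> * \<bar>r s\<bar> \<partial>ivl (2 * pi))"
proof -
  define \<rho> where "\<rho> s = clip K (q s)" for s
  define C where "C = c\<^sub>0 * (1 + B powr p)"
  have q: "integrable (ivl (2 * pi)) q" unfolding q_def using U w by (intro kproj_integrable) simp
  have r: "integrable (ivl (2 * pi)) r" unfolding r_def using V w' by (intro kproj_integrable) simp
  have [measurable]: "q \<in> borel_measurable borel" "r \<in> borel_measurable borel"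
    using borel_measurable_integrable[OF q] borel_measurable_integrable[OF r] by simp_all
  have \<rho>: "\<rho> \<in> borel_measurable borel" "periodic \<rho>" "\<And>s. \<bar>\<rho> s\<bar> \<le> 1"
    using periodic_kproj[of "\<lambda>z. U z - w z"] clip_le_1
    by (simp_all add: \<rho>_def[abs_def] periodic_def q_def[symmetric])
  define a where "a = 2 * pi * (\<integral>s. \<bar>\<rho> s\<bar> \<partial>ivl (2 * pi))"
  define T where "T = travel \<rho>"
  note TU = travel_test[OF U(1) w \<rho>, folded q_def a_def T_def]
  note TV = travel_test[OF V(1) w' \<rho>, folded r_def a_def T_def]
  note Ta = integral_abs_travel_le[OF \<rho>, folded a_def T_def]
  note s = source_integrable
  have [measurable]: "U \<in> borel_measurable borel" "V \<in> borel_measurable borel" "T \<in> borel_measurable borel"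
    using borel_measurable_integrable[OF U(1)] borel_measurable_integrable[OF V(1)] borel_measurable_integrable[OF Ta(2)] by simp_all
  have "\<bar>T z\<bar> \<le> 2" for z
    using \<rho>(3)[of "fst z + snd z"] \<rho>(3)[of "fst z - snd z"] unfolding T_def travel_def by linarith
  then have sT: "integrable M\<^sub>\<Omega> (\<lambda>z. source b \<epsilon> f u v z * T z)"
    by (intro integrable_mult_bounded[OF s] borel_measurable_Omega) measurable
  have "0 = (\<integral>z. source b \<epsilon> f u v z * T z \<partial>M\<^sub>\<Omega>)"
    unfolding T_def by (rule source_travel[OF \<rho>, symmetric])
  also have "\<dots> \<le> (\<integral>z. C * \<bar>T z\<bar> - b * (U z * T z) - \<epsilon> * (V z * T z) \<partial>M\<^sub>\<Omega>)"
  proof (rule integral_mono_AE[OF sT])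
    show "integrable M\<^sub>\<Omega> (\<lambda>z. C * \<bar>T z\<bar> - b * (U z * T z) - \<epsilon> * (V z * T z))"
      using TU(2) TV(2) Ta(2) by (subst integrable_Omega_iff) simp_all
    have "AE z in M\<^sub>\<Omega>. source b \<epsilon> f u v z * T z \<le> C * \<bar>T z\<bar> - b * (u z * T z) - \<epsilon> * (v z * T z)"
      using source_travel_upper[OF dec w(2) clip_mono[of K]] K
      unfolding C_def T_def \<rho>_def[abs_def] q_def by simp
    with U(2) V(2) show "AE z in M\<^sub>\<Omega>. source b \<epsilon> f u v z * T z \<le> C * \<bar>T z\<bar> - b * (U z * T z) - \<epsilon> * (V z * T z)"
      by eventually_elim simp
  qed
  also have "\<dots> = (\<integral>z. C * \<bar>T z\<bar> - b * (U z * T z) - \<epsilon> * (V z * T z) \<partial>cyl)"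
    by (rule integral_Omega) measurable
  also have "\<dots> = C * (\<integral>z. \<bar>T z\<bar> \<partial>cyl) - b * (\<integral>z. U z * T z \<partial>cyl) - \<epsilon> * (\<integral>z. V z * T z \<partial>cyl)"
    using TU(2) TV(2) Ta(2) by simp
  finally have "b * (\<integral>z. U z * T z \<partial>cyl) \<le> C * (\<integral>z. \<bar>T z\<bar> \<partial>cyl) - \<epsilon> * (\<integral>z. V z * T z \<partial>cyl)" by simp
  moreover have "C * (\<integral>z. \<bar>T z\<bar> \<partial>cyl) \<le> C * a"
    using Ta(1) c0 by (intro mult_left_mono) (auto simp: C_def)
  moreover have "- \<epsilon> * (\<integral>z. V z * T z \<partial>cyl) \<le> \<bar>\<epsilon>\<bar> * (B' * a + 2 * pi * (\<integral>s. \<bar>\<rho> s\<bar> * \<bar>r s\<bar> \<partial>ivl (2 * pi)))"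
  proof -
    have "\<bar>\<integral>s. \<rho> s * r s \<partial>ivl (2 * pi)\<bar> \<le> (\<integral>s. \<bar>\<rho> s\<bar> * \<bar>r s\<bar> \<partial>ivl (2 * pi))"
      using integral_abs_bound[of "ivl (2 * pi)" "\<lambda>s. \<rho> s * r s"] by (simp add: abs_mult)
    then have "\<bar>2 * pi * (\<integral>s. \<rho> s * r s \<partial>ivl (2 * pi))\<bar> \<le> 2 * pi * (\<integral>s. \<bar>\<rho> s\<bar> * \<bar>r s\<bar> \<partial>ivl (2 * pi))"
      by (simp add: abs_mult)
    with TV(1) have "\<bar>\<integral>z. V z * T z \<partial>cyl\<bar> \<le> B' * a + 2 * pi * (\<integral>s. \<bar>\<rho> s\<bar> * \<bar>r s\<bar> \<partial>ivl (2 * pi))"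
      by linarith
    then have "\<bar>\<epsilon>\<bar> * \<bar>\<integral>z. V z * T z \<partial>cyl\<bar> \<le> \<bar>\<epsilon>\<bar> * (B' * a + 2 * pi * (\<integral>s. \<bar>\<rho> s\<bar> * \<bar>r s\<bar> \<partial>ivl (2 * pi)))"
      by (intro mult_left_mono) auto
    moreover have "- \<epsilon> * (\<integral>z. V z * T z \<partial>cyl) \<le> \<bar>\<epsilon>\<bar> * \<bar>\<integral>z. V z * T z \<partial>cyl\<bar>"
      by (metis abs_ge_self abs_minus_cancel abs_mult)
    ultimately show ?thesis by linarith
  qed
  \<comment> \<open>The error from the bounded part is placed on the favourable side; multiplying by
    b keeps the inequality because b is positive.\<close>
  moreover have "b * (2 * pi * (\<integral>s. \<rho> s * q s \<partial>ivl (2 * pi)) - B * a) \<le> b * (\<integral>z. U z * T z \<partial>cyl)"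
    using TU(1) b by (intro mult_left_mono) auto
  ultimately have "2 * pi * (b * (\<integral>s. \<rho> s * q s \<partial>ivl (2 * pi)))
    \<le> C * a + b * (B * a) + \<bar>\<epsilon>\<bar> * (B' * a + 2 * pi * (\<integral>s. \<bar>\<rho> s\<bar> * \<bar>r s\<bar> \<partial>ivl (2 * pi)))"
    by (simp add: algebra_simps)
  also have "\<dots> = 2 * pi * ((C + b * B + \<bar>\<epsilon>\<bar> * B') * (\<integral>s. \<bar>\<rho> s\<bar> \<partial>ivl (2 * pi))
      + \<bar>\<epsilon>\<bar> * (\<integral>s. \<bar>\<rho> s\<bar> * \<bar>r s\<bar> \<partial>ivl (2 * pi)))"
    by (simp add: a_def algebra_simps)
  finally show ?thesis
    unfolding \<rho>_def C_def by (subst (asm) mult_le_cancel_left_pos) simp_all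
qed

end

text \<open>Quantifying over all nontrivial weak solutions includes the one furnished by local
  linking. The threshold b / 4 is the one required by \<open>coupled_truncation_bound\<close> and is
  uniform in the solution, whereas the bounds on u and v depend on the solution.\<close>

theorem theorem1p4:
  fixes b c\<^sub>0 p q :: real
    and f g :: "real \<Rightarrow> real \<Rightarrow> real \<Rightarrow> real"
  assumes "b > 0" and "- b \<notin> spectrum_L"
    and "p > 1" and "q > 1" and "c\<^sub>0 > 0"
    and "admissible_nonlinearity c\<^sub>0 p f"
    and "admissible_nonlinearity c\<^sub>0 q g"
  shows "\<exists>\<epsilon>\<^sub>0>0. \<forall>\<epsilon>. \<bar>\<epsilon>\<bar> < \<epsilon>\<^sub>0 \<longrightarrow>
    (\<forall>u v. weak_solution b \<epsilon> f g u v \<and> nontrivial_pair u v \<longrightarrow> u \<in> Linf \<and> v \<in> Linf)"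
proof (intro exI[of _ "b / 4"] conjI allI impI)
  show "0 < b / 4" using assms(1) by simp
  fix \<epsilon> u v assume e: "\<bar>\<epsilon>\<bar> < b / 4" and uv: "weak_solution b \<epsilon> f g u v \<and> nontrivial_pair u v"
  have H: "u \<in> H_space b" "v \<in> H_space b" using uv by (auto simp: weak_solution_def)
  note wu = conjunct1[OF conjunct2[OF conjunct2[OF conjunct1[OF uv, unfolded weak_solution_def]]]]
  note wv = conjunct2[OF conjunct2[OF conjunct2[OF conjunct1[OF uv, unfolded weak_solution_def]]]]
  note Cu = assms(5,3,6) H wu
  \<comment> \<open>The second equation is the first with f, p and g, q exchanged and u, v
    swapped.\<close>
  note Cv = assms(5,4,7) H(2,1) wv
  obtain U w B where U: "integrable cyl U" "AE z in M\<^sub>\<Omega>. u z = U z"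
    and w: "integrable cyl w" "\<And>z. z \<in> Omega \<Longrightarrow> \<bar>w z\<bar> \<le> B"
    and decu: "AE z in M\<^sub>\<Omega>. u z = w z + travel (kproj (\<lambda>z. U z - w z)) z"
    by (rule solution_decomposition[OF Cu]) (rule that; (assumption | blast))
  obtain V w' B' where V: "integrable cyl V" "AE z in M\<^sub>\<Omega>. v z = V z"
    and w': "integrable cyl w'" "\<And>z. z \<in> Omega \<Longrightarrow> \<bar>w' z\<bar> \<le> B'"
    and decv: "AE z in M\<^sub>\<Omega>. v z = w' z + travel (kproj (\<lambda>z. V z - w' z)) z"
    by (rule solution_decomposition[OF Cv]) (rule that; (assumption | blast))
  define r where "r = kproj (\<lambda>z. U z - w z)"
  define r' where "r' = kproj (\<lambda>z. V z - w' z)"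
  have r: "integrable (ivl (2 * pi)) r" unfolding r_def using U w by (intro kproj_integrable) simp
  have r': "integrable (ivl (2 * pi)) r'" unfolding r'_def using V w' by (intro kproj_integrable) simp
  have B: "0 \<le> B" using w(2)[of "(0, 0)"] by (force simp: Omega_def)
  have B': "0 \<le> B'" using w'(2)[of "(0, 0)"] by (force simp: Omega_def)
  define C where "C = c\<^sub>0 * (1 + B powr p) + b * B + \<bar>\<epsilon>\<bar> * B'"
  define C' where "C' = c\<^sub>0 * (1 + B' powr q) + b * B' + \<bar>\<epsilon>\<bar> * B"
  have C: "0 \<le> C" "0 \<le> C'" using assms(1,5) B B' by (auto simp: C_def C'_def)
  \<comment> \<open>Both inequalities are weakened to the common constant C + C', so that a single
    level K serves for both profiles.\<close>
  have Q: "b * (\<integral>s. clip K (r s) * r s \<partial>ivl (2 * pi)) \<le> (C + C') * (\<integral>s. \<bar>clip K (r s)\<bar> \<partial>ivl (2 * pi))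
      + \<bar>\<epsilon>\<bar> * (\<integral>s. \<bar>clip K (r s)\<bar> * \<bar>r' s\<bar> \<partial>ivl (2 * pi))" if "0 < K" for K
    using kernel_estimate[OF Cu U w decu V w' assms(1) that, folded r_def r'_def C_def]
      mult_nonneg_nonneg[OF C(2), of "\<integral>s. \<bar>clip K (r s)\<bar> \<partial>ivl (2 * pi)"]
    unfolding distrib_right[of C] by simp
  have R: "b * (\<integral>s. clip K (r' s) * r' s \<partial>ivl (2 * pi)) \<le> (C + C') * (\<integral>s. \<bar>clip K (r' s)\<bar> \<partial>ivl (2 * pi))
      + \<bar>\<epsilon>\<bar> * (\<integral>s. \<bar>clip K (r' s)\<bar> * \<bar>r s\<bar> \<partial>ivl (2 * pi))" if "0 < K" for K
    using kernel_estimate[OF Cv V w' decv U w assms(1) that, folded r_def r'_def C'_def]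
      mult_nonneg_nonneg[OF C(1), of "\<integral>s. \<bar>clip K (r' s)\<bar> \<partial>ivl (2 * pi)"]
    unfolding distrib_right[of C] by simp
  obtain K where K: "AE s in ivl (2 * pi). \<bar>r s\<bar> \<le> K" "AE s in ivl (2 * pi). \<bar>r' s\<bar> \<le> K"
    using coupled_truncation_bound[OF r r' finite_measure_ivl assms(1) _ e add_nonneg_nonneg[OF C] Q R]
    by auto
  have m: "u \<in> borel_measurable M\<^sub>\<Omega>" "v \<in> borel_measurable M\<^sub>\<Omega>" using H by (auto simp: H_space_def L2_def)
  have mr: "r \<in> borel_measurable borel" "r' \<in> borel_measurable borel"
    using borel_measurable_integrable[OF r] borel_measurable_integrable[OF r'] by simp_all
  show "u \<in> Linf"
    by (rule Linf_of_decomposition[OF decu[folded r_def] m(1) w(2) mr(1) _ K(1)])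
      (simp_all add: r_def periodic_kproj)
  show "v \<in> Linf"
    by (rule Linf_of_decomposition[OF decv[folded r'_def] m(2) w'(2) mr(2) _ K(2)])
      (simp_all add: r'_def periodic_kproj)
qed

end
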